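(* Let $n\ge1$, let $\mathbf{m}\in\mathbb{H}_n$ be a Hessenberg function (natural unit interval order on $[n]$), let $\lambda\vdash n$ be a partition and let $1\le k\le n$. Then the quotient $c_{\lambda,k}(\mathbf{m};q)/[k]_q\in\mathbb{Q}(q)$ is a polynomial in $q$.
   Context: Notation: $[n]=\{1,\dots,n\}$, $[k]_q=1+q+\cdots+q^{k-1}$, $[k]_q!=\prod_{i=1}^k[i]_q$. $\mathrm{SYT}(\lambda)$ is the set of standard Young tableaux of shape $\lambda$ (English notation), $\mathrm{SYT}(n)=\bigcup_{\lambda\vdash n}\mathrm{SYT}(\lambda)$, and for $\lambda\vdash n$, $\mathrm{SYT}_k(\lambda)$ is the set of $T\in\mathrm{SYT}(\lambda)$ whose entry $n$ lies in column $k$. A Hessenberg function of length $n$ is a weakly increasing map $\mathbf{m}:[n]\to[n]$ with $i\le\mathbf{m}(i)$ for all $i$; $\mathbb{H}_n$ is the set of these. For $T\in\mathrm{SYT}(n)$ and $0\le r\le n$, let $\delta^{(r)}(T)=(\delta_1,\dots,\delta_n)$ where $\delta_i=1$ if column $i$ of $T$ contains an integer greater than $r$ and $\delta_i=0$ otherwise. Write uniquely $\delta^{(r)}(T)=(1^{b_0},0^{a_1},1^{b_1},\dots,0^{a_l},1^{b_l},0^{a_{l+1}})$ with $a_1,\dots,a_l,b_1,\dots,b_l$ positive and $b_0,a_{l+1}$ nonnegative integers. For $0\le k\le l$, $f^{(r)}_k(T)\in\mathrm{SYT}(n+1)$ is obtained from $T$ by adding a cell with entry $n+1$ at the bottom of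 column $c=\sum_{i=1}^k a_i+\sum_{i=0}^k b_i+1$, and \[ \psi^{(r)}_k(T;q)=q^{\sum_{i=k+1}^l b_i}\prod_{i=1}^k\frac{\left[\sum_{j=i+1}^k a_j+\sum_{j=i}^k b_j\right]_q}{\left[\sum_{j=i}^k a_j+\sum_{j=i}^k b_j\right]_q}\prod_{i=k+1}^l\frac{\left[\sum_{j=k+1}^i a_j+\sum_{j=k+1}^{i-1}b_j\right]_q}{\left[\sum_{j=k+1}^i a_j+\sum_{j=k+1}^{i}b_j\right]_q}. \] For $\mathbf{m}\in\mathbb{H}_n$ and $T\in\mathrm{SYT}(n)$, let $T'$ be $T$ with the entry $n$ removed, let $\mathbf{m}'\in\mathbb{H}_{n-1}$ be $\mathbf{m}'(i)=\mathbf{m}(i+1)-1$, and $r=n-\mathbf{m}(1)$. Define recursively $p_\emptyset(\emptyset;q)=1$ for $n=0$, and $p_{\mathbf{m}}(T;q)=\psi^{(r)}_k(T';q)\,p_{\mathbf{m}'}(T';q)$ if $T=f^{(r)}_k(T')$ for some $0\le k\le l$ (with $l$ determined by $\delta^{(r)}(T')$), and $p_{\mathbf{m}}(T;q)=0$ otherwise. Finally, $c_{\lambda,k}(\mathbf{m};q)=\prod_{i\ge1}[\lambda_i]_q!\sum_{T\in\mathrm{SYT}_k(\lambda)}p_{\mathbf{m}}(T;q)$. *)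

theory Defs
  imports
    "HOL-Library.FuncSet"
    "HOL-Computational_Algebra.Polynomial_Factorial"
begin

section \<open>\<open>q\<close>-integers in \<open>\<rat>(q)\<close>\<close>

type_synonym ratfun = "rat poly fract"

definition qvar :: ratfun where
  "qvar = to_fract [:0, 1:]"

definition qint :: "nat \<Rightarrow> ratfun" where
  "qint k = (\<Sum>i<k. qvar ^ i)"

definition qfact :: "nat \<Rightarrow> ratfun" where
  "qfact k = (\<Prod>i=1..k. qint i)"

section \<open>Partitions, tableaux and Hessenberg functions\<close>

definition partition_of :: "nat list \<Rightarrow> nat \<Rightarrow> bool" (infix "\<turnstile>p" 50) where
  "lam \<turnstile>p n \<longleftrightarrow> sorted_wrt (\<ge>) lam \<and> 0 \<notin> set lam \<and> sum_list lam = n"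

text \<open>Cells are pairs (row, column), both counted from 1, with row 1 on top.\<close>

definition diagram :: "nat list \<Rightarrow> (nat \<times> nat) set" where
  "diagram lam = {(i, j). 1 \<le> i \<and> i \<le> length lam \<and> 1 \<le> j \<and> j \<le> lam ! (i - 1)}"

text \<open>A tableau is its filling, extended by 0 outside the diagram; hence a cell belongs to
  the shape iff its value is nonzero.\<close>

type_synonym tableau = "nat \<times> nat \<Rightarrow> nat"

definition SYT :: "nat list \<Rightarrow> tableau set" where
  "SYT lam = {T. (\<forall>x. x \<notin> diagram lam \<longrightarrow> T x = 0) \<and>
     bij_betw T (diagram lam) {1..sum_list lam} \<and>
     (\<forall>i j j'. (i, j) \<in> diagram lam \<longrightarrow> (i, j') \<in> diagram lam \<longrightarrow> j < j' \<longrightarrow> T (i, j) < T (i, j')) \<and>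
     (\<forall>i i' j. (i, j) \<in> diagram lam \<longrightarrow> (i', j) \<in> diagram lam \<longrightarrow> i < i' \<longrightarrow> T (i, j) < T (i', j))}"

definition SYT_col :: "nat \<Rightarrow> nat list \<Rightarrow> tableau set" where
  "SYT_col k lam = {T \<in> SYT lam. \<exists>i. (i, k) \<in> diagram lam \<and> T (i, k) = sum_list lam}"

text \<open>Only the values on \<open>{1..n}\<close> matter: all notions below depend on \<open>m\<close> only through them.\<close>

definition hessenberg :: "nat \<Rightarrow> (nat \<Rightarrow> nat) \<Rightarrow> bool" where
  "hessenberg n m \<longleftrightarrow> m \<in> {1..n} \<rightarrow> {1..n} \<and> mono_on {1..n} m \<and> (\<forall>i\<in>{1..n}. i \<le> m i)"

section \<open>The sequence \<open>\<delta>\<close> and its run lengths\<close>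

definition delta :: "nat \<Rightarrow> nat \<Rightarrow> tableau \<Rightarrow> nat list" where
  "delta n r T = map (\<lambda>j. if \<exists>i. T (i, j) > r then 1 else 0) [1..<Suc n]"

text \<open>\<open>d = (1^b\<^sub>0, 0^a\<^sub>1, 1^b\<^sub>1, \<dots>, 0^a\<^sub>l, 1^b\<^sub>l, 0^a\<^sub>l\<^sub>+\<^sub>1)\<close>, where \<open>a\<close> and \<open>b\<close> are extended
  by 0 to all indices so that the triple \<open>(l, a, b)\<close> is unique.\<close>

fun is_runs :: "nat list \<Rightarrow> nat \<times> (nat \<Rightarrow> nat) \<times> (nat \<Rightarrow> nat) \<Rightarrow> bool" where
  "is_runs d (l, a, b) \<longleftrightarrow>
     d = replicate (b 0) 1
         @ concat (map (\<lambda>i. replicate (a i) 0 @ replicate (b i) 1) [1..<Suc l])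
         @ replicate (a (Suc l)) 0 \<and>
     (\<forall>i\<in>{1..l}. a i > 0 \<and> b i > 0) \<and>
     (\<forall>i. i \<notin> {1..Suc l} \<longrightarrow> a i = 0) \<and> (\<forall>i. i \<notin> {0..l} \<longrightarrow> b i = 0)"

definition runs :: "nat list \<Rightarrow> nat \<times> (nat \<Rightarrow> nat) \<times> (nat \<Rightarrow> nat)" where
  "runs d = (THE t. is_runs d t)"

definition num_runs :: "nat \<Rightarrow> nat \<Rightarrow> tableau \<Rightarrow> nat" where
  "num_runs n r T = fst (runs (delta n r T))"

section \<open>Adding and removing the largest entry\<close>

definition col_height :: "tableau \<Rightarrow> nat \<Rightarrow> nat" where
  "col_height T j = card {i. T (i, j) \<noteq> 0}"

definition add_col :: "nat \<Rightarrow> nat \<Rightarrow> nat \<Rightarrow> tableau \<Rightarrow> nat" where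
  "add_col n r k T = (case runs (delta n r T) of (l, a, b) \<Rightarrow>
     (\<Sum>i=1..k. a i) + (\<Sum>i=0..k. b i) + 1)"

text \<open>Here \<open>n\<close> is the size of \<open>T\<close>, and the new entry is \<open>n + 1\<close>.\<close>

definition add_cell :: "nat \<Rightarrow> nat \<Rightarrow> nat \<Rightarrow> tableau \<Rightarrow> tableau" where
  "add_cell n r k T = (let c = add_col n r k T in T((col_height T c + 1, c) := n + 1))"

definition remove_entry :: "nat \<Rightarrow> tableau \<Rightarrow> tableau" where
  "remove_entry n T = (\<lambda>x. if T x = n then 0 else T x)"

section \<open>The weights\<close>

definition psi :: "nat \<Rightarrow> nat \<Rightarrow> nat \<Rightarrow> tableau \<Rightarrow> ratfun" where
  "psi n r k T = (case runs (delta n r T) of (l, a, b) \<Rightarrow>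
     qvar ^ (\<Sum>i=k+1..l. b i)
     * (\<Prod>i=1..k. qint ((\<Sum>j=i+1..k. a j) + (\<Sum>j=i..k. b j))
                  / qint ((\<Sum>j=i..k. a j) + (\<Sum>j=i..k. b j)))
     * (\<Prod>i=k+1..l. qint ((\<Sum>j=k+1..i. a j) + (\<Sum>j=k+1..i-1. b j))
                    / qint ((\<Sum>j=k+1..i. a j) + (\<Sum>j=k+1..i. b j))))"

text \<open>The first argument is the size of \<open>T\<close>. The index \<open>k\<close> selected by the definite
  description is unique, see \<open>add_cell_inj\<close> below.\<close>

fun hess_p :: "nat \<Rightarrow> (nat \<Rightarrow> nat) \<Rightarrow> tableau \<Rightarrow> ratfun" where
  "hess_p 0 m T = 1"
| "hess_p (Suc n) m T =
    (let T' = remove_entry (Suc n) T; r = Suc n - m 1; l = num_runs n r T' in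
     if \<exists>k\<le>l. T = add_cell n r k T'
     then psi n r (THE k. k \<le> l \<and> T = add_cell n r k T') T' * hess_p n (\<lambda>i. m (i + 1) - 1) T'
     else 0)"

definition coeff_c :: "nat list \<Rightarrow> nat \<Rightarrow> (nat \<Rightarrow> nat) \<Rightarrow> ratfun" where
  "coeff_c lam k m = prod_list (map qfact lam) * (\<Sum>T\<in>SYT_col k lam. hess_p (sum_list lam) m T)"

section \<open>Well-definedness\<close>

lemma finite_diagram: "finite (diagram lam)"
proof -
  have "diagram lam \<subseteq> {..length lam} \<times> {..Max (set lam)}"
    by (auto simp: diagram_def intro!: order_trans[OF _ Max_ge])
  then show ?thesis by (rule finite_subset) simp
qed

lemma finite_SYT: "finite (SYT lam)"
proof -
  have "SYT lam \<subseteq> {T. T ` diagram lam \<subseteq> {1..sum_list lam} \<and> {x. T x \<noteq> 0} \<subseteq> diagram lam}"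
  proof
    fix T assume T: "T \<in> SYT lam"
    then have "T ` diagram lam = {1..sum_list lam}" by (simp add: SYT_def bij_betw_def)
    moreover have "x \<in> diagram lam" if "T x \<noteq> 0" for x
      proof (rule ccontr)
      assume x: "x \<notin> diagram lam"
      have "\<forall>x. x \<notin> diagram lam \<longrightarrow> T x = 0" using T unfolding SYT_def by (elim CollectE conjE)
      then have "T x = 0" using x by (elim allE[of _ x]) (rule mp)
      then show False using that by simp
    qed
    ultimately show "T \<in> {T. T ` diagram lam \<subseteq> {1..sum_list lam} \<and> {x. T x \<noteq> 0} \<subseteq> diagram lam}"
      by blast
  qed
  also have "finite \<dots>"
  proof (rule finite_subset)
    show "{T. T ` diagram lam \<subseteq> {1..sum_list lam} \<and> {x. T x \<noteq> 0} \<subseteq> diagram lam}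
      \<subseteq> {T. \<forall>x. (x \<in> diagram lam \<longrightarrow> T x \<in> {1..sum_list lam}) \<and> (x \<notin> diagram lam \<longrightarrow> T x = 0)}"
      by (auto simp: image_subset_iff)
    show "finite {T. \<forall>x. (x \<in> diagram lam \<longrightarrow> T x \<in> {1..sum_list lam}) \<and> (x \<notin> diagram lam \<longrightarrow> T x = 0)}"
      by (rule finite_set_of_finite_funs) (simp_all add: finite_diagram)
  qed
  finally (finite_subset) show ?thesis .
qed

lemma finite_SYT_col: "finite (SYT_col k lam)"
  using finite_SYT[of lam] by (simp add: SYT_col_def)

fun runs_step :: "nat \<Rightarrow> nat \<times> (nat \<Rightarrow> nat) \<times> (nat \<Rightarrow> nat) \<Rightarrow> nat \<times> (nat \<Rightarrow> nat) \<times> (nat \<Rightarrow> nat)" where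
  "runs_step x (l, a, b) =
     (if x = 0 then (l, a(Suc l := Suc (a (Suc l))), b)
      else if a (Suc l) = 0 then (l, a, b(l := Suc (b l)))
      else (Suc l, a, b(Suc l := 1)))"

lemma runs_blocks_cong:
  assumes "\<And>i. 1 \<le> i \<Longrightarrow> i \<le> l \<Longrightarrow> a i = a' i \<and> b i = b' i"
  shows "concat (map (\<lambda>i. replicate (a i) 0 @ replicate (b i) (1::nat)) [1..<Suc l]) =
    concat (map (\<lambda>i. replicate (a' i) 0 @ replicate (b' i) 1) [1..<Suc l])"
  by (rule arg_cong[of _ _ concat], rule map_cong) (auto simp: assms)

lemma is_runs_step:
  assumes "is_runs d t" "x \<in> {0, 1}"
  shows "is_runs (d @ [x]) (runs_step x t)"
proof -
  obtain l a b where t: "t = (l, a, b)" by (cases t)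
  show ?thesis
  proof (cases "x = 0")
    case True
    have c: "concat (map (\<lambda>i. replicate ((a(Suc l := Suc (a (Suc l)))) i) 0 @ replicate (b i) (1::nat)) [1..<Suc l]) =
      concat (map (\<lambda>i. replicate (a i) 0 @ replicate (b i) 1) [1..<Suc l])"
      by (rule runs_blocks_cong) auto
    show ?thesis
      using assms True unfolding t runs_step.simps if_P[OF True] is_runs.simps c
      by (auto simp: replicate_append_same)
  next
    case False
    then have x: "x = 1" using assms by auto
    show ?thesis
    proof (cases "a (Suc l) = 0")
      case True
      show ?thesis
      proof (cases l)
        case 0
        then show ?thesis using assms x True by (auto simp: t replicate_append_same)
      next
        case (Suc l0)
        have c: "concat (map (\<lambda>i. replicate (a i) 0 @ replicate ((b(Suc l0 := Suc (b (Suc l0)))) i) (1::nat)) [1..<Suc l0]) =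
          concat (map (\<lambda>i. replicate (a i) 0 @ replicate (b i) 1) [1..<Suc l0])"
          by (rule runs_blocks_cong) auto
        show ?thesis using assms x True c by (auto simp: t Suc replicate_append_same)
      qed
    next
      case nz: False
      have c: "concat (map (\<lambda>i. replicate (a i) 0 @ replicate ((b(Suc l := 1)) i) (1::nat)) [1..<Suc l]) =
          concat (map (\<lambda>i. replicate (a i) 0 @ replicate (b i) 1) [1..<Suc l])"
        by (rule runs_blocks_cong) auto
      show ?thesis using assms x nz c by (auto simp: t le_Suc_eq)
    qed
  qed
qed

lemma is_runs_snocE:
  assumes "is_runs (d @ [x]) t"
  obtains t' where "is_runs d t'" "t = runs_step x t'"
proof -
  obtain l a b where t: "t = (l, a, b)" by (cases t)
  consider (A) "a (Suc l) > 0" | (B) "a (Suc l) = 0" "l = 0" | (C) "a (Suc l) = 0" "b l > 1" "l > 0"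
    | (D) "a (Suc l) = 0" "b l = 1" "l > 0"
  proof -
    have "0 < b l" if "l > 0" using assms that unfolding t is_runs.simps by auto
    then show ?thesis using that by (cases "l = 0"; cases "a (Suc l) = 0"; cases "b l = 1") auto
  qed
  then show ?thesis
  proof cases
    case A
    then obtain y where y: "a (Suc l) = Suc y" using gr0_implies_Suc by blast
    have c: "concat (map (\<lambda>i. replicate ((a(Suc l := y)) i) 0 @ replicate (b i) (1::nat)) [1..<Suc l]) =
      concat (map (\<lambda>i. replicate (a i) 0 @ replicate (b i) 1) [1..<Suc l])"
      by (rule runs_blocks_cong) auto
    have "x = 0" "is_runs d (l, a(Suc l := y), b)"
      using assms y c
      by (auto simp: t simp flip: replicate_append_same append_assoc simp del: upt_Suc)
    then show ?thesis using that y by (fastforce simp: t)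
  next
    case B
    then have "b 0 > 0" using assms by (cases "b 0") (auto simp: t)
    then obtain y where y: "b 0 = Suc y" using gr0_implies_Suc by blast
    have "x = 1" "is_runs d (0, a, b(0 := y))"
      using assms y B by (auto simp: t simp flip: replicate_append_same)
    moreover from this have "t = runs_step x (0, a, b(0 := y))"
      using y B by (simp add: t fun_upd_idem)
    ultimately show ?thesis using that by blast
  next
    case C
    then obtain y l0 where y: "b l = Suc (Suc y)" "l = Suc l0"
      by (metis One_nat_def Suc_lessE gr0_implies_Suc)
    have c: "concat (map (\<lambda>i. replicate (a i) 0 @ replicate ((b(Suc l0 := Suc y)) i) (1::nat)) [1..<Suc l0]) =
      concat (map (\<lambda>i. replicate (a i) 0 @ replicate (b i) 1) [1..<Suc l0])"
      by (rule runs_blocks_cong) auto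
    have s: "[1..<Suc (Suc l0)] = [1..<Suc l0] @ [Suc l0]" by simp
    have rr: "replicate (Suc (Suc y)) (1::nat) = replicate (Suc y) 1 @ [1]"
      by (simp add: replicate_append_same)
    have eq: "d @ [x] = (replicate (b 0) 1
         @ concat (map (\<lambda>i. replicate (a i) 0 @ replicate (b i) 1) [1..<Suc l0])
         @ replicate (a (Suc l0)) 0 @ replicate (Suc y) 1) @ [1]"
      using assms C(1) y unfolding t is_runs.simps y(2) s map_append concat_append
      by (simp add: rr del: upt_Suc replicate_Suc One_nat_def)
    then have "x = 1" and d: "d = replicate (b 0) 1
         @ concat (map (\<lambda>i. replicate (a i) 0 @ replicate (b i) 1) [1..<Suc l0])
         @ replicate (a (Suc l0)) 0 @ replicate (Suc y) 1"
      unfolding append1_eq_conv by auto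
    have "is_runs d (l, a, b(l := Suc y))"
      unfolding is_runs.simps y(2) s map_append concat_append c
      using assms C(1) y d by (auto simp: t simp del: upt_Suc replicate_Suc)
    moreover have "t = runs_step x (l, a, b(l := Suc y))"
      using y C(1) \<open>x = 1\<close> by (auto simp: t)
    ultimately show ?thesis by (rule that)
  next
    case D
    then obtain l0 where l0: "l = Suc l0" using gr0_implies_Suc by blast
    have c: "concat (map (\<lambda>i. replicate (a i) 0 @ replicate ((b(Suc l0 := 0)) i) (1::nat)) [1..<Suc l0]) =
      concat (map (\<lambda>i. replicate (a i) 0 @ replicate (b i) 1) [1..<Suc l0])"
      by (rule runs_blocks_cong) auto
    have s: "[1..<Suc (Suc l0)] = [1..<Suc l0] @ [Suc l0]" by simp
    have eq: "d @ [x] = (replicate (b 0) 1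
         @ concat (map (\<lambda>i. replicate (a i) 0 @ replicate (b i) 1) [1..<Suc l0])
         @ replicate (a (Suc l0)) 0) @ [1]"
      using assms D unfolding t is_runs.simps l0 s map_append concat_append
      by (simp del: upt_Suc)
    then have "x = 1" and d: "d = replicate (b 0) 1
         @ concat (map (\<lambda>i. replicate (a i) 0 @ replicate (b i) 1) [1..<Suc l0])
         @ replicate (a (Suc l0)) 0"
      unfolding append1_eq_conv by auto
    have "is_runs d (l0, a, b(Suc l0 := 0))"
      unfolding is_runs.simps c
      using assms D(1) l0 d by (auto simp: t le_Suc_eq simp del: upt_Suc)
    moreover have "a (Suc l0) > 0" using assms by (auto simp: t l0)
    then have "t = runs_step x (l0, a, b(Suc l0 := 0))"
      using D(2) l0 \<open>x = 1\<close> by (auto simp: t)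
    ultimately show ?thesis by (rule that)
  qed
qed

lemma runs_ex1: "set d \<subseteq> {0, 1} \<Longrightarrow> \<exists>!t. is_runs d t"
proof (induction d rule: rev_induct)
  case Nil
  show ?case
  proof (rule ex1I[of _ "(0, \<lambda>_. 0, \<lambda>_. 0)"])
    fix t assume t: "is_runs [] t"
    obtain l a b where [simp]: "t = (l, a, b)" by (cases t)
    have l: "l = 0"
    proof (rule ccontr)
      assume "l \<noteq> 0"
      then have "l \<in> {1..l}" by simp
      then have "a l > 0" using t by (auto simp del: upt_Suc)
      moreover have "concat (map (\<lambda>i. replicate (a i) 0 @ replicate (b i) (1::nat)) [1..<Suc l]) = []"
        using t by (simp del: upt_Suc concat_eq_Nil_conv)
      then have "replicate (a l) (0::nat) = []" using \<open>l \<in> {1..l}\<close> by auto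
      then have "a l = 0" by (cases "a l") auto
      ultimately show False by simp
    qed
    have "a i = 0" for i using t l by (cases "i = 1") auto
    moreover have "b i = 0" for i using t l by (cases "i = 0") auto
    ultimately show "t = (0, \<lambda>_. 0, \<lambda>_. 0)" using l by auto
  qed auto
next
  case (snoc x d)
  then obtain t where t: "is_runs d t" "\<And>t'. is_runs d t' \<Longrightarrow> t' = t"
    by (metis le_sup_iff set_append)
  show ?case
  proof (rule ex1I)
    show "is_runs (d @ [x]) (runs_step x t)" using t(1) snoc.prems by (intro is_runs_step) auto
  next
    fix t' assume "is_runs (d @ [x]) t'"
    then show "t' = runs_step x t" by (rule is_runs_snocE) (use t(2) in auto)
  qed
qed

lemma is_runs_runs: "is_runs (delta n r T) (runs (delta n r T))"
  unfolding runs_def by (rule theI', rule runs_ex1) (auto simp: delta_def)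

lemma add_col_strict_mono:
  assumes "k < k'" "k' \<le> num_runs n r T"
  shows "add_col n r k T < add_col n r k' T"
proof -
  obtain l a b where r: "runs (delta n r T) = (l, a, b)" by (cases "runs (delta n r T)")
  have "is_runs (delta n r T) (l, a, b)" using is_runs_runs[of n r T] r by simp
  then have b: "b k' > 0" using assms r by (auto simp: num_runs_def)
  have "sum a {1..k} \<le> sum a {1..k'}" using assms by (intro sum_mono2) auto
  moreover have "sum b {0..k} < sum b {0..k'}"
    using assms b by (intro sum_strict_mono2[of _ _ k']) auto
  ultimately show ?thesis by (simp add: add_col_def r)
qed

lemma add_cell_inj:
  assumes "\<And>x. T x \<noteq> Suc n" "k \<le> num_runs n r T" "k' \<le> num_runs n r T"
    and "add_cell n r k T = add_cell n r k' T"
  shows "k = k'"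
proof -
  let ?c = "add_col n r k T" and ?c' = "add_col n r k' T"
  have "?c = ?c'"
  proof (rule ccontr)
    assume ne: "?c \<noteq> ?c'"
    have "add_cell n r k T (col_height T ?c + 1, ?c) = Suc n"
      by (simp add: add_cell_def Let_def)
    moreover have "add_cell n r k' T (col_height T ?c + 1, ?c) = T (col_height T ?c + 1, ?c)"
      using ne by (simp add: add_cell_def Let_def)
    ultimately show False using assms(1,4) by metis
  qed
  then show ?thesis
    using add_col_strict_mono[of k k' n r T] add_col_strict_mono[of k' k n r T] assms(2,3)
    by (metis less_irrefl linorder_less_linear)
qed

end

theory Submission
  imports Defs
begin

text \<open>
  The sum over tableaux becomes a sum over words by recording the column of each entry. Entry
  \<open>t\<close> stands for the vertex \<open>n + 1 - t\<close> of the unit interval graph; it is adjacent to the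
  earlier entries \<open>s\<close> with \<open>r t < s < t\<close>, where \<open>r t = n - m (n + 1 - t)\<close>. The weight of a
  tableau is then a product over \<open>t\<close> of factors \<open>psi_set R c\<close>, where \<open>c\<close> is the letter of \<open>t\<close>
  and \<open>R\<close> the set of letters at its earlier neighbours: such words are colourings of the graph,
  and \<open>psi_set R c\<close> is the residue at \<open>z = q\<^sup>-\<^sup>c\<close> of
  \<open>(z - q\<^sup>-\<^sup>1)\<^sup>-\<^sup>1 \<Prod>\<^sub>s (z - q\<^sup>-\<^sup>s) / (z - q\<^sup>-\<^sup>s\<^sup>-\<^sup>1)\<close> with \<open>s\<close> ranging over \<open>R\<close>.

  Exchanging the letters of two consecutive adjacent vertices gives three-term relations between
  the sums for neighbouring graphs, the modular law. The chromatic quasisymmetric function, the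
  sum of \<open>q\<^bsup>asc\<^esup> x\<^sup>\<kappa>\<close> over proper colourings, satisfies the same relations. If each letter \<open>c\<close>
  carries in addition \<open>[c] e\<^sub>c / e\<^sub>c\<^sub>-\<^sub>1\<close>, both sums equal \<open>[n]! e\<^sub>n\<close> on complete graphs, and both
  are multiplicative over disconnected graphs. These facts determine a function on unit interval
  graphs (\<open>modular_law_unique\<close>), so the two sums agree (\<open>psi_sum_eq_chrom_sum\<close>). The word side is
  an expansion into products of elementary symmetric functions, and the chromatic side visibly has
  coefficients in \<open>\<rat>[q]\<close>. With \<open>x\<^sub>i = z^(B^i)\<close> the products of elementary symmetric functions
  become polynomials in \<open>z\<close> whose lowest terms are monic of distinct degrees; hence all
  coefficients of the expansion lie in \<open>\<rat>[q]\<close> (\<open>content_sum_polynomial\<close>).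

  This treats the words of a given content together, whatever their last letter. To isolate the
  last letter \<open>k\<close>, attach to the last vertex a path with \<open>s\<close> vertices. A run \<open>k + 1, \<dots>, k + s\<close>
  along the path contributes \<open>[k + s] / [k]\<close>, and once \<open>k + s > n\<close> a letter \<open>k + s\<close> can only
  arise from such a run or from a last letter larger than \<open>k\<close>. By descending induction on \<open>k\<close>,
  the quotient in question becomes a polynomial when multiplied by \<open>[k + s]\<close>, for two consecutive
  values of \<open>s\<close>; as \<open>[K + 1] - q [K] = 1\<close>, it is a polynomial itself
  (\<open>last_letter_quotient_polynomial\<close>).
\<close>

section \<open>The modular law and its uniqueness theorem\<close>

text \<open>
  A unit interval graph on the vertices \<open>l + 1, \<dots>, n\<close> is encoded by the function \<open>r\<close> for which
  \<open>s < t\<close> are adjacent iff \<open>r t < s\<close>. Intervals that do not start at 1 allow a disconnected graph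
  to be cut into its pieces without renumbering.
\<close>

definition reach_fun :: "nat \<Rightarrow> nat \<Rightarrow> (nat \<Rightarrow> nat) \<Rightarrow> bool" where
  "reach_fun l n r \<longleftrightarrow> (\<forall>t\<in>{l<..n}. l \<le> r t \<and> r t < t) \<and> mono_on {l<..n} r"

lemma reach_funD:
  assumes "reach_fun l n r"
  shows "l < t \<Longrightarrow> t \<le> n \<Longrightarrow> l \<le> r t" "l < t \<Longrightarrow> t \<le> n \<Longrightarrow> r t < t"
    "l < s \<Longrightarrow> s \<le> t \<Longrightarrow> t \<le> n \<Longrightarrow> r s \<le> r t"
  using assms by (auto simp: reach_fun_def mono_on_def)

lemma reach_fun_upd:
  assumes "reach_fun l n r" "l < t" "t \<le> n" "l \<le> v" "v < t"
    and "l < t - 1 \<Longrightarrow> r (t - 1) \<le> v" "t < n \<Longrightarrow> v \<le> r (Suc t)"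
  shows "reach_fun l n (r(t := v))"
proof -
  have "(r(t := v)) x \<le> (r(t := v)) y" if that': "l < x" "x \<le> y" "y \<le> n" for x y
  proof -
    consider "x = y" | "x \<noteq> t" "y \<noteq> t" | "x = t" "y > t" | "y = t" "x < t"
      using that'(2) by linarith
    then show ?thesis
    proof cases
      case 3
      have "r (Suc t) \<le> r y" using 3 that' by (intro reach_funD(3)[OF assms(1)]) auto
      then show ?thesis using 3 that' assms(7) by auto
    next
      case 4
      have "r x \<le> r (t - 1)" using 4 that' by (intro reach_funD(3)[OF assms(1)]) auto
      moreover have "r (t - 1) \<le> v" using 4 that' by (intro assms(6)) linarith
      ultimately show ?thesis using 4 by auto
    qed (use that' reach_funD(3)[OF assms(1), of x y] in auto)
  qed
  then have "mono_on {l<..n} (r(t := v))" by (intro mono_onI) auto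
  then show ?thesis using assms reach_funD[OF assms(1)] by (auto simp: reach_fun_def)
qed

text \<open>
  Both laws compare three graphs that differ in how two consecutive vertices are joined to a third
  one: to neither (the term with factor \<open>q\<close>), to one, or to both. In \<open>vertex_law\<close> the third vertex
  \<open>t\<close> comes after the pair \<open>a, a + 1\<close>; in \<open>pair_law\<close> it is the vertex \<open>r (a + 1)\<close> before the pair.
  Apart from this the two vertices of the pair have the same neighbours. The pair in
  \<open>pair_law\<close> does not contain the last vertex \<open>n\<close>: this weaker hypothesis is inherited when the
  last vertex is deleted, which the induction on \<open>n\<close> below requires.
\<close>

locale modular_law =
  fixes q :: "'a::field" and l n :: nat and f :: "(nat \<Rightarrow> nat) \<Rightarrow> 'a"
  assumes vertex_law: "\<And>r t a. \<lbrakk>reach_fun l n r; t \<le> n; r t = a; l < a; Suc a < t; r a = r (Suc a);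
      r (t - 1) < a; t < n \<Longrightarrow> a < r (Suc t)\<rbrakk>
    \<Longrightarrow> (1 + q) * f r = f (r(t := a - 1)) + q * f (r(t := Suc a))"
  and pair_law: "\<And>r a. \<lbrakk>reach_fun l n r; l < a; Suc a < n; r (Suc a) = Suc (r a); r (Suc a) < a;
      \<And>t. Suc a < t \<Longrightarrow> t \<le> n \<Longrightarrow> r t \<noteq> a\<rbrakk>
    \<Longrightarrow> (1 + q) * f r = f (r(Suc a := r a)) + q * f (r(a := r (Suc a)))"
  and vanish_disconnected: "\<And>r t. \<lbrakk>reach_fun l n r; Suc l < t; t \<le> n; r t = t - 1\<rbrakk> \<Longrightarrow> f r = 0"
begin

text \<open>
  Suppose no vertex after \<open>a + 1\<close> distinguishes \<open>a\<close> from \<open>a + 1\<close>. Then \<open>f r\<close> is determined by the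
  graphs with the same later part in which \<open>a\<close> and \<open>a + 1\<close> have the same earlier neighbours. If
  \<open>r a\<close> and \<open>r (a + 1)\<close> differ by one, this is \<open>pair_law\<close>. Otherwise the pair
  \<open>r (a + 1) - 1, r (a + 1)\<close> lies further left and is in the same situation, so it may be assumed
  symmetric; then \<open>vertex_law\<close> lowers \<open>r (a + 1)\<close>.
\<close>

lemma vanish_from_symmetric_pair:
  assumes q: "1 + q \<noteq> 0" "q \<noteq> 0"
    and "reach_fun l n r" "l < a" "Suc a < n" "\<And>t. Suc a < t \<Longrightarrow> t \<le> n \<Longrightarrow> r t \<noteq> a"
    and "\<And>r'. \<lbrakk>reach_fun l n r'; \<forall>t>Suc a. r' t = r t; r' a = r' (Suc a)\<rbrakk> \<Longrightarrow> f r' = 0"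
  shows "f r = 0"
  using assms(3-)
proof (induction a arbitrary: r rule: less_induct)
  case (less a)
  note sym = less.prems(5) and IH = less.IH
  have "f r' = 0" if "reach_fun l n r'" "\<forall>t>Suc a. r' t = r t" for r'
    using that
  proof (induction "r' (Suc a) - r' a" arbitrary: r' rule: less_induct)
    case (less r')
    note R = reach_funD[OF less.prems(1)]
    let ?v = "r' (Suc a)" and ?w = "r' a"
    have vw: "?w \<le> ?v" using \<open>l < a\<close> \<open>Suc a < n\<close> by (intro R) auto
    have vn: "?v \<le> r' (Suc (Suc a))" using \<open>l < a\<close> \<open>Suc a < n\<close> by (intro R) auto
    have va: "?v \<le> a" using R(2)[of "Suc a"] \<open>l < a\<close> \<open>Suc a < n\<close> by auto
    have lw: "l \<le> ?w" using R(1) \<open>l < a\<close> \<open>Suc a < n\<close> by auto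
    have tail: "r' t \<noteq> a" if "Suc a < t" "t \<le> n" for t
      using that less.prems(2) \<open>\<And>t. Suc a < t \<Longrightarrow> t \<le> n \<Longrightarrow> r t \<noteq> a\<close> by auto
    consider "?v = ?w" | "?v = a" | "?v < a" "?v = Suc ?w" | "?v < a" "Suc (Suc ?w) \<le> ?v"
      using vw va by linarith
    then show ?case
    proof cases
      case 1
      then show ?thesis using sym less.prems by simp
    next
      case 2
      then show ?thesis using less.prems(1) \<open>l < a\<close> \<open>Suc a < n\<close>
        by (intro vanish_disconnected[of r' "Suc a"]) auto
    next
      case 3
      have "reach_fun l n (r'(Suc a := r' a))"
        using less.prems 3 \<open>l < a\<close> \<open>Suc a < n\<close> lw vn by (intro reach_fun_upd) auto
      then have "f (r'(Suc a := r' a)) = 0"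
        by (rule sym) (use less.prems in auto)
      moreover have "reach_fun l n (r'(a := r' (Suc a)))"
        using less.prems 3 \<open>l < a\<close> \<open>Suc a < n\<close> lw R(3)[of "a - 1" a]
        by (intro reach_fun_upd) auto
      then have "f (r'(a := r' (Suc a))) = 0"
        by (rule sym) (use less.prems in auto)
      ultimately have "(1 + q) * f r' = 0"
        using pair_law[of r' a] less.prems(1) 3 \<open>l < a\<close> \<open>Suc a < n\<close> tail by auto
      then show ?thesis using q by simp
    next
      case 4
      show ?thesis
      proof (rule IH[of "?v - 1" r'])
        show "?v - 1 < a" "l < ?v - 1" "Suc (?v - 1) < n" using 4 lw \<open>Suc a < n\<close> by auto
        show "reach_fun l n r'" by fact
        show "r' t \<noteq> ?v - 1" if "Suc (?v - 1) < t" "t \<le> n" for t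
        proof (cases "t \<le> a")
          case True
          then have "r' t \<le> ?w" using that 4 lw \<open>Suc a < n\<close> by (intro R) auto
          then show ?thesis using 4 by auto
        next
          case False
          then have "?v \<le> r' t" using that 4 \<open>l < a\<close> by (intro R) auto
          then show ?thesis using 4 by auto
        qed
        fix r''
        assume r'': "reach_fun l n r''" "\<forall>t>Suc (?v - 1). r'' t = r' t" "r'' (?v - 1) = r'' (Suc (?v - 1))"
        have eq: "r'' (Suc a) = ?v" "r'' a = ?w" "r'' (Suc (Suc a)) = r' (Suc (Suc a))"
          "r'' (?v - 1) = r'' ?v"
          using r'' 4 by auto
        have tail'': "\<forall>t>Suc a. r'' t = r t" using r'' less.prems(2) 4 by auto
        have reach: "reach_fun l n (r''(Suc a := v))" if "?w \<le> v" "v \<le> ?v" for v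
          using that r'' eq 4 vn lw va \<open>l < a\<close> \<open>Suc a < n\<close> by (intro reach_fun_upd) auto
        have "f (r''(Suc a := ?v - 1)) = 0" "f (r''(Suc a := ?v - 2)) = 0"
          using 4 reach[of "?v - 1"] reach[of "?v - 2"] tail'' eq by (auto intro!: less.hyps)
        moreover have "(1 + q) * f (r''(Suc a := ?v - 1)) =
            f ((r''(Suc a := ?v - 1))(Suc a := ?v - 1 - 1)) + q * f ((r''(Suc a := ?v - 1))(Suc a := Suc (?v - 1)))"
          using 4 reach[of "?v - 1"] eq lw vn va \<open>l < a\<close> \<open>Suc a < n\<close>
          by (intro vertex_law) auto
        moreover have "r''(Suc a := ?v) = r''" using eq by auto
        moreover have "?v - 1 - 1 = ?v - 2" "Suc (?v - 1) = ?v" using 4 by auto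
        ultimately show "f r'' = 0" using q by (simp del: fun_upd_apply)
      qed
    qed
  qed
  then show ?case using less.prems by blast
qed

end

text \<open>
  Attaching a pendant vertex to the last vertex \<open>n\<close> preserves the laws because \<open>pair_law\<close> never
  involves \<open>n\<close>, which the new vertex would distinguish from \<open>n - 1\<close>.
\<close>

lemma modular_law_restrict:
  assumes "modular_law q l (Suc n) f" "l < n"
  shows "modular_law q l n (\<lambda>r. f (r(Suc n := n - 1)))"
proof -
  interpret modular_law q l "Suc n" f by fact
  have reach: "reach_fun l (Suc n) (r(Suc n := n - 1))" if "reach_fun l n r" for r
  proof -
    have "r x \<le> n - 1" if "l < x" "x \<le> n" for x
      using reach_funD(2)[OF \<open>reach_fun l n r\<close> that] that by linarith
    then show ?thesis
      using that \<open>l < n\<close> by (auto simp: reach_fun_def mono_on_def le_Suc_eq)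
  qed
  show ?thesis
  proof
    fix r t a
    assume *: "reach_fun l n r" "t \<le> n" "r t = a" "l < a" "Suc a < t" "r a = r (Suc a)" "r (t - 1) < a"
      "t < n \<Longrightarrow> a < r (Suc t)"
    have "(1 + q) * f (r(Suc n := n - 1)) =
        f ((r(Suc n := n - 1))(t := a - 1)) + q * f ((r(Suc n := n - 1))(t := Suc a))"
      using * by (intro vertex_law reach) (auto simp: le_less)
    then show "(1 + q) * f (r(Suc n := n - 1)) =
        f ((r(t := a - 1))(Suc n := n - 1)) + q * f ((r(t := Suc a))(Suc n := n - 1))"
      using * by (simp add: fun_upd_twist)
  next
    fix r a
    assume *: "reach_fun l n r" "l < a" "Suc a < n" "r (Suc a) = Suc (r a)" "r (Suc a) < a"
      "\<And>t. Suc a < t \<Longrightarrow> t \<le> n \<Longrightarrow> r t \<noteq> a"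
    let ?r = "r(Suc n := n - 1)"
    have "(1 + q) * f ?r = f (?r(Suc a := ?r a)) + q * f (?r(a := ?r (Suc a)))"
      using * by (intro pair_law reach) (auto simp: le_Suc_eq)
    then show "(1 + q) * f ?r = f ((r(Suc a := r a))(Suc n := n - 1)) + q * f ((r(a := r (Suc a)))(Suc n := n - 1))"
      using * by (simp add: fun_upd_twist)
  next
    fix r t
    assume *: "reach_fun l n r" "Suc l < t" "t \<le> n" "r t = t - 1"
    then show "f (r(Suc n := n - 1)) = 0"
      by (intro vanish_disconnected[of _ t] reach) auto
  qed
qed

text \<open>
  A solution of the modular law that vanishes on disconnected and on complete graphs is zero. The
  last vertex \<open>n\<close> has three cases. If it is isolated, the graph is disconnected. If it is pendant
  (\<open>r n = n - 2\<close>), it is deleted and induction applies. If it has more neighbours, the first two of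
  them may be assumed symmetric, and \<open>vertex_law\<close> expresses the value through graphs in which
  \<open>n\<close> has fewer neighbours.
\<close>

theorem modular_law_unique:
  assumes "modular_law q l n f" "l < n" "q \<noteq> 0" "\<And>k. (\<Sum>i\<le>k. q ^ i) \<noteq> 0"
    and "\<And>r. (\<forall>t\<in>{l<..n}. r t = l) \<Longrightarrow> f r = 0"
    and "reach_fun l n r"
  shows "f r = 0"
  using assms(2,1,5,6)
proof (induction n arbitrary: f r)
  case (Suc n)
  note step = Suc
  show ?case
  proof (cases "n = l")
    case True
    have "r t = l" if "t \<in> {l<..Suc n}" for t
      using that True reach_funD(1,2)[OF Suc.prems(4), of t] by (auto simp: le_Suc_eq)
    then show ?thesis using Suc.prems(3) by blast
  next
    case False
    then have "l < n" using Suc.prems by simp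
    interpret modular_law q l "Suc n" f by fact
    have q: "1 + q \<noteq> 0" using assms(4)[of 1] by simp
    have law: "modular_law q l n (\<lambda>r. f (r(Suc n := n - 1)))"
      using step \<open>l < n\<close> by (intro modular_law_restrict) auto
    \<comment> \<open>A complete graph with one vertex joined to \<open>k\<close> of its vertices: \<open>vertex_law\<close> is a linear
        recursion in \<open>k\<close> whose solution is \<open>[k]\<close> times the value at \<open>k = 1\<close>. At the largest \<open>k\<close> the
        graph is complete, so the value is zero.\<close>
    have lollipop: "f (r(Suc n := n - 1)) = 0" if r: "\<forall>t\<in>{l<..n}. r t = l" for r
    proof -
      have reach: "reach_fun l (Suc n) (r(Suc n := j))" if "l \<le> j" "j \<le> n" for j
        using r that by (auto simp: reach_fun_def mono_on_def)
      let ?g = "\<lambda>j. f (r(Suc n := j))"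
      have "k \<le> n - l \<Longrightarrow> ?g (n - k) = (\<Sum>i<k. q ^ i) * ?g (n - 1) \<and>
          (k < n - l \<longrightarrow> ?g (n - Suc k) = (\<Sum>i<Suc k. q ^ i) * ?g (n - 1))" for k
      proof (induction k)
        case 0
        have "f (r(Suc n := n)) = 0"
          using \<open>l < n\<close> by (intro vanish_disconnected[of _ "Suc n"] reach) auto
        then show ?case by (simp del: fun_upd_apply)
      next
        case (Suc k)
        then have IH: "?g (n - k) = (\<Sum>i<k. q ^ i) * ?g (n - 1)" "?g (n - Suc k) = (\<Sum>i<Suc k. q ^ i) * ?g (n - 1)"
          by (simp_all del: fun_upd_apply)
        show ?case
        proof (intro conjI impI)
          assume k: "Suc k < n - l"
          have "(1 + q) * ?g (n - Suc k) = f ((r(Suc n := n - Suc k))(Suc n := n - Suc k - 1))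
              + q * f ((r(Suc n := n - Suc k))(Suc n := Suc (n - Suc k)))"
          proof (rule vertex_law)
            show "reach_fun l (Suc n) (r(Suc n := n - Suc k))" using k by (intro reach) auto
          qed (use k r in \<open>auto simp: Suc_diff_Suc\<close>)
          then have "?g (n - Suc (Suc k)) = (1 + q) * ?g (n - Suc k) - q * ?g (n - k)"
            using k by (simp add: Suc_diff_Suc del: fun_upd_apply)
          also have "\<dots> = ((1 + q) * (\<Sum>i<Suc k. q ^ i) - q * (\<Sum>i<k. q ^ i)) * ?g (n - 1)"
            unfolding IH by (simp add: algebra_simps del: fun_upd_apply)
          also have "(1 + q) * (\<Sum>i<Suc k. q ^ i) - q * (\<Sum>i<k. q ^ i) = (\<Sum>i<Suc (Suc k). q ^ i)"
            by (simp add: algebra_simps)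
          finally show "?g (n - Suc (Suc k)) = (\<Sum>i<Suc (Suc k). q ^ i) * ?g (n - 1)" .
        qed (use IH in \<open>simp del: fun_upd_apply\<close>)
      qed
      from this[of "n - l"] have "?g l = (\<Sum>i<n - l. q ^ i) * ?g (n - 1)"
        using \<open>l < n\<close> by (simp del: fun_upd_apply)
      moreover have "?g l = 0" using r by (intro Suc.prems(3)) auto
      moreover have "(\<Sum>i<n - l. q ^ i) \<noteq> 0"
      proof -
        have "{..n - l - 1} = {..<n - l}" using \<open>l < n\<close> by auto
        then show ?thesis using assms(4)[of "n - l - 1"] by simp
      qed
      ultimately show ?thesis by (simp del: fun_upd_apply)
    qed
    show ?thesis using Suc.prems(4)
    proof (induction "n - r (Suc n)" arbitrary: r rule: less_induct)
      case (less r)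
      note R = reach_funD[OF less.prems]
      let ?v = "r (Suc n)"
      have v: "?v \<le> n" "l \<le> ?v" using R(1,2)[of "Suc n"] \<open>l < n\<close> by auto
      consider "?v = n" | "?v = n - 1" | "Suc ?v < n" using v by linarith
      then show ?case
      proof cases
        case 1
        then show ?thesis using less.prems \<open>l < n\<close> by (intro vanish_disconnected[of r "Suc n"]) auto
      next
        case 2
        have "reach_fun l n r" using less.prems by (auto simp: reach_fun_def mono_on_def)
        then have "f (r(Suc n := n - 1)) = 0" using Suc.IH[OF \<open>l < n\<close> law lollipop] by blast
        then show ?thesis using 2 by (metis fun_upd_triv)
      next
        case 3
        show ?thesis
        proof (rule vanish_from_symmetric_pair[OF q \<open>q \<noteq> 0\<close> less.prems])
          show "l < Suc ?v" "Suc (Suc ?v) < Suc n" using v 3 by auto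
          show "r t \<noteq> Suc ?v" if "Suc (Suc ?v) < t" "t \<le> Suc n" for t
            using R(3)[of t "Suc n"] that v by auto
          fix r'
          assume r': "reach_fun l (Suc n) r'" "\<forall>t>Suc (Suc ?v). r' t = r t" "r' (Suc ?v) = r' (Suc (Suc ?v))"
          have eq: "r' (Suc n) = ?v" using r' 3 by auto
          have rn: "r' n \<le> ?v" using reach_funD(3)[OF r'(1), of n "Suc n"] eq \<open>l < n\<close> by auto
          have reach: "reach_fun l (Suc n) (r'(Suc n := j))" if "?v \<le> j" "j \<le> n" for j
            using that r' v rn \<open>l < n\<close> by (intro reach_fun_upd) auto
          have "f (r'(Suc n := Suc ?v)) = 0" "f (r'(Suc n := Suc (Suc ?v))) = 0"
            using 3 by (auto intro!: less.hyps reach)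
          moreover have "(1 + q) * f (r'(Suc n := Suc ?v)) = f ((r'(Suc n := Suc ?v))(Suc n := Suc ?v - 1))
              + q * f ((r'(Suc n := Suc ?v))(Suc n := Suc (Suc ?v)))"
          proof (rule vertex_law)
            show "reach_fun l (Suc n) (r'(Suc n := Suc ?v))" using 3 by (intro reach) auto
          qed (use 3 v rn r' in auto)
          moreover have "r'(Suc n := ?v) = r'" using eq by auto
          ultimately show "f r' = 0" by (simp del: fun_upd_apply)
        qed
      qed
    qed
  qed
qed simp

section \<open>Weighted colourings of unit interval graphs\<close>

definition colour_weight :: "(nat set \<Rightarrow> nat \<Rightarrow> 'a::comm_ring_1) \<Rightarrow> (nat \<Rightarrow> nat) \<Rightarrow> nat set \<Rightarrow> (nat \<Rightarrow> nat) \<Rightarrow> 'a" where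
  "colour_weight \<phi> r P w = (\<Prod>t\<in>P. \<phi> (w ` {r t<..<t}) (w t))"

text \<open>
  Colourings are extensional functions on the vertices. The weight of a vertex depends on its colour
  and on the set of colours of its earlier neighbours, which form a clique.
\<close>

definition colour_sum :: "(nat set \<Rightarrow> nat \<Rightarrow> 'a::comm_ring_1) \<Rightarrow> nat set \<Rightarrow> nat \<Rightarrow> nat \<Rightarrow> (nat \<Rightarrow> nat) \<Rightarrow> 'a" where
  "colour_sum \<phi> E l n r = (\<Sum>w\<in>{l<..n} \<rightarrow>\<^sub>E E. colour_weight \<phi> r {l<..n} w)"

definition swap_adj :: "nat \<Rightarrow> (nat \<Rightarrow> nat) \<Rightarrow> nat \<Rightarrow> nat" where
  "swap_adj a w = w(a := w (Suc a), Suc a := w a)"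

lemma swap_adj_swap_adj [simp]: "swap_adj a (swap_adj a w) = w"
  by (auto simp: swap_adj_def)

lemma swap_adj_simps [simp]:
  "swap_adj a w a = w (Suc a)" "swap_adj a w (Suc a) = w a"
  "s \<noteq> a \<Longrightarrow> s \<noteq> Suc a \<Longrightarrow> swap_adj a w s = w s"
  by (auto simp: swap_adj_def)

lemma swap_adj_image: "a \<in> A \<longleftrightarrow> Suc a \<in> A \<Longrightarrow> swap_adj a w ` A = w ` A"
  by (auto simp: swap_adj_def image_def)

lemma swap_adj_PiE: "w \<in> P \<rightarrow>\<^sub>E E \<Longrightarrow> a \<in> P \<Longrightarrow> Suc a \<in> P \<Longrightarrow> swap_adj a w \<in> P \<rightarrow>\<^sub>E E"
  by (fastforce simp: PiE_def Pi_def extensional_def swap_adj_def)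

lemma sum_eq_0_by_swap:
  fixes D :: "(nat \<Rightarrow> nat) \<Rightarrow> 'a::field"
  assumes "(2::'a) \<noteq> 0" "a \<in> P" "Suc a \<in> P" "\<And>w. w \<in> P \<rightarrow>\<^sub>E E \<Longrightarrow> D w + D (swap_adj a w) = 0"
  shows "sum D (P \<rightarrow>\<^sub>E E) = 0"
proof -
  have "sum D (P \<rightarrow>\<^sub>E E) = (\<Sum>w\<in>P \<rightarrow>\<^sub>E E. D (swap_adj a w))"
    by (rule sum.reindex_bij_witness[of _ "swap_adj a" "swap_adj a"])
      (use assms in \<open>simp_all add: swap_adj_PiE\<close>)
  then have "2 * sum D (P \<rightarrow>\<^sub>E E) = (\<Sum>w\<in>P \<rightarrow>\<^sub>E E. D w + D (swap_adj a w))"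
    by (simp add: sum.distrib)
  also have "\<dots> = 0" using assms(4) by simp
  finally show ?thesis using assms(1) by simp
qed

lemma sum_PiE_Un:
  fixes F G :: "(nat \<Rightarrow> nat) \<Rightarrow> 'a::comm_ring_1"
  assumes "I \<inter> J = {}"
  shows "(\<Sum>w\<in>(I \<union> J) \<rightarrow>\<^sub>E E. F (restrict w I) * G (restrict w J)) = sum F (I \<rightarrow>\<^sub>E E) * sum G (J \<rightarrow>\<^sub>E E)"
proof -
  have "sum F (I \<rightarrow>\<^sub>E E) * sum G (J \<rightarrow>\<^sub>E E) = (\<Sum>(u, v)\<in>(I \<rightarrow>\<^sub>E E) \<times> (J \<rightarrow>\<^sub>E E). F u * G v)"
    by (simp add: sum_product sum.cartesian_product)
  also have "\<dots> = (\<Sum>w\<in>(I \<union> J) \<rightarrow>\<^sub>E E. F (restrict w I) * G (restrict w J))"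
  proof (rule sum.reindex_bij_witness[where i = "\<lambda>w. (restrict w I, restrict w J)"
        and j = "\<lambda>(u, v) t. if t \<in> I then u t else v t"], goal_cases)
    case (1 p)
    then have "restrict (\<lambda>t. if t \<in> I then fst p t else snd p t) I = fst p"
      "restrict (\<lambda>t. if t \<in> I then fst p t else snd p t) J = snd p"
      using assms by (auto simp: restrict_def fun_eq_iff PiE_def extensional_def)
    then show ?case by (simp add: case_prod_beta)
  next
    case (2 p)
    then show ?case by (auto simp: PiE_def extensional_def Pi_def)
  next
    case (3 w)
    then show ?case by (auto simp: fun_eq_iff PiE_def extensional_def)
  next
    case (4 w)
    then show ?case by (auto simp: PiE_def extensional_def Pi_def)
  next
    case (5 p)
    then have "restrict (\<lambda>t. if t \<in> I then fst p t else snd p t) I = fst p"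
      "restrict (\<lambda>t. if t \<in> I then fst p t else snd p t) J = snd p"
      using assms by (auto simp: restrict_def fun_eq_iff PiE_def extensional_def)
    then show ?case by (simp add: case_prod_beta)
  qed
  finally show ?thesis by simp
qed

lemma sum_PiE_Suc:
  assumes "l \<le> n" "finite E"
  shows "(\<Sum>w\<in>{l<..Suc n} \<rightarrow>\<^sub>E E. F w) = (\<Sum>w\<in>{l<..n} \<rightarrow>\<^sub>E E. \<Sum>c\<in>E. F (w(Suc n := c)))"
proof -
  have "(\<Sum>w\<in>{l<..n} \<rightarrow>\<^sub>E E. \<Sum>c\<in>E. F (w(Suc n := c))) =
      (\<Sum>(w, c)\<in>({l<..n} \<rightarrow>\<^sub>E E) \<times> E. F (w(Suc n := c)))"
    by (simp add: sum.cartesian_product)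
  also have "\<dots> = (\<Sum>w\<in>{l<..Suc n} \<rightarrow>\<^sub>E E. F w)"
    by (rule sum.reindex_bij_witness[where i = "\<lambda>w. (restrict w {l<..n}, w (Suc n))"
        and j = "\<lambda>(w, c). w(Suc n := c)"])
      (use assms in \<open>auto simp: fun_eq_iff PiE_def extensional_def Pi_def le_Suc_eq split: if_splits\<close>)
  finally show ?thesis by simp
qed

lemma colour_weight_cong:
  "(\<And>t s. t \<in> P \<Longrightarrow> s = t \<or> r t < s \<and> s < t \<Longrightarrow> w s = w' s) \<Longrightarrow> colour_weight \<phi> r P w = colour_weight \<phi> r P w'"
  unfolding colour_weight_def by (rule prod.cong) (auto intro!: arg_cong2[of _ _ _ _ \<phi>] image_cong)

text \<open>
  The graph has no edge across \<open>s\<close>, so the colourings of the two sides are independent.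
\<close>

lemma colour_sum_disconnected:
  assumes "l \<le> s" "s \<le> n" "\<And>t. l < t \<Longrightarrow> t \<le> s \<Longrightarrow> l \<le> r t" "\<And>t. s < t \<Longrightarrow> t \<le> n \<Longrightarrow> s \<le> r t"
  shows "colour_sum \<phi> E l n r = colour_sum \<phi> E l s r * colour_sum \<phi> E s n r"
proof -
  have U: "{l<..n} = {l<..s} \<union> {s<..n}" "{l<..s} \<inter> {s<..n} = {}" using assms by auto
  have split: "colour_weight \<phi> r {l<..n} w = colour_weight \<phi> r {l<..s} (restrict w {l<..s}) *
      colour_weight \<phi> r {s<..n} (restrict w {s<..n})" for w
  proof -
    have "colour_weight \<phi> r {l<..n} w = colour_weight \<phi> r {l<..s} w * colour_weight \<phi> r {s<..n} w"
      unfolding colour_weight_def U(1) by (rule prod.union_disjoint) auto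
    also have "colour_weight \<phi> r {l<..s} w = colour_weight \<phi> r {l<..s} (restrict w {l<..s})"
      by (rule colour_weight_cong) (use assms(3) in force)
    also have "colour_weight \<phi> r {s<..n} w = colour_weight \<phi> r {s<..n} (restrict w {s<..n})"
      by (rule colour_weight_cong) (use assms(4) in force)
    finally show ?thesis .
  qed
  show ?thesis
    unfolding colour_sum_def split using sum_PiE_Un[OF U(2), of "colour_weight \<phi> r {l<..s}" "colour_weight \<phi> r {s<..n}" E]
    by (simp add: U(1))
qed

text \<open>
  The two exchange identities say what happens when the colours \<open>x, y\<close> of two adjacent vertices
  with the same neighbours, coloured by \<open>S\<close>, are exchanged. In \<open>swap_below\<close> a later vertex of colour
  \<open>z\<close>, whose remaining neighbours are coloured by \<open>R\<close>, sees none, one or both of them; in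
  \<open>swap_above\<close> an earlier vertex of colour \<open>u\<close> is seen by none, one or both of them.
\<close>

locale colour_system =
  fixes q :: "'a::field" and E :: "nat set" and \<phi> :: "nat set \<Rightarrow> nat \<Rightarrow> 'a"
  assumes two: "(2::'a) \<noteq> 0" and finite_colours: "finite E"
    and proper: "\<And>R c. c \<in> R \<Longrightarrow> \<phi> R c = 0"
    and swap_below: "\<And>S R x y z. \<lbrakk>S \<subseteq> E; R \<subseteq> E; x \<in> E; y \<in> E; z \<in> E; x \<noteq> y; x \<notin> R; y \<notin> R\<rbrakk> \<Longrightarrow>
      (1 + q) * (\<phi> S x * \<phi> (insert x S) y * \<phi> (insert y R) z + \<phi> S y * \<phi> (insert y S) x * \<phi> (insert x R) z)
      = (\<phi> S x * \<phi> (insert x S) y + \<phi> S y * \<phi> (insert y S) x) * (\<phi> (insert x (insert y R)) z + q * \<phi> R z)"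
    and swap_above: "\<And>S u x y. \<lbrakk>S \<subseteq> E; x \<in> E; y \<in> E; u \<in> E; x \<noteq> y; u \<notin> S\<rbrakk> \<Longrightarrow>
      (1 + q) * (\<phi> (insert u S) x * \<phi> (insert x S) y + \<phi> (insert u S) y * \<phi> (insert y S) x)
      = \<phi> (insert u S) x * \<phi> (insert x (insert u S)) y + \<phi> (insert u S) y * \<phi> (insert y (insert u S)) x
        + q * (\<phi> S x * \<phi> (insert x S) y + \<phi> S y * \<phi> (insert y S) x)"
begin

text \<open>
  All other vertices see both or neither of \<open>a\<close> and \<open>a + 1\<close>. Hence in the sum over a colouring and
  the colouring with the two colours exchanged, their weights come out as a common factor, and what
  remains is one of the exchange identities. If the colours do not meet the conditions of the
  identity, some vertex is adjacent to a vertex of its own colour and all weights are zero. The same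
  argument proves both laws.
\<close>

lemma vertex_law:
  assumes r: "reach_fun l n r" and t: "t \<le> n" "r t = a" "l < a" "Suc a < t" "r a = r (Suc a)"
    "r (t - 1) < a" "t < n \<Longrightarrow> a < r (Suc t)"
  shows "(1 + q) * colour_sum \<phi> E l n r =
    colour_sum \<phi> E l n (r(t := a - 1)) + q * colour_sum \<phi> E l n (r(t := Suc a))"
proof -
  note R = reach_funD[OF r]
  let ?P = "{l<..n}"
  let ?Q = "?P - {a, Suc a, t}"
  let ?W = "\<lambda>r. colour_weight \<phi> r ?P"
  let ?K = "\<lambda>w. \<Prod>s\<in>?Q. \<phi> (w ` {r s<..<s}) (w s)"
  let ?S = "\<lambda>w. w ` {r a<..<a}" and ?R = "\<lambda>w. w ` {Suc a<..<t}"
  have ra: "r a < a" using R(2)[of a] t by auto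
  have sep: "r s < a" if "l < s" "s < t" for s
  proof -
    have "r s \<le> r (t - 1)" using that t by (intro R(3)) linarith+
    then show ?thesis using t by linarith
  qed
  have sep': "a < r s" if "t < s" "s \<le> n" for s
    using R(3)[of "Suc t" s] that t by auto
  have P: "?P = insert a (insert (Suc a) (insert t ?Q))" using t by auto
  have split: "?W (r(t := v)) w =
      ?K w * (\<phi> (?S w) (w a) * \<phi> (insert (w a) (?S w)) (w (Suc a)) * \<phi> (w ` {v<..<t}) (w t))" for v w
  proof -
    have "{r (Suc a)<..<Suc a} = insert a {r a<..<a}" using ra t by auto
    then have b: "w ` {r (Suc a)<..<Suc a} = insert (w a) (?S w)" by simp
    have "?W (r(t := v)) w = (\<Prod>s\<in>insert a (insert (Suc a) (insert t ?Q)).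
      \<phi> (w ` {(r(t := v)) s<..<s}) (w s))"
      unfolding colour_weight_def by (subst P) rule
    also have "\<dots> = \<phi> (?S w) (w a) * (\<phi> (insert (w a) (?S w)) (w (Suc a)) *
        (\<phi> (w ` {v<..<t}) (w t) * (\<Prod>s\<in>?Q. \<phi> (w ` {(r(t := v)) s<..<s}) (w s))))"
      using t b by simp
    also have "(\<Prod>s\<in>?Q. \<phi> (w ` {(r(t := v)) s<..<s}) (w s)) = ?K w"
      by (rule prod.cong) auto
    finally show ?thesis by (simp add: mult_ac del: fun_upd_apply)
  qed
  have nbrs: "w ` {a<..<t} = insert (w (Suc a)) (?R w)"
    "w ` {a - 1<..<t} = insert (w a) (insert (w (Suc a)) (?R w))" for w :: "nat \<Rightarrow> nat"
  proof -
    have "{a<..<t} = insert (Suc a) {Suc a<..<t}" "{a - 1<..<t} = insert a (insert (Suc a) {Suc a<..<t})"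
      using t by auto
    then show "w ` {a<..<t} = insert (w (Suc a)) (?R w)"
      "w ` {a - 1<..<t} = insert (w a) (insert (w (Suc a)) (?R w))" by simp_all
  qed
  define D where "D w = (1 + q) * ?W (r(t := a)) w - (?W (r(t := a - 1)) w + q * ?W (r(t := Suc a)) w)" for w
  have "D w + D (swap_adj a w) = 0" if w: "w \<in> ?P \<rightarrow>\<^sub>E E" for w
  proof -
    have K: "?K (swap_adj a w) = ?K w"
    proof (rule prod.cong)
      fix s assume s: "s \<in> ?Q"
      have "a \<in> {r s<..<s} \<longleftrightarrow> Suc a \<in> {r s<..<s}"
        using s sep[of s] sep'[of s] by (cases s t rule: linorder_cases) auto
      then show "\<phi> (swap_adj a w ` {r s<..<s}) (swap_adj a w s) = \<phi> (w ` {r s<..<s}) (w s)"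
        using s by (simp add: swap_adj_image)
    qed simp
    have S: "?S (swap_adj a w) = ?S w" "?R (swap_adj a w) = ?R w" by (intro swap_adj_image; simp)+
    consider "w a = w (Suc a)" | "w a \<in> ?R w \<or> w (Suc a) \<in> ?R w"
      | "w a \<noteq> w (Suc a)" "w a \<notin> ?R w" "w (Suc a) \<notin> ?R w" by blast
    then show ?thesis
    proof cases
      case 1
      then show ?thesis unfolding D_def split by (simp add: proper)
    next
      case 2
      then obtain s where s: "Suc a < s" "s < t" "w s = w a \<or> w s = w (Suc a)" by force
      have "r s < a" using s t by (intro sep) auto
      then have "w s \<in> w ` {r s<..<s}" using s by auto
      then have "\<phi> (w ` {r s<..<s}) (w s) = 0" by (rule proper)
      then have "?K w = 0" using s t by (intro prod_zero bexI[of _ s]) auto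
      then show ?thesis unfolding D_def split K by (simp only:) simp
    next
      case 3
      let ?x = "w a" and ?y = "w (Suc a)" and ?z = "w t"
      have z: "swap_adj a w t = ?z" using t by auto
      have "D w + D (swap_adj a w) = ?K w * ((1 + q) *
          (\<phi> (?S w) ?x * \<phi> (insert ?x (?S w)) ?y * \<phi> (insert ?y (?R w)) ?z +
           \<phi> (?S w) ?y * \<phi> (insert ?y (?S w)) ?x * \<phi> (insert ?x (?R w)) ?z)
         - (\<phi> (?S w) ?x * \<phi> (insert ?x (?S w)) ?y + \<phi> (?S w) ?y * \<phi> (insert ?y (?S w)) ?x) *
           (\<phi> (insert ?x (insert ?y (?R w))) ?z + q * \<phi> (?R w) ?z))"
        unfolding D_def split K S nbrs swap_adj_simps z
        by (simp add: insert_commute[of ?y ?x] algebra_simps)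
      also have "\<dots> = 0"
      proof -
        have "?S w \<subseteq> E" "?R w \<subseteq> E" "?x \<in> E" "?y \<in> E" "?z \<in> E"
          using w t R(1)[of a] by (fastforce simp: PiE_def Pi_def)+
        then show ?thesis using 3 by (subst swap_below) auto
      qed
      finally show ?thesis .
    qed
  qed
  then have "sum D (?P \<rightarrow>\<^sub>E E) = 0"
    using t by (intro sum_eq_0_by_swap[of a] two) auto
  moreover have "r(t := a) = r" using t by auto
  ultimately show ?thesis
    unfolding D_def colour_sum_def by (simp add: sum_subtractf sum.distrib sum_distrib_left)
qed

lemma pair_law:
  assumes r: "reach_fun l n r" and a: "l < a" "Suc a \<le> n" "r (Suc a) = Suc (r a)" "r (Suc a) < a"
    "\<And>t. Suc a < t \<Longrightarrow> t \<le> n \<Longrightarrow> r t \<noteq> a"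
  shows "(1 + q) * colour_sum \<phi> E l n r =
    colour_sum \<phi> E l n (r(Suc a := r a)) + q * colour_sum \<phi> E l n (r(a := r (Suc a)))"
proof -
  note R = reach_funD[OF r]
  let ?P = "{l<..n}"
  let ?Q = "?P - {a, Suc a}"
  let ?u = "r (Suc a)"
  let ?W = "\<lambda>r. colour_weight \<phi> r ?P"
  let ?K = "\<lambda>w. \<Prod>s\<in>?Q. \<phi> (w ` {r s<..<s}) (w s)"
  let ?S = "\<lambda>w. w ` {?u<..<a}"
  have P: "?P = insert a (insert (Suc a) ?Q)" using a by auto
  have split: "?W (r(a := v, Suc a := v')) w =
      ?K w * (\<phi> (w ` {v<..<a}) (w a) * \<phi> (w ` {v'<..<Suc a}) (w (Suc a)))" for v v' w
  proof -
    have "?W (r(a := v, Suc a := v')) w = (\<Prod>s\<in>insert a (insert (Suc a) ?Q).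
      \<phi> (w ` {(r(a := v, Suc a := v')) s<..<s}) (w s))"
      unfolding colour_weight_def by (subst P) rule
    also have "\<dots> = \<phi> (w ` {v<..<a}) (w a) * (\<phi> (w ` {v'<..<Suc a}) (w (Suc a)) *
        (\<Prod>s\<in>?Q. \<phi> (w ` {(r(a := v, Suc a := v')) s<..<s}) (w s)))"
      by simp
    also have "(\<Prod>s\<in>?Q. \<phi> (w ` {(r(a := v, Suc a := v')) s<..<s}) (w s)) = ?K w"
      by (rule prod.cong) auto
    finally show ?thesis by (simp add: mult_ac del: fun_upd_apply)
  qed
  have nbrs: "w ` {r a<..<a} = insert (w ?u) (?S w)"
    "w ` {?u<..<Suc a} = insert (w a) (?S w)"
    "w ` {r a<..<Suc a} = insert (w a) (insert (w ?u) (?S w))" for w :: "nat \<Rightarrow> nat"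
  proof -
    have "{r a<..<a} = insert ?u {?u<..<a}" "{?u<..<Suc a} = insert a {?u<..<a}"
      "{r a<..<Suc a} = insert a (insert ?u {?u<..<a})" using a by auto
    then show "w ` {r a<..<a} = insert (w ?u) (?S w)"
      "w ` {?u<..<Suc a} = insert (w a) (?S w)"
      "w ` {r a<..<Suc a} = insert (w a) (insert (w ?u) (?S w))" by simp_all
  qed
  define D where "D w = (1 + q) * ?W (r(a := r a, Suc a := ?u)) w
    - (?W (r(a := r a, Suc a := r a)) w + q * ?W (r(a := ?u, Suc a := ?u)) w)" for w
  have "D w + D (swap_adj a w) = 0" if w: "w \<in> ?P \<rightarrow>\<^sub>E E" for w
  proof -
    have K: "?K (swap_adj a w) = ?K w"
    proof (rule prod.cong)
      fix s assume s: "s \<in> ?Q"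
      have "s > Suc a \<Longrightarrow> r s \<noteq> a" using s a by auto
      then have "a \<in> {r s<..<s} \<longleftrightarrow> Suc a \<in> {r s<..<s}" using s by auto
      then show "\<phi> (swap_adj a w ` {r s<..<s}) (swap_adj a w s) = \<phi> (w ` {r s<..<s}) (w s)"
        using s by (simp add: swap_adj_image)
    qed simp
    have S: "?S (swap_adj a w) = ?S w" by (intro swap_adj_image) simp
    have u: "swap_adj a w ?u = w ?u" using a by (intro swap_adj_simps) auto
    consider "w a = w (Suc a)" | "w ?u \<in> ?S w" | "w a \<noteq> w (Suc a)" "w ?u \<notin> ?S w" by blast
    then show ?thesis
    proof cases
      case 1
      then show ?thesis unfolding D_def split nbrs by (simp add: proper)
    next
      case 2
      then obtain s where s: "?u < s" "s < a" "w s = w ?u" by force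
      have l: "l < s" using R(1)[of a] s a by auto
      have "r s \<le> r a" using s a l by (intro R) auto
      then have "w s \<in> w ` {r s<..<s}" using s a by auto
      then have "\<phi> (w ` {r s<..<s}) (w s) = 0" by (rule proper)
      then have "?K w = 0" using s a l by (intro prod_zero bexI[of _ s]) auto
      then show ?thesis unfolding D_def split K by (simp only:) simp
    next
      case 3
      let ?x = "w a" and ?y = "w (Suc a)"
      let ?T = "insert (w ?u) (?S w)"
      have "D w + D (swap_adj a w) = ?K w *
         ((1 + q) * (\<phi> ?T ?x * \<phi> (insert ?x (?S w)) ?y + \<phi> ?T ?y * \<phi> (insert ?y (?S w)) ?x)
          - (\<phi> ?T ?x * \<phi> (insert ?x ?T) ?y + \<phi> ?T ?y * \<phi> (insert ?y ?T) ?x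
            + q * (\<phi> (?S w) ?x * \<phi> (insert ?x (?S w)) ?y + \<phi> (?S w) ?y * \<phi> (insert ?y (?S w)) ?x)))"
        unfolding D_def split K nbrs S swap_adj_simps u
        by (simp add: algebra_simps)
      also have "\<dots> = 0"
      proof -
        have "l \<le> r a" using R(1)[of a] a by auto
        then have "?S w \<subseteq> E" "w ?u \<in> E" "?x \<in> E" "?y \<in> E"
          using w a by (fastforce simp: PiE_def Pi_def)+
        then show ?thesis using 3 by (subst swap_above) auto
      qed
      finally show ?thesis .
    qed
  qed
  then have "sum D (?P \<rightarrow>\<^sub>E E) = 0"
    using a by (intro sum_eq_0_by_swap[of a] two) auto
  moreover have "r(a := r a, Suc a := ?u) = r" "r(a := r a, Suc a := r a) = r(Suc a := r a)"
    "r(a := ?u, Suc a := ?u) = r(a := ?u)" by auto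
  ultimately show ?thesis
    unfolding D_def colour_sum_def by (simp add: sum_subtractf sum.distrib sum_distrib_left)
qed

end

section \<open>The chromatic quasisymmetric function\<close>

text \<open>
  In the resulting sum an edge \<open>s < t\<close> contributes \<open>q\<close> if it is an ascent of the colouring.
\<close>

definition chrom_step :: "'a::field \<Rightarrow> (nat \<Rightarrow> 'a) \<Rightarrow> nat set \<Rightarrow> nat \<Rightarrow> 'a" where
  "chrom_step q x R c = (if c \<in> R then 0 else q ^ card {s \<in> R. s < c} * x c)"

definition ascent_factor :: "'a::field \<Rightarrow> nat \<Rightarrow> nat \<Rightarrow> 'a" where
  "ascent_factor q s c = (if s = c then 0 else if s < c then q else 1)"

lemma chrom_step_insert:
  assumes "finite R" "s \<notin> R"
  shows "chrom_step q x (insert s R) c = ascent_factor q s c * chrom_step q x R c"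
proof -
  have "{i \<in> insert s R. i < c} = (if s < c then insert s {i \<in> R. i < c} else {i \<in> R. i < c})" by auto
  then show ?thesis using assms by (auto simp: chrom_step_def ascent_factor_def)
qed

lemma chrom_step_same: "c \<in> R \<Longrightarrow> chrom_step q x R c = 0"
  by (simp add: chrom_step_def)

lemma ascent_factor_swap:
  assumes "a \<noteq> b"
  shows "(1 + q) * (ascent_factor q a b * ascent_factor q b c + ascent_factor q b a * ascent_factor q a c)
      = (ascent_factor q a b + ascent_factor q b a) * (ascent_factor q a c * ascent_factor q b c + q)"
    and "(1 + q) * (ascent_factor q a b * ascent_factor q c a + ascent_factor q b a * ascent_factor q c b)
      = (ascent_factor q a b + ascent_factor q b a) * (ascent_factor q c a * ascent_factor q c b + q)"
  using assms
  by (cases a b rule: linorder_cases; cases a c rule: linorder_cases; cases b c rule: linorder_cases;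
      simp add: ascent_factor_def algebra_simps)+

lemma chrom_colour_system:
  assumes "(2::'a::field) \<noteq> 0" "finite E"
  shows "colour_system (q :: 'a) E (chrom_step q x)"
proof
  fix S R :: "nat set" and a b c :: nat
  let ?f = "chrom_step q x" and ?e = "ascent_factor q"
  assume "S \<subseteq> E" "R \<subseteq> E" and ab: "a \<noteq> b" "a \<notin> R" "b \<notin> R"
  then have *: "finite S" "finite R" "a \<noteq> b" "a \<notin> R" "b \<notin> R"
    using assms by (auto intro: finite_subset)
  show "(1 + q) * (?f S a * ?f (insert a S) b * ?f (insert b R) c + ?f S b * ?f (insert b S) a * ?f (insert a R) c)
      = (?f S a * ?f (insert a S) b + ?f S b * ?f (insert b S) a) * (?f (insert a (insert b R)) c + q * ?f R c)"
  proof (cases "a \<in> S \<or> b \<in> S")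
    case True
    then have "?f S a * ?f (insert a S) b = 0" "?f S b * ?f (insert b S) a = 0"
      by (auto simp: chrom_step_same)
    then show ?thesis by (simp only: mult_zero_left mult_zero_right add_0)
  next
    case False
    then have e: "?f S a * ?f (insert a S) b = ?f S a * ?f S b * ?e a b"
      "?f S b * ?f (insert b S) a = ?f S a * ?f S b * ?e b a"
      "?f (insert a R) c = ?f R c * ?e a c" "?f (insert b R) c = ?f R c * ?e b c"
      "?f (insert a (insert b R)) c = ?f R c * (?e a c * ?e b c)"
      using * by (simp_all add: chrom_step_insert)
    show ?thesis
      using arg_cong[OF ascent_factor_swap(1)[OF \<open>a \<noteq> b\<close>, of q c], of "\<lambda>z. ?f S a * ?f S b * ?f R c * z"]
      unfolding e by (simp add: algebra_simps)
  qed
next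
  fix S :: "nat set" and u a b :: nat
  let ?f = "chrom_step q x" and ?e = "ascent_factor q"
  assume "S \<subseteq> E" and ab: "a \<noteq> b" "u \<notin> S"
  then have *: "finite S" "a \<noteq> b" "u \<notin> S"
    using assms by (auto intro: finite_subset)
  show "(1 + q) * (?f (insert u S) a * ?f (insert a S) b + ?f (insert u S) b * ?f (insert b S) a)
      = ?f (insert u S) a * ?f (insert a (insert u S)) b + ?f (insert u S) b * ?f (insert b (insert u S)) a
        + q * (?f S a * ?f (insert a S) b + ?f S b * ?f (insert b S) a)"
  proof (cases "a \<in> S \<or> b \<in> S")
    case True
    then have "?f S a * ?f (insert a S) b = 0" "?f S b * ?f (insert b S) a = 0"
      "?f (insert u S) a * ?f (insert a S) b = 0" "?f (insert u S) b * ?f (insert b S) a = 0"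
      "?f (insert u S) a * ?f (insert a (insert u S)) b = 0" "?f (insert u S) b * ?f (insert b (insert u S)) a = 0"
      by (auto simp: chrom_step_same)
    then show ?thesis by (simp only: mult_zero_left mult_zero_right add_0)
  next
    case False
    have ua: "?f (insert a (insert u S)) b = ?f S b * (?e a b * ?e u b)" if "u \<noteq> a"
      using that * False by (simp add: chrom_step_insert)
    have ub: "?f (insert b (insert u S)) a = ?f S a * (?e b a * ?e u a)" if "u \<noteq> b"
      using that * False by (simp add: chrom_step_insert)
    have e: "?f (insert u S) a = ?f S a * ?e u a" "?f (insert u S) b = ?f S b * ?e u b"
      "?f (insert a S) b = ?f S b * ?e a b" "?f (insert b S) a = ?f S a * ?e b a"
      using * False by (simp_all add: chrom_step_insert)
    have "?f (insert u S) a * ?f (insert a (insert u S)) b = ?f S a * ?f S b * (?e a b * ?e u a * ?e u b)"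
      using ua e by (cases "u = a") (auto simp: ascent_factor_def chrom_step_same)
    moreover have "?f (insert u S) b * ?f (insert b (insert u S)) a = ?f S a * ?f S b * (?e b a * ?e u a * ?e u b)"
      using ub e by (cases "u = b") (auto simp: ascent_factor_def chrom_step_same)
    ultimately show ?thesis
      using arg_cong[OF ascent_factor_swap(2)[OF \<open>a \<noteq> b\<close>, of q u], of "\<lambda>z. ?f S a * ?f S b * z"]
      by (simp only: e) (simp add: algebra_simps)
  qed
qed (use assms in \<open>auto simp: chrom_step_same\<close>)

definition elem_sym :: "(nat \<Rightarrow> 'a::comm_ring_1) \<Rightarrow> nat set \<Rightarrow> nat \<Rightarrow> 'a" where
  "elem_sym x E k = (\<Sum>S | S \<subseteq> E \<and> card S = k. \<Prod>s\<in>S. x s)"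

lemma elem_sym_0: "finite E \<Longrightarrow> elem_sym x E 0 = 1"
proof -
  assume "finite E"
  then have "{S. S \<subseteq> E \<and> card S = 0} = {{}}" by (auto dest: finite_subset)
  then show ?thesis by (simp add: elem_sym_def)
qed

text \<open>
  The number of elements below \<open>c\<close> runs through \<open>0, \<dots>, card S - 1\<close>.
\<close>

lemma sum_power_rank:
  fixes q :: "'a::field" and S :: "nat set"
  assumes "finite S"
  shows "(\<Sum>c\<in>S. q ^ card {s \<in> S. s < c}) = (\<Sum>i<card S. q ^ i)"
  using assms
proof (induction S rule: finite_linorder_max_induct)
  case (insert b A)
  have "{s \<in> insert b A. s < c} = {s \<in> A. s < c}" if "c \<in> A" for c using that insert by auto
  moreover have "{s \<in> insert b A. s < b} = A" using insert by auto
  moreover have "b \<notin> A" using insert by auto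
  ultimately show ?case using insert by simp
qed simp

lemma colour_weight_complete_inj:
  assumes "\<And>R c. c \<in> R \<Longrightarrow> \<phi> R c = 0" "\<forall>t\<in>{l<..n}. r t = l" "colour_weight \<phi> r {l<..n} w \<noteq> 0"
  shows "inj_on w {l<..n}"
proof (rule linorder_inj_onI)
  fix s t assume st: "s < t" "s \<in> {l<..n}" "t \<in> {l<..n}"
  show "w s \<noteq> w t"
  proof
    assume "w s = w t"
    moreover have "s \<in> {r t<..<t}" using st assms(2) by auto
    ultimately have "w t \<in> w ` {r t<..<t}" by (metis imageI)
    then have "\<phi> (w ` {r t<..<t}) (w t) = 0" by (rule assms(1))
    then have "colour_weight \<phi> r {l<..n} w = 0"
      unfolding colour_weight_def using st by (intro prod_zero bexI[of _ t]) auto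
    then show False using assms(3) by simp
  qed
qed auto

lemma colour_weight_Suc:
  assumes "l \<le> n"
  shows "colour_weight \<phi> r {l<..Suc n} (w(Suc n := c)) =
    colour_weight \<phi> r {l<..n} w * \<phi> (w ` {r (Suc n)<..n}) c"
proof -
  have "{l<..Suc n} = insert (Suc n) {l<..n}" using assms by auto
  moreover have "colour_weight \<phi> r {l<..n} (w(Suc n := c)) = colour_weight \<phi> r {l<..n} w"
    by (rule colour_weight_cong) auto
  moreover have "(w(Suc n := c)) ` {r (Suc n)<..<Suc n} = w ` {r (Suc n)<..n}" by (auto simp: image_def)
  moreover have "colour_weight \<phi> r (insert (Suc n) {l<..n}) v =
      \<phi> (v ` {r (Suc n)<..<Suc n}) (v (Suc n)) * colour_weight \<phi> r {l<..n} v" for v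
    unfolding colour_weight_def by (rule prod.insert) auto
  ultimately show ?thesis by (simp only: fun_upd_same mult.commute)
qed

text \<open>
  With as many colours as vertices the colourings of a complete graph are the bijections. The last
  vertex sees every other colour, so choosing its colour contributes \<open>[n - l]\<close>.
\<close>

lemma chrom_sum_complete_bij:
  assumes "l \<le> n" "\<forall>t\<in>{l<..n}. r t = l" "finite S" "card S = n - l"
  shows "colour_sum (chrom_step q x) S l n r = (\<Prod>k=1..n - l. \<Sum>i<k. q ^ i) * (\<Prod>s\<in>S. x s)"
  using assms
proof (induction n arbitrary: S rule: dec_induct)
  case base
  then show ?case by (simp add: colour_sum_def colour_weight_def)
next
  case (step n)
  let ?f = "chrom_step q x"
  have inner: "(\<Sum>w\<in>{l<..n} \<rightarrow>\<^sub>E S. colour_weight ?f r {l<..n} w * ?f (w ` {l<..n}) c) =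
      (\<Prod>k=1..n - l. \<Sum>i<k. q ^ i) * (\<Prod>s\<in>S. x s) * q ^ card {s \<in> S. s < c}" if c: "c \<in> S" for c
  proof -
    have "(\<Sum>w\<in>{l<..n} \<rightarrow>\<^sub>E S. colour_weight ?f r {l<..n} w * ?f (w ` {l<..n}) c) =
        (\<Sum>w\<in>{l<..n} \<rightarrow>\<^sub>E (S - {c}). colour_weight ?f r {l<..n} w * ?f (w ` {l<..n}) c)"
    proof (rule sum.mono_neutral_right)
      show "finite ({l<..n} \<rightarrow>\<^sub>E S)" using step by (intro finite_PiE) auto
      show "\<forall>w\<in>({l<..n} \<rightarrow>\<^sub>E S) - ({l<..n} \<rightarrow>\<^sub>E (S - {c})). colour_weight ?f r {l<..n} w * ?f (w ` {l<..n}) c = 0"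
      proof
        fix w assume w: "w \<in> ({l<..n} \<rightarrow>\<^sub>E S) - ({l<..n} \<rightarrow>\<^sub>E (S - {c}))"
        then have "c \<in> w ` {l<..n}" by (auto simp: PiE_def Pi_def)
        then show "colour_weight ?f r {l<..n} w * ?f (w ` {l<..n}) c = 0" by (simp add: chrom_step_same)
      qed
    qed (auto simp: PiE_def Pi_def)
    also have "\<dots> = (\<Sum>w\<in>{l<..n} \<rightarrow>\<^sub>E (S - {c}). colour_weight ?f r {l<..n} w * ?f (S - {c}) c)"
    proof (rule sum.cong)
      fix w assume w: "w \<in> {l<..n} \<rightarrow>\<^sub>E (S - {c})"
      show "colour_weight ?f r {l<..n} w * ?f (w ` {l<..n}) c = colour_weight ?f r {l<..n} w * ?f (S - {c}) c"
      proof (cases "colour_weight ?f r {l<..n} w = 0")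
        case False
        then have "inj_on w {l<..n}"
          using step by (intro colour_weight_complete_inj[of ?f l n r]) (auto simp: chrom_step_same)
        then have "card (w ` {l<..n}) = card (S - {c})" using step c by (simp add: card_image)
        moreover have "w ` {l<..n} \<subseteq> S - {c}" using w by auto
        ultimately have "w ` {l<..n} = S - {c}" using step by (intro card_subset_eq) auto
        then show ?thesis by simp
      qed simp
    qed simp
    also have "\<dots> = colour_sum ?f (S - {c}) l n r * ?f (S - {c}) c"
      by (simp add: colour_sum_def sum_distrib_right)
    also have "colour_sum ?f (S - {c}) l n r = (\<Prod>k=1..n - l. \<Sum>i<k. q ^ i) * (\<Prod>s\<in>S - {c}. x s)"
      using step c by (intro step.IH) auto
    also have "?f (S - {c}) c = q ^ card {s \<in> S. s < c} * x c"
    proof -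
      have "{s \<in> S - {c}. s < c} = {s \<in> S. s < c}" by auto
      then show ?thesis by (simp add: chrom_step_def)
    qed
    also have "(\<Prod>s\<in>S. x s) = x c * (\<Prod>s\<in>S - {c}. x s)"
      using step c by (intro prod.remove) auto
    ultimately show ?thesis by (simp add: mult_ac)
  qed
  have "colour_sum ?f S l (Suc n) r =
      (\<Sum>w\<in>{l<..n} \<rightarrow>\<^sub>E S. \<Sum>c\<in>S. colour_weight ?f r {l<..n} w * ?f (w ` {l<..n}) c)"
    unfolding colour_sum_def using step by (subst sum_PiE_Suc) (auto simp: colour_weight_Suc)
  also have "\<dots> = (\<Sum>c\<in>S. (\<Prod>k=1..n - l. \<Sum>i<k. q ^ i) * (\<Prod>s\<in>S. x s) * q ^ card {s \<in> S. s < c})"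
    by (subst sum.swap, rule sum.cong) (use inner in auto)
  also have "\<dots> = (\<Prod>k=1..n - l. \<Sum>i<k. q ^ i) * (\<Prod>s\<in>S. x s) * (\<Sum>i<card S. q ^ i)"
    using step by (simp add: sum_distrib_left[symmetric] sum_power_rank)
  finally show ?case using step by (simp add: Suc_diff_le)
qed

lemma chrom_sum_complete:
  assumes "l \<le> n" "\<forall>t\<in>{l<..n}. r t = l" "finite E"
  shows "colour_sum (chrom_step q x) E l n r = (\<Prod>k=1..n - l. \<Sum>i<k. q ^ i) * elem_sym x E (n - l)"
proof -
  let ?W = "colour_weight (chrom_step q x) r {l<..n}"
  let ?Z = "{w \<in> {l<..n} \<rightarrow>\<^sub>E E. ?W w \<noteq> 0}" and ?T = "{S. S \<subseteq> E \<and> card S = n - l}"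
  have inj: "inj_on w {l<..n}" if "?W w \<noteq> 0" for w
    using assms that by (intro colour_weight_complete_inj[of "chrom_step q x" l n r]) (auto simp: chrom_step_same)
  have fin: "finite ({l<..n} \<rightarrow>\<^sub>E S)" if "S \<subseteq> E" for S
    using that assms by (intro finite_PiE) (auto intro: finite_subset)
  have "colour_sum (chrom_step q x) E l n r = sum ?W ?Z"
    unfolding colour_sum_def using fin by (intro sum.mono_neutral_right) auto
  also have "\<dots> = (\<Sum>S\<in>?T. \<Sum>w\<in>{w \<in> ?Z. w ` {l<..n} = S}. ?W w)"
  proof (rule sum.group[symmetric])
    show "finite ?Z" using fin by simp
    show "finite ?T" using assms by simp
    show "(\<lambda>w. w ` {l<..n}) ` ?Z \<subseteq> ?T"
    proof (rule image_subsetI)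
      fix w assume w: "w \<in> ?Z"
      then have "w ` {l<..n} \<subseteq> E" by auto
      then show "w ` {l<..n} \<in> ?T" using w card_image[OF inj[of w]] by simp
    qed
  qed
  also have "\<dots> = (\<Sum>S\<in>?T. colour_sum (chrom_step q x) S l n r)"
  proof (rule sum.cong)
    fix S assume S: "S \<in> ?T"
    then have "finite S" using assms by (auto intro: finite_subset)
    have image: "w ` {l<..n} = S" if "w \<in> {l<..n} \<rightarrow>\<^sub>E S" "?W w \<noteq> 0" for w
    proof (rule card_subset_eq)
      show "w ` {l<..n} \<subseteq> S" using that(1) by auto
      show "card (w ` {l<..n}) = card S" using S card_image[OF inj[OF that(2)]] by simp
    qed fact
    have "{w \<in> ?Z. w ` {l<..n} = S} = {w \<in> {l<..n} \<rightarrow>\<^sub>E S. ?W w \<noteq> 0}" (is "?A = ?B")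
    proof (intro set_eqI iffI)
      fix w assume "w \<in> ?A"
      then show "w \<in> ?B" by (auto simp: PiE_def)
    next
      fix w assume w: "w \<in> ?B"
      then have "w \<in> {l<..n} \<rightarrow>\<^sub>E E" using S by (auto simp: PiE_def Pi_def)
      then show "w \<in> ?A" using w image[of w] by simp
    qed
    moreover have "sum ?W ?B = sum ?W ({l<..n} \<rightarrow>\<^sub>E S)"
      using S fin by (intro sum.mono_neutral_left) auto
    ultimately show "(\<Sum>w\<in>{w \<in> ?Z. w ` {l<..n} = S}. ?W w) = colour_sum (chrom_step q x) S l n r"
      unfolding colour_sum_def by simp
  qed simp
  also have "\<dots> = (\<Sum>S\<in>?T. (\<Prod>k=1..n - l. \<Sum>i<k. q ^ i) * (\<Prod>s\<in>S. x s))"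
    using assms by (intro sum.cong chrom_sum_complete_bij) (auto intro: finite_subset)
  finally show ?thesis by (simp add: elem_sym_def sum_distrib_left)
qed

section \<open>The transition weights\<close>

lemma qvar_power: "qvar ^ k = to_fract (monom 1 k)"
  by (induction k) (simp_all add: qvar_def monom_Suc flip: to_fract_mult)

lemma qvar_power_eq_iff [simp]: "qvar ^ i = qvar ^ j \<longleftrightarrow> i = j"
proof
  assume "qvar ^ i = qvar ^ j"
  then have "degree (monom (1::rat) i) = degree (monom (1::rat) j)" by (simp add: qvar_power)
  then show "i = j" by (simp add: degree_monom_eq)
qed simp

lemma qvar_nonzero [simp]: "qvar \<noteq> 0" by (simp add: qvar_def)

lemma two_ratfun: "(2::ratfun) \<noteq> 0"
proof -
  have "(2::ratfun) = to_fract (1 + 1)" unfolding to_fract_add to_fract_1 by simp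
  then show ?thesis by (simp only: to_fract_eq_0_iff)
qed

lemma qint_0 [simp]: "qint 0 = 0" and qint_1 [simp]: "qint (Suc 0) = 1"
  and qint_Suc: "qint (Suc k) = qint k + qvar ^ k"
  by (simp_all add: qint_def)

lemma qvar_power_diff: "i \<le> j \<Longrightarrow> qvar ^ j - qvar ^ i = (qvar - 1) * qvar ^ i * qint (j - i)"
proof (induction j rule: dec_induct)
  case (step j)
  then show ?case by (simp add: Suc_diff_le qint_Suc algebra_simps flip: power_add)
qed simp

lemma qint_nonzero [simp]: "qint k = 0 \<longleftrightarrow> k = 0"
  using qvar_power_diff[of 0 k] qvar_power_eq_iff[of k 0] by (cases "k = 0") auto

text \<open>
  With the value 1 at 0, products of ratios of consecutive \<open>q\<close>-integers telescope without exception.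
\<close>

definition qint_pos :: "nat \<Rightarrow> ratfun" where
  "qint_pos k = (if k = 0 then 1 else qint k)"

lemma qint_pos_nonzero [simp]: "qint_pos k \<noteq> 0" by (simp add: qint_pos_def)

text \<open>
  The probability that a new cell is added in column \<open>z\<close>, as a function of the set \<open>S\<close> of columns
  that contain large entries. The factor with \<open>s = z - 1\<close> is 1; it stands for the residue of the
  simple pole at \<open>q\<^sup>-\<^sup>z\<close>, and the weight is zero when this pole is absent.
\<close>

definition psi_set :: "nat set \<Rightarrow> nat \<Rightarrow> ratfun" where
  "psi_set S z = (if z \<in> S \<or> z \<noteq> 1 \<and> z - 1 \<notin> S then 0 else
     (\<Prod>s\<in>{s \<in> S. s < z}. qint_pos (z - s) / qint_pos (z - s - 1)) / qint_pos (z - 1)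
     * (\<Prod>s\<in>{s \<in> S. z < s}. qvar * qint (s - z) / qint (s + 1 - z)))"

lemma psi_set_same: "z \<in> S \<Longrightarrow> psi_set S z = 0" by (simp add: psi_set_def)

lemma psi_set_missing: "z = Suc s \<Longrightarrow> 0 < s \<Longrightarrow> s \<notin> S \<Longrightarrow> psi_set S z = 0" by (simp add: psi_set_def)

text \<open>
  Away from the pole, adding a letter \<open>s\<close> to \<open>R\<close> multiplies the weight of \<open>z\<close> by
  \<open>q (q\<^sup>s - q\<^sup>z) / (q\<^sup>s\<^sup>+\<^sup>1 - q\<^sup>z)\<close>. For \<open>s + 1 = z\<close> the rule fails: there \<open>psi_set R z = 0\<close>
  by \<open>psi_set_missing\<close>, which says nothing about the weight after adding \<open>s\<close>. These exceptional
  positions are the reason for the case distinctions below.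
\<close>

lemma psi_set_insert:
  assumes "finite R" "s \<notin> R" "Suc s \<noteq> z"
  shows "psi_set (insert s R) z * (qvar * qvar ^ s - qvar ^ z) = qvar * (qvar ^ s - qvar ^ z) * psi_set R z"
proof (cases s z rule: linorder_cases)
  case equal
  then show ?thesis by (simp add: psi_set_same)
next
  case less
  then have z: "Suc s < z" using assms by simp
  have sets: "{i \<in> insert s R. i < z} = insert s {i \<in> R. i < z}" "{i \<in> insert s R. z < i} = {i \<in> R. z < i}"
    using z by auto
  have "psi_set (insert s R) z * qint (z - Suc s) = qint (z - s) * psi_set R z"
    unfolding psi_set_def sets using z assms by (auto simp: qint_pos_def)
  then have "(1 - qvar) * (qvar * qvar ^ s) * (psi_set (insert s R) z * qint (z - Suc s)) =
      (1 - qvar) * (qvar * qvar ^ s) * (qint (z - s) * psi_set R z)" by (rule arg_cong)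
  moreover have "qvar * qvar ^ s - qvar ^ z = (1 - qvar) * (qvar * qvar ^ s) * qint (z - Suc s)"
    using qvar_power_diff[of "Suc s" z] z by (simp add: algebra_simps)
  moreover have "qvar ^ s - qvar ^ z = (1 - qvar) * qvar ^ s * qint (z - s)"
    using qvar_power_diff[of s z] z by (simp add: algebra_simps)
  ultimately show ?thesis by (simp add: mult_ac)
next
  case greater
  have sets: "{i \<in> insert s R. i < z} = {i \<in> R. i < z}" "{i \<in> insert s R. z < i} = insert s {i \<in> R. z < i}"
    using greater by auto
  have "z - 1 \<noteq> s" using greater by simp
  then have "psi_set (insert s R) z * qint (Suc s - z) = qvar * qint (s - z) * psi_set R z"
    unfolding psi_set_def sets using greater assms by auto
  then have "(qvar - 1) * qvar ^ z * (psi_set (insert s R) z * qint (Suc s - z)) =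
      (qvar - 1) * qvar ^ z * (qvar * qint (s - z) * psi_set R z)" by (rule arg_cong)
  moreover have "qvar * qvar ^ s - qvar ^ z = (qvar - 1) * qvar ^ z * qint (Suc s - z)"
    using qvar_power_diff[of z "Suc s"] greater by simp
  moreover have "qvar ^ s - qvar ^ z = (qvar - 1) * qvar ^ z * qint (s - z)"
    using qvar_power_diff[of z s] greater by simp
  ultimately show ?thesis by (simp add: mult_ac)
qed

lemma qvar_mult_power_neq: "Suc i \<noteq> j \<Longrightarrow> qvar * qvar ^ i - qvar ^ j \<noteq> 0"
  by (metis power_Suc qvar_power_eq_iff right_minus_eq)

lemma exchange_generic:
  fixes q :: "'a::field"
  assumes "V * (q * X - Y) = q * (X - Y) * B" "U * (q * Y - X) = q * (Y - X) * A"
  shows "A * V * (q * X - Y) = B * U * (X - q * Y)"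
  using assms by algebra

text \<open>
  The ratio of the weights of the two orders of a pair of letters. If the letters are consecutive
  numbers, one of the two orders has weight zero, in agreement with the vanishing factor.
\<close>

lemma psi_set_swap:
  assumes "finite S" "x \<noteq> y" "0 < x" "0 < y"
  shows "psi_set S x * psi_set (insert x S) y * (qvar * qvar ^ x - qvar ^ y) =
    psi_set S y * psi_set (insert y S) x * (qvar ^ x - qvar * qvar ^ y)"
proof (cases "x \<in> S \<or> y \<in> S")
  case True
  then have "psi_set S x * psi_set (insert x S) y = 0" "psi_set S y * psi_set (insert y S) x = 0"
    by (auto simp: psi_set_same)
  then show ?thesis by (simp only: mult_zero_left)
next
  case False
  consider "y = Suc x" | "x = Suc y" | "y \<noteq> Suc x" "x \<noteq> Suc y" by blast
  then show ?thesis
  proof cases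
    case 1
    then show ?thesis using False assms by (simp add: psi_set_missing)
  next
    case 2
    then show ?thesis using False assms by (simp add: psi_set_missing)
  next
    case 3
    have "psi_set (insert x S) y * (qvar * qvar ^ x - qvar ^ y) = qvar * (qvar ^ x - qvar ^ y) * psi_set S y"
      "psi_set (insert y S) x * (qvar * qvar ^ y - qvar ^ x) = qvar * (qvar ^ y - qvar ^ x) * psi_set S x"
      using False 3 assms by (intro psi_set_insert; auto)+
    then show ?thesis by (rule exchange_generic)
  qed
qed

text \<open>
  The exchange identity for rational functions, multiplied by its denominators: \<open>X, Y, Z\<close> stand for
  \<open>q\<^sup>x, q\<^sup>y, q\<^sup>z\<close>.
\<close>

lemma swap_below_generic:
  fixes q :: "'a::field"
  assumes "Ax * (q * X - Z) = q * (X - Z) * A" "Ay * (q * Y - Z) = q * (Y - Z) * A"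
    and "Axy * (q * X - Z) = q * (X - Z) * Ay" "P * (q * X - Y) = P' * (X - q * Y)"
    and "q * X - Z \<noteq> 0" "q * Y - Z \<noteq> 0"
  shows "(1 + q) * (P * Ay + P' * Ax) = (P + P') * (Axy + q * A)"
proof -
  have "((1 + q) * (P * Ay + P' * Ax) - (P + P') * (Axy + q * A)) * ((q * X - Z) * (q * Y - Z)) = 0"
    using assms(1-4) by algebra
  then show ?thesis using assms(5,6) by simp
qed

text \<open>
  The case \<open>Z = q X\<close>, where the letter \<open>x\<close> creates the pole at \<open>z\<close>.
\<close>

lemma swap_below_special:
  fixes q :: "'a::field"
  assumes "Axy * (q * Y - q * X) = q * (Y - q * X) * Ax" "P * (q * X - Y) = P' * (X - q * Y)"
    and "q \<noteq> 0" "X \<noteq> Y"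
  shows "(1 + q) * (P' * Ax) = (P + P') * Axy"
proof -
  have "((1 + q) * (P' * Ax) - (P + P') * Axy) * (q * (Y - X)) = 0"
    using assms(1,2) by algebra
  then show ?thesis using assms(3,4) by simp
qed

lemma psi_set_swap_below_aux:
  assumes "finite S" "finite R" "x \<noteq> y" "x \<notin> R" "y \<notin> R" "0 < x" "0 < y" "z = Suc x"
  shows "(1 + qvar) * (psi_set S x * psi_set (insert x S) y * psi_set (insert y R) z
      + psi_set S y * psi_set (insert y S) x * psi_set (insert x R) z)
    = (psi_set S x * psi_set (insert x S) y + psi_set S y * psi_set (insert y S) x)
      * (psi_set (insert x (insert y R)) z + qvar * psi_set R z)"
proof -
  have 0: "psi_set R z = 0" "psi_set (insert y R) z = 0" using assms by (auto intro: psi_set_missing)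
  have "psi_set (insert y (insert x R)) z * (qvar * qvar ^ y - qvar ^ z) =
      qvar * (qvar ^ y - qvar ^ z) * psi_set (insert x R) z"
    using assms by (intro psi_set_insert) auto
  then have "psi_set (insert x (insert y R)) z * (qvar * qvar ^ y - qvar * qvar ^ x) =
      qvar * (qvar ^ y - qvar * qvar ^ x) * psi_set (insert x R) z"
    using \<open>z = Suc x\<close> by (simp add: insert_commute[of x y])
  then have "(1 + qvar) * (psi_set S y * psi_set (insert y S) x * psi_set (insert x R) z) =
      (psi_set S x * psi_set (insert x S) y + psi_set S y * psi_set (insert y S) x) * psi_set (insert x (insert y R)) z"
    using assms by (rule_tac swap_below_special[OF _ psi_set_swap]) auto
  then show ?thesis using 0 by simp
qed

lemma psi_set_swap_below:
  assumes "finite S" "finite R" "x \<noteq> y" "x \<notin> R" "y \<notin> R" "0 < x" "0 < y"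
  shows "(1 + qvar) * (psi_set S x * psi_set (insert x S) y * psi_set (insert y R) z
      + psi_set S y * psi_set (insert y S) x * psi_set (insert x R) z)
    = (psi_set S x * psi_set (insert x S) y + psi_set S y * psi_set (insert y S) x)
      * (psi_set (insert x (insert y R)) z + qvar * psi_set R z)"
proof -
  consider "z = Suc x" | "z = Suc y" | "Suc x \<noteq> z" "Suc y \<noteq> z" by blast
  then show ?thesis
  proof cases
    case 1
    then show ?thesis using psi_set_swap_below_aux[of S R x y z] assms by simp
  next
    case 2
    then show ?thesis using psi_set_swap_below_aux[of S R y x z] assms
      by (simp add: insert_commute[of x y] add.commute)
  next
    case 3
    show ?thesis
    proof (rule swap_below_generic)
      show "psi_set (insert x R) z * (qvar * qvar ^ x - qvar ^ z) = qvar * (qvar ^ x - qvar ^ z) * psi_set R z"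
        "psi_set (insert y R) z * (qvar * qvar ^ y - qvar ^ z) = qvar * (qvar ^ y - qvar ^ z) * psi_set R z"
        "psi_set (insert x (insert y R)) z * (qvar * qvar ^ x - qvar ^ z) = qvar * (qvar ^ x - qvar ^ z) * psi_set (insert y R) z"
        using 3 assms by (intro psi_set_insert; auto)+
      show "psi_set S x * psi_set (insert x S) y * (qvar * qvar ^ x - qvar ^ y) =
        psi_set S y * psi_set (insert y S) x * (qvar ^ x - qvar * qvar ^ y)"
        using assms by (intro psi_set_swap) auto
      show "qvar * qvar ^ x - qvar ^ z \<noteq> 0" "qvar * qvar ^ y - qvar ^ z \<noteq> 0"
        using 3 by (intro qvar_mult_power_neq; simp)+
    qed
  qed
qed

text \<open>
  As above, with \<open>U\<close> for \<open>q\<^sup>u\<close>; \<open>P\<close>, \<open>O\<close> and \<open>B\<close> are the weights when \<open>u\<close> is seen by none, by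
  the first or by both of the two vertices.
\<close>

lemma swap_above_generic:
  fixes q :: "'a::field"
  assumes "Ox * (q * U - X) = q * (U - X) * P" "Oy * (q * U - Y) = q * (U - Y) * P'"
    and "Bx * (q * U - Y) = q * (U - Y) * Ox" "By * (q * U - X) = q * (U - X) * Oy"
    and "P * (q * X - Y) = P' * (X - q * Y)"
    and "q * U - X \<noteq> 0" "q * U - Y \<noteq> 0"
  shows "(1 + q) * (Ox + Oy) = Bx + By + q * (P + P')"
proof -
  have "((1 + q) * (Ox + Oy) - (Bx + By + q * (P + P'))) * ((q * U - X) * (q * U - Y)) = 0"
    using assms(1-5) by algebra
  then show ?thesis using assms(6,7) by simp
qed

text \<open>
  The case \<open>X = q U\<close>, where the letter \<open>u\<close> creates the pole at \<open>x\<close>.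
\<close>

lemma swap_above_special:
  fixes q :: "'a::field"
  assumes "B * (q * U - Y) = q * (U - Y) * A" "V * B * (q * (q * U) - Y) = P' * (q * U - q * Y)"
    and "q \<noteq> 0" "U \<noteq> Y"
  shows "(1 + q) * (V * A) = V * B + P'"
proof -
  have "((1 + q) * (V * A) - (V * B + P')) * (q * (U - Y)) = 0"
    using assms(1,2) by algebra
  then show ?thesis using assms(3,4) by simp
qed

text \<open>
  The case \<open>X = q U\<close> with \<open>y = u\<close>.
\<close>

lemma swap_above_adjacent:
  fixes q :: "'a::field"
  assumes "B * (q * (q * U) - U) = q * (q * U - U) * A" "q \<noteq> 1" "U \<noteq> 0"
  shows "(1 + q) * B = q * A"
proof -
  have "((1 + q) * B - q * A) * ((q - 1) * U) = 0" using assms(1) by algebra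
  then show ?thesis using assms(2,3) by simp
qed

lemma psi_set_swap_above_aux:
  assumes "finite S" "x \<noteq> y" "u \<notin> S" "0 < x" "0 < y" "0 < u" "x = Suc u"
  shows "(1 + qvar) * (psi_set (insert u S) x * psi_set (insert x S) y + psi_set (insert u S) y * psi_set (insert y S) x)
      = psi_set (insert u S) x * psi_set (insert x (insert u S)) y + psi_set (insert u S) y * psi_set (insert y (insert u S)) x
        + qvar * (psi_set S x * psi_set (insert x S) y + psi_set S y * psi_set (insert y S) x)"
proof (cases "x \<in> S")
  case True
  then have "psi_set S x = 0" "psi_set (insert u S) x = 0" "psi_set (insert y S) x = 0"
    "psi_set (insert y (insert u S)) x = 0"
    by (auto simp: psi_set_same)
  then show ?thesis by simp
next
  case x: False
  show ?thesis
  proof (cases "y = u")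
    case True
    have 0: "psi_set S x = 0" "psi_set (insert u S) u = 0" "psi_set (insert x (insert u S)) u = 0"
      using assms by (auto simp: psi_set_same intro: psi_set_missing)
    have "psi_set (insert x S) u * (qvar * qvar ^ x - qvar ^ u) = qvar * (qvar ^ x - qvar ^ u) * psi_set S u"
      using x assms by (intro psi_set_insert) auto
    then have "(1 + qvar) * psi_set (insert x S) u = qvar * psi_set S u"
      using qvar_power_eq_iff[of 1 0] by (intro swap_above_adjacent[of _ _ "qvar ^ u"]) (simp_all add: \<open>x = Suc u\<close>)
    then have "(1 + qvar) * psi_set (insert x S) u * psi_set (insert u S) x = qvar * psi_set S u * psi_set (insert u S) x"
      by simp
    then show ?thesis unfolding True 0 by (simp add: mult_ac)
  next
    case False
    have 0: "psi_set S x = 0" "psi_set (insert y S) x = 0"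
      using assms False by (auto intro: psi_set_missing)
    have "psi_set (insert u (insert x S)) y * (qvar * qvar ^ u - qvar ^ y) =
        qvar * (qvar ^ u - qvar ^ y) * psi_set (insert x S) y"
      using assms by (intro psi_set_insert) auto
    moreover have "psi_set (insert u S) x * psi_set (insert x (insert u S)) y * (qvar * qvar ^ x - qvar ^ y) =
        psi_set (insert u S) y * psi_set (insert y (insert u S)) x * (qvar ^ x - qvar * qvar ^ y)"
      using assms by (intro psi_set_swap) auto
    ultimately have "(1 + qvar) * (psi_set (insert u S) x * psi_set (insert x S) y) =
        psi_set (insert u S) x * psi_set (insert x (insert u S)) y + psi_set (insert u S) y * psi_set (insert y (insert u S)) x"
      using assms False
      by (intro swap_above_special[of _ _ "qvar ^ u" "qvar ^ y"]) (simp_all add: insert_commute[of x u] insert_commute[of "Suc u" u])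
    then show ?thesis using 0 by simp
  qed
qed

lemma psi_set_swap_above:
  assumes "finite S" "x \<noteq> y" "u \<notin> S" "0 < x" "0 < y" "0 < u"
  shows "(1 + qvar) * (psi_set (insert u S) x * psi_set (insert x S) y + psi_set (insert u S) y * psi_set (insert y S) x)
      = psi_set (insert u S) x * psi_set (insert x (insert u S)) y + psi_set (insert u S) y * psi_set (insert y (insert u S)) x
        + qvar * (psi_set S x * psi_set (insert x S) y + psi_set S y * psi_set (insert y S) x)"
proof -
  consider "x = Suc u" | "y = Suc u" | "Suc u \<noteq> x" "Suc u \<noteq> y" by blast
  then show ?thesis
  proof cases
    case 1
    then show ?thesis using psi_set_swap_above_aux[of S x y u] assms by simp
  next
    case 2
    then show ?thesis using psi_set_swap_above_aux[of S y x u] assms by (simp add: add.commute)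
  next
    case 3
    have step: "psi_set (insert u S) a * (qvar * qvar ^ u - qvar ^ a) = qvar * (qvar ^ u - qvar ^ a) * psi_set S a"
      if "Suc u \<noteq> a" for a
      using that assms by (intro psi_set_insert) auto
    have both: "psi_set (insert u S) a * psi_set (insert a (insert u S)) b * (qvar * qvar ^ u - qvar ^ b) =
        qvar * (qvar ^ u - qvar ^ b) * (psi_set (insert u S) a * psi_set (insert a S) b)"
      if "Suc u \<noteq> b" for a b
    proof (cases "a = u")
      case True
      then show ?thesis by (simp add: psi_set_same)
    next
      case False
      have "psi_set (insert u (insert a S)) b * (qvar * qvar ^ u - qvar ^ b) =
          qvar * (qvar ^ u - qvar ^ b) * psi_set (insert a S) b"
        using that False assms by (intro psi_set_insert) auto
      then show ?thesis by (simp add: insert_commute[of a u] mult_ac)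
    qed
    show ?thesis
    proof (rule swap_above_generic)
      show "psi_set (insert u S) x * psi_set (insert x S) y * (qvar * qvar ^ u - qvar ^ x) =
          qvar * (qvar ^ u - qvar ^ x) * (psi_set S x * psi_set (insert x S) y)"
        using arg_cong[OF step[OF 3(1)], of "\<lambda>z. z * psi_set (insert x S) y"] by (simp only: mult_ac)
      show "psi_set (insert u S) y * psi_set (insert y S) x * (qvar * qvar ^ u - qvar ^ y) =
          qvar * (qvar ^ u - qvar ^ y) * (psi_set S y * psi_set (insert y S) x)"
        using arg_cong[OF step[OF 3(2)], of "\<lambda>z. z * psi_set (insert y S) x"] by (simp only: mult_ac)
      show "psi_set S x * psi_set (insert x S) y * (qvar * qvar ^ x - qvar ^ y) =
        psi_set S y * psi_set (insert y S) x * (qvar ^ x - qvar * qvar ^ y)"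
        using assms by (intro psi_set_swap) auto
      show "qvar * qvar ^ u - qvar ^ x \<noteq> 0" "qvar * qvar ^ u - qvar ^ y \<noteq> 0"
        using 3 by (intro qvar_mult_power_neq; simp)+
    qed (use 3 both in auto)
  qed
qed

section \<open>The word sum is the chromatic function\<close>

lemma colour_system_scale:
  assumes "colour_system q E \<phi>"
  shows "colour_system q E (\<lambda>R c. \<phi> R c * h c)"
proof -
  interpret colour_system q E \<phi> by fact
  show ?thesis
  proof
    fix S R :: "nat set" and x y z :: nat
    assume *: "S \<subseteq> E" "R \<subseteq> E" "x \<in> E" "y \<in> E" "z \<in> E" "x \<noteq> y" "x \<notin> R" "y \<notin> R"
    show "(1 + q) * (\<phi> S x * h x * (\<phi> (insert x S) y * h y) * (\<phi> (insert y R) z * h z)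
          + \<phi> S y * h y * (\<phi> (insert y S) x * h x) * (\<phi> (insert x R) z * h z))
        = (\<phi> S x * h x * (\<phi> (insert x S) y * h y) + \<phi> S y * h y * (\<phi> (insert y S) x * h x))
          * (\<phi> (insert x (insert y R)) z * h z + q * (\<phi> R z * h z))"
      using arg_cong[OF swap_below[OF *], of "\<lambda>v. h x * h y * h z * v"] by (simp add: algebra_simps)
  next
    fix S :: "nat set" and x y u :: nat
    assume *: "S \<subseteq> E" "x \<in> E" "y \<in> E" "u \<in> E" "x \<noteq> y" "u \<notin> S"
    show "(1 + q) * (\<phi> (insert u S) x * h x * (\<phi> (insert x S) y * h y)
          + \<phi> (insert u S) y * h y * (\<phi> (insert y S) x * h x))
        = \<phi> (insert u S) x * h x * (\<phi> (insert x (insert u S)) y * h y)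
          + \<phi> (insert u S) y * h y * (\<phi> (insert y (insert u S)) x * h x)
          + q * (\<phi> S x * h x * (\<phi> (insert x S) y * h y) + \<phi> S y * h y * (\<phi> (insert y S) x * h x))"
      using arg_cong[OF swap_above[OF *], of "\<lambda>v. h x * h y * v"] by (simp add: algebra_simps)
  qed (simp_all add: two finite_colours proper)
qed

lemma psi_colour_system:
  assumes "finite E" "0 \<notin> E"
  shows "colour_system qvar E psi_set"
proof
  fix S R :: "nat set" and x y z :: nat
  assume *: "S \<subseteq> E" "R \<subseteq> E" "x \<in> E" "y \<in> E" "z \<in> E" "x \<noteq> y" "x \<notin> R" "y \<notin> R"
  have "finite S" "finite R" using * assms by (auto intro: finite_subset)
  moreover have "0 < x" "0 < y" using * assms by (metis gr0I)+
  ultimately show "(1 + qvar) * (psi_set S x * psi_set (insert x S) y * psi_set (insert y R) z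
      + psi_set S y * psi_set (insert y S) x * psi_set (insert x R) z)
    = (psi_set S x * psi_set (insert x S) y + psi_set S y * psi_set (insert y S) x)
      * (psi_set (insert x (insert y R)) z + qvar * psi_set R z)"
    using * by (intro psi_set_swap_below) auto
next
  fix S :: "nat set" and x y u :: nat
  assume *: "S \<subseteq> E" "x \<in> E" "y \<in> E" "u \<in> E" "x \<noteq> y" "u \<notin> S"
  have "finite S" using * assms by (auto intro: finite_subset)
  moreover have "0 < x" "0 < y" "0 < u" using * assms by (metis gr0I)+
  ultimately show "(1 + qvar) * (psi_set (insert u S) x * psi_set (insert x S) y + psi_set (insert u S) y * psi_set (insert y S) x)
      = psi_set (insert u S) x * psi_set (insert x (insert u S)) y + psi_set (insert u S) y * psi_set (insert y (insert u S)) x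
        + qvar * (psi_set S x * psi_set (insert x S) y + psi_set S y * psi_set (insert y S) x)"
    using * by (intro psi_set_swap_above) auto
qed (use assms two_ratfun psi_set_same in auto)

lemma prod_qint_pos_telescope:
  assumes "a \<le> b" "b \<le> z"
  shows "(\<Prod>s\<in>{a..<b}. qint_pos (z - s) / qint_pos (z - s - 1)) = qint_pos (z - a) / qint_pos (z - b)"
  using assms
proof (induction b rule: dec_induct)
  case (step b)
  then show ?case by (simp add: Suc_diff_Suc)
qed simp

text \<open>
  If the letters so far are \<open>1, \<dots>, k\<close>, the next one is forced. Hence a complete graph admits a
  single word.
\<close>

lemma psi_set_initial:
  assumes "0 < c"
  shows "psi_set {1..k} c = (if c = Suc k then 1 else 0)"
proof (cases "c = Suc k")
  case True
  have sets: "{s \<in> {1..k}. s < Suc k} = {1..<Suc k}" "{s \<in> {1..k}. Suc k < s} = {}" by auto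
  have "(\<Prod>s\<in>{1..<Suc k}. qint_pos (Suc k - s) / qint_pos (Suc k - s - 1)) = qint_pos k"
    using prod_qint_pos_telescope[of 1 "Suc k" "Suc k"] by (simp add: qint_pos_def[of 0])
  then show ?thesis unfolding True psi_set_def sets by auto
next
  case False
  then show ?thesis using assms by (auto simp: psi_set_def)
qed

lemma psi_sum_complete:
  assumes "l \<le> n" "\<forall>t\<in>{l<..n}. r t = l" "n - l \<le> N"
  shows "colour_sum (\<lambda>R c. psi_set R c * h c) {1..N} l n r = (\<Prod>k=1..n - l. h k)"
proof -
  let ?f = "\<lambda>R c. psi_set R c * h c"
  have "colour_sum ?f {1..N} l n r = (\<Prod>k=1..n - l. h k) \<and>
      (\<forall>w\<in>{l<..n} \<rightarrow>\<^sub>E {1..N}. colour_weight ?f r {l<..n} w \<noteq> 0 \<longrightarrow> w ` {l<..n} = {1..n - l})"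
    using assms
  proof (induction n rule: dec_induct)
    case base
    then show ?case by (simp add: colour_sum_def colour_weight_def)
  next
    case (step n)
    then have IH: "colour_sum ?f {1..N} l n r = (\<Prod>k=1..n - l. h k)"
      "\<And>w. w \<in> {l<..n} \<rightarrow>\<^sub>E {1..N} \<Longrightarrow> colour_weight ?f r {l<..n} w \<noteq> 0 \<Longrightarrow> w ` {l<..n} = {1..n - l}"
      by auto
    have r: "r (Suc n) = l" and nl: "Suc n - l = Suc (n - l)" "n - l < N" using step by auto
    have c: "?f (w ` {l<..n}) c = (if c = Suc (n - l) then h (Suc (n - l)) else 0)"
      if "w \<in> {l<..n} \<rightarrow>\<^sub>E {1..N}" "colour_weight ?f r {l<..n} w \<noteq> 0" "c \<in> {1..N}" for w c
      using psi_set_initial[of c "n - l"] that IH(2)[OF that(1,2)] by simp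
    have "colour_sum ?f {1..N} l (Suc n) r =
        (\<Sum>w\<in>{l<..n} \<rightarrow>\<^sub>E {1..N}. \<Sum>c\<in>{1..N}. colour_weight ?f r {l<..n} w * ?f (w ` {l<..n}) c)"
      unfolding colour_sum_def using step by (subst sum_PiE_Suc) (auto simp: colour_weight_Suc r)
    also have "\<dots> = (\<Sum>w\<in>{l<..n} \<rightarrow>\<^sub>E {1..N}. colour_weight ?f r {l<..n} w * h (Suc (n - l)))"
    proof (rule sum.cong)
      fix w assume w: "w \<in> {l<..n} \<rightarrow>\<^sub>E {1..N}"
      show "(\<Sum>c\<in>{1..N}. colour_weight ?f r {l<..n} w * ?f (w ` {l<..n}) c) = colour_weight ?f r {l<..n} w * h (Suc (n - l))"
      proof (cases "colour_weight ?f r {l<..n} w = 0")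
        case False
        have "(\<Sum>c\<in>{1..N}. colour_weight ?f r {l<..n} w * ?f (w ` {l<..n}) c) =
            (\<Sum>c\<in>{1..N}. if c = Suc (n - l) then colour_weight ?f r {l<..n} w * h (Suc (n - l)) else 0)"
          using c[OF w False] by (intro sum.cong) auto
        also have "\<dots> = colour_weight ?f r {l<..n} w * h (Suc (n - l))" using nl by simp
        finally show ?thesis .
      qed simp
    qed simp
    also have "\<dots> = (\<Prod>k=1..n - l. h k) * h (Suc (n - l))"
      unfolding IH(1)[symmetric] colour_sum_def by (rule sum_distrib_right[symmetric])
    finally have "colour_sum ?f {1..N} l (Suc n) r = (\<Prod>k=1..Suc n - l. h k)" by (simp add: nl)
    moreover have "w ` {l<..Suc n} = {1..Suc n - l}"
      if w: "w \<in> {l<..Suc n} \<rightarrow>\<^sub>E {1..N}" "colour_weight ?f r {l<..Suc n} w \<noteq> 0" for w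
    proof -
      let ?v = "restrict w {l<..n}"
      have v: "?v \<in> {l<..n} \<rightarrow>\<^sub>E {1..N}" using w by (auto simp: PiE_def Pi_def)
      have cn: "w (Suc n) \<in> {1..N}" using w step by (auto simp: PiE_def Pi_def)
      have "w = ?v(Suc n := w (Suc n))"
        using w step by (auto simp: fun_eq_iff PiE_def extensional_def)
      then have *: "colour_weight ?f r {l<..Suc n} w = colour_weight ?f r {l<..n} ?v * ?f (?v ` {l<..n}) (w (Suc n))"
        using colour_weight_Suc[of l n ?f r ?v "w (Suc n)"] step r by simp
      then have nz: "colour_weight ?f r {l<..n} ?v \<noteq> 0" "?f (?v ` {l<..n}) (w (Suc n)) \<noteq> 0"
        using w by auto
      have "w (Suc n) = Suc (n - l)" using c[OF v nz(1) cn] nz(2) by (auto split: if_splits)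
      moreover have "w ` {l<..n} = {1..n - l}" using IH(2)[OF v nz(1)] by simp
      moreover have "{l<..Suc n} = insert (Suc n) {l<..n}" using step by auto
      ultimately show ?thesis using nl by auto
    qed
    ultimately show ?case by blast
  qed
  then show ?thesis by simp
qed

lemma modular_law_diff:
  assumes "colour_system q E \<phi>" "colour_system q E \<phi>'"
    and "\<And>r t. reach_fun l n r \<Longrightarrow> Suc l < t \<Longrightarrow> t \<le> n \<Longrightarrow> r t = t - 1 \<Longrightarrow>
      colour_sum \<phi> E l n r = colour_sum \<phi>' E l n r"
  shows "modular_law q l n (\<lambda>r. colour_sum \<phi> E l n r - colour_sum \<phi>' E l n r)"
proof -
  interpret A: colour_system q E \<phi> by fact
  interpret B: colour_system q E \<phi>' by fact
  show ?thesis
  proof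
    fix r t a
    assume *: "reach_fun l n r" "t \<le> n" "r t = a" "l < a" "Suc a < t" "r a = r (Suc a)" "r (t - 1) < a"
      "t < n \<Longrightarrow> a < r (Suc t)"
    show "(1 + q) * (colour_sum \<phi> E l n r - colour_sum \<phi>' E l n r) =
      colour_sum \<phi> E l n (r(t := a - 1)) - colour_sum \<phi>' E l n (r(t := a - 1)) +
      q * (colour_sum \<phi> E l n (r(t := Suc a)) - colour_sum \<phi>' E l n (r(t := Suc a)))"
      using A.vertex_law[OF *] B.vertex_law[OF *] by (simp add: right_diff_distrib del: fun_upd_apply)
  next
    fix r a
    assume *: "reach_fun l n r" "l < a" "Suc a < n" "r (Suc a) = Suc (r a)" "r (Suc a) < a"
      "\<And>t. Suc a < t \<Longrightarrow> t \<le> n \<Longrightarrow> r t \<noteq> a"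
    show "(1 + q) * (colour_sum \<phi> E l n r - colour_sum \<phi>' E l n r) =
      colour_sum \<phi> E l n (r(Suc a := r a)) - colour_sum \<phi>' E l n (r(Suc a := r a)) +
      q * (colour_sum \<phi> E l n (r(a := r (Suc a))) - colour_sum \<phi>' E l n (r(a := r (Suc a))))"
      using A.pair_law[OF *(1,2) less_imp_le[OF *(3)] *(4,5,6)]
        B.pair_law[OF *(1,2) less_imp_le[OF *(3)] *(4,5,6)]
      by (simp add: right_diff_distrib del: fun_upd_apply)
  qed (use assms(3) in auto)
qed

text \<open>
  Induction on the number of vertices: the difference of the two sums obeys the modular law; it
  vanishes on disconnected graphs by multiplicativity and the induction hypothesis, and on complete
  graphs by the explicit values, where the ratios \<open>e\<^sub>c / e\<^sub>c\<^sub>-\<^sub>1\<close> telescope to \<open>e\<^sub>n\<^sub>-\<^sub>l\<close>.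
\<close>

theorem psi_sum_eq_chrom_sum:
  fixes x :: "nat \<Rightarrow> ratfun" and N :: nat
  defines "e \<equiv> elem_sym x {1..N}"
  assumes "\<And>c. c \<le> N \<Longrightarrow> e c \<noteq> 0" "l \<le> n" "n - l \<le> N" "reach_fun l n r"
  shows "colour_sum (\<lambda>R c. psi_set R c * (qint c * (e c / e (c - 1)))) {1..N} l n r =
    colour_sum (chrom_step qvar x) {1..N} l n r"
  using assms(3-5)
proof (induction "n - l" arbitrary: l n r rule: less_induct)
  case less
  let ?f = "\<lambda>R c. psi_set R c * (qint c * (e c / e (c - 1)))" and ?g = "chrom_step qvar x"
  show ?case
  proof (cases "l = n")
    case True
    then show ?thesis by (simp add: colour_sum_def colour_weight_def)
  next
    case False
    then have "l < n" using less by simp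
    have "colour_sum ?f {1..N} l n r - colour_sum ?g {1..N} l n r = 0"
    proof (rule modular_law_unique[OF modular_law_diff \<open>l < n\<close>])
      show "colour_system qvar {1..N} ?f"
        by (intro colour_system_scale psi_colour_system) auto
      show "colour_system qvar {1..N} ?g"
        by (intro chrom_colour_system two_ratfun) auto
    next
      fix r t
      assume r: "reach_fun l n r" "Suc l < t" "t \<le> n" "r t = t - 1"
      have eq: "colour_sum \<phi> {1..N} l n r = colour_sum \<phi> {1..N} l (t - 1) r * colour_sum \<phi> {1..N} (t - 1) n r"
        for \<phi> :: "nat set \<Rightarrow> nat \<Rightarrow> ratfun"
        using r reach_funD(1)[OF r(1)] reach_funD(3)[OF r(1), of t] by (intro colour_sum_disconnected) auto
      have "reach_fun l (t - 1) r" "reach_fun (t - 1) n r"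
        using r reach_funD[OF r(1)] reach_funD(3)[OF r(1), of t]
        by (auto simp: reach_fun_def mono_on_def)
      then have "colour_sum ?f {1..N} l (t - 1) r = colour_sum ?g {1..N} l (t - 1) r"
        "colour_sum ?f {1..N} (t - 1) n r = colour_sum ?g {1..N} (t - 1) n r"
        using r less by (auto intro!: less.hyps)
      then show "colour_sum ?f {1..N} l n r = colour_sum ?g {1..N} l n r" by (simp only: eq)
    next
      fix r assume r: "\<forall>t\<in>{l<..n}. r t = l"
      have "(\<Prod>k=1..m. e k / e (k - 1)) = e m" if "m \<le> N" for m
        using that
      proof (induction m)
        case 0
        show ?case by (simp add: e_def elem_sym_0)
      next
        case (Suc m)
        then show ?case using assms(2)[of m] by simp
      qed
      then have "(\<Prod>k=1..n - l. qint k * (e k / e (k - 1))) = (\<Prod>k=1..n - l. qint k) * e (n - l)"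
        using less by (subst prod.distrib) simp
      then have "colour_sum ?f {1..N} l n r = (\<Prod>k=1..n - l. qint k) * e (n - l)"
        using less r by (subst psi_sum_complete) auto
      moreover have "colour_sum ?g {1..N} l n r = (\<Prod>k=1..n - l. qint k) * e (n - l)"
        using less r by (subst chrom_sum_complete) (auto simp: e_def qint_def)
      ultimately show "colour_sum ?f {1..N} l n r - colour_sum ?g {1..N} l n r = 0" by simp
    next
      fix k
      have "(\<Sum>i\<le>k. qvar ^ i) = qint (Suc k)" by (simp add: qint_def lessThan_Suc_atMost)
      then show "(\<Sum>i\<le>k. qvar ^ i) \<noteq> 0" by simp
    qed (use less in auto)
    then show ?thesis by simp
  qed
qed

section \<open>Polynomial coefficients, lowest terms and letter counts\<close>

definition polynomials :: "ratfun set" where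
  "polynomials = range to_fract"

lemma polynomials_0 [simp]: "0 \<in> polynomials" and polynomials_1 [simp]: "1 \<in> polynomials"
  and polynomials_add: "a \<in> polynomials \<Longrightarrow> b \<in> polynomials \<Longrightarrow> a + b \<in> polynomials"
  and polynomials_diff: "a \<in> polynomials \<Longrightarrow> b \<in> polynomials \<Longrightarrow> a - b \<in> polynomials"
  and polynomials_mult: "a \<in> polynomials \<Longrightarrow> b \<in> polynomials \<Longrightarrow> a * b \<in> polynomials"
proof -
  show "0 \<in> polynomials" "1 \<in> polynomials"
    unfolding polynomials_def by (metis rangeI to_fract_0, metis rangeI to_fract_1)
  show "a + b \<in> polynomials" if "a \<in> polynomials" "b \<in> polynomials"
    using that unfolding polynomials_def by (metis (no_types, lifting) imageE rangeI to_fract_add)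
  show "a - b \<in> polynomials" if "a \<in> polynomials" "b \<in> polynomials"
    using that unfolding polynomials_def by (metis (no_types, lifting) imageE rangeI to_fract_diff)
  show "a * b \<in> polynomials" if "a \<in> polynomials" "b \<in> polynomials"
    using that unfolding polynomials_def by (metis (no_types, lifting) imageE rangeI to_fract_mult)
qed

lemma polynomials_sum: "(\<And>i. i \<in> I \<Longrightarrow> f i \<in> polynomials) \<Longrightarrow> sum f I \<in> polynomials"
  by (induction I rule: infinite_finite_induct) (auto intro: polynomials_add)

lemma polynomials_qvar_power: "qvar ^ k \<in> polynomials"
  by (auto simp: polynomials_def qvar_power)

lemma polynomials_qint: "qint k \<in> polynomials"
  unfolding qint_def by (intro polynomials_sum polynomials_qvar_power)

definition poly_coeffs :: "ratfun poly set" where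
  "poly_coeffs = {p. \<forall>i. coeff p i \<in> polynomials}"

lemma poly_coeffs_mult: "p \<in> poly_coeffs \<Longrightarrow> p' \<in> poly_coeffs \<Longrightarrow> p * p' \<in> poly_coeffs"
  by (auto simp: poly_coeffs_def coeff_mult intro!: polynomials_sum polynomials_mult)

lemma poly_coeffs_1: "1 \<in> poly_coeffs" by (auto simp: poly_coeffs_def)

lemma poly_coeffs_sum: "(\<And>i. i \<in> I \<Longrightarrow> f i \<in> poly_coeffs) \<Longrightarrow> sum f I \<in> poly_coeffs"
  by (auto simp: poly_coeffs_def coeff_sum intro!: polynomials_sum)

lemma poly_coeffs_prod: "(\<And>i. i \<in> I \<Longrightarrow> f i \<in> poly_coeffs) \<Longrightarrow> prod f I \<in> poly_coeffs"
  by (induction I rule: infinite_finite_induct) (auto intro: poly_coeffs_mult poly_coeffs_1)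

lemma poly_coeffs_power: "p \<in> poly_coeffs \<Longrightarrow> p ^ k \<in> poly_coeffs"
  by (induction k) (auto intro: poly_coeffs_mult poly_coeffs_1)

lemma poly_coeffs_monom: "a \<in> polynomials \<Longrightarrow> monom a k \<in> poly_coeffs"
  by (auto simp: poly_coeffs_def)

definition lowest_monic :: "'a::comm_ring_1 poly \<Rightarrow> nat \<Rightarrow> bool" where
  "lowest_monic p d \<longleftrightarrow> coeff p d = 1 \<and> (\<forall>i<d. coeff p i = 0)"

lemma lowest_monic_mult:
  assumes "lowest_monic p d" "lowest_monic p' d'"
  shows "lowest_monic (p * p') (d + d')"
proof -
  have "coeff p i * coeff p' (j - i) = 0" if "i \<le> j" "j \<le> d + d'" "j < d + d' \<or> i \<noteq> d" for i j
  proof -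
    have "i < d \<or> j - i < d'" using that by linarith
    then show ?thesis using assms by (auto simp: lowest_monic_def)
  qed
  moreover from this have "coeff (p * p') (d + d') = (\<Sum>i\<in>{d}. coeff p i * coeff p' (d + d' - i))"
    unfolding coeff_mult by (intro sum.mono_neutral_right) auto
  ultimately show ?thesis using assms by (auto simp: lowest_monic_def coeff_mult)
qed

lemma lowest_monic_1: "lowest_monic 1 0" by (simp add: lowest_monic_def)

lemma lowest_monic_power: "lowest_monic p d \<Longrightarrow> lowest_monic (p ^ k) (k * d)"
  by (induction k) (auto intro: lowest_monic_mult lowest_monic_1)

lemma lowest_monic_prod:
  "(\<And>i. i \<in> I \<Longrightarrow> lowest_monic (f i) (d i)) \<Longrightarrow> finite I \<Longrightarrow> lowest_monic (prod f I) (sum d I)"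
  by (induction I rule: infinite_finite_induct) (auto intro: lowest_monic_mult lowest_monic_1)

text \<open>
  The largest element of \<open>S\<close> is at least \<open>c\<close>; remove it and continue.
\<close>

lemma sum_initial_least:
  fixes g :: "nat \<Rightarrow> nat"
  assumes "strict_mono g" "finite S" "0 \<notin> S" "card S = c"
  shows "sum g {1..c} \<le> sum g S \<and> (S \<noteq> {1..c} \<longrightarrow> sum g {1..c} < sum g S)"
  using assms(2-4)
proof (induction c arbitrary: S)
  case (Suc c)
  let ?m = "Max S"
  have "S \<noteq> {}" using Suc.prems(3) by (metis card.empty nat.distinct(1))
  then have m: "?m \<in> S" using Suc.prems(1) by (intro Max_in)
  have "S \<subseteq> {1..?m}"
  proof
    fix x assume "x \<in> S"
    then show "x \<in> {1..?m}" using Suc.prems(1,2) Max_ge[of S x] by (cases x) auto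
  qed
  then have "card S \<le> card {1..?m}" by (intro card_mono) auto
  then have cm: "Suc c \<le> ?m" using Suc.prems(3) by simp
  have IH: "sum g {1..c} \<le> sum g (S - {?m}) \<and> (S - {?m} \<noteq> {1..c} \<longrightarrow> sum g {1..c} < sum g (S - {?m}))"
    using Suc.prems m by (intro Suc.IH) (simp_all del: Max_less_iff)
  have S: "sum g S = g ?m + sum g (S - {?m})" using Suc.prems(1) m by (rule sum.remove)
  have "g (Suc c) \<le> g ?m" using cm assms(1) by (simp add: strict_mono_less_eq)
  moreover have "g (Suc c) < g ?m" if "Suc c \<noteq> ?m" using cm that assms(1) by (simp add: strict_mono_less)
  moreover have "S = {1..Suc c}" if "S - {?m} = {1..c}" "Suc c = ?m"
  proof -
    have "S = insert (Suc c) {1..c}" using m that by (metis insert_Diff)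
    then show ?thesis by auto
  qed
  moreover have "sum g {1..Suc c} = sum g {1..c} + g (Suc c)" by simp
  ultimately show ?case using IH S by (cases "S - {?m} = {1..c}"; cases "Suc c = ?m") linarith+
qed simp

lemma digits_unique:
  fixes B :: nat
  assumes "\<And>i. i \<in> {1..N} \<Longrightarrow> h i < B" "\<And>i. i \<in> {1..N} \<Longrightarrow> h' i < B"
    and "(\<Sum>i=1..N. h i * B ^ i) = (\<Sum>i=1..N. h' i * B ^ i)" "i \<in> {1..N}"
  shows "h i = h' i"
  using assms
proof (induction N)
  case (Suc N)
  have bound: "(\<Sum>i=1..M. g i * B ^ i) < B ^ Suc M" if "\<And>i. i \<in> {1..M} \<Longrightarrow> g i < B" "0 < B" for g M
    using that(1)
  proof (induction M)
    case 0
    then show ?case using that(2) by simp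
  next
    case (Suc M)
    then have "(\<Sum>i=1..M. g i * B ^ i) < B ^ Suc M" "g (Suc M) + 1 \<le> B" by (auto simp: Suc_le_eq)
    then have "(\<Sum>i=1..Suc M. g i * B ^ i) < (g (Suc M) + 1) * B ^ Suc M" by simp
    also have "\<dots> \<le> B * B ^ Suc M" using \<open>g (Suc M) + 1 \<le> B\<close> by (rule mult_le_mono1)
    finally show ?case by simp
  qed
  have div_eq: "(a + x * P) div P = x" if "a < P" for a x P :: nat
    using that by simp
  have "0 < B" using Suc.prems(1)[of "Suc N"] by simp
  then have "(\<Sum>i=1..N. h i * B ^ i) < B ^ Suc N" "(\<Sum>i=1..N. h' i * B ^ i) < B ^ Suc N"
    using Suc.prems(1,2) by (intro bound; simp)+
  moreover have "(\<Sum>i=1..N. h i * B ^ i) + h (Suc N) * B ^ Suc N = (\<Sum>i=1..N. h' i * B ^ i) + h' (Suc N) * B ^ Suc N"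
    using Suc.prems(3) by simp
  ultimately have "h (Suc N) = h' (Suc N)" "(\<Sum>i=1..N. h i * B ^ i) = (\<Sum>i=1..N. h' i * B ^ i)"
  proof -
    assume a: "(\<Sum>i=1..N. h i * B ^ i) < B ^ Suc N" "(\<Sum>i=1..N. h' i * B ^ i) < B ^ Suc N"
      and eq: "(\<Sum>i=1..N. h i * B ^ i) + h (Suc N) * B ^ Suc N = (\<Sum>i=1..N. h' i * B ^ i) + h' (Suc N) * B ^ Suc N"
    show "h (Suc N) = h' (Suc N)"
      using arg_cong[OF eq, of "\<lambda>x. x div B ^ Suc N"] div_eq[OF a(1)] div_eq[OF a(2)] by (simp only:)
    then show "(\<Sum>i=1..N. h i * B ^ i) = (\<Sum>i=1..N. h' i * B ^ i)" using eq by simp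
  qed
  then show ?case using Suc by (cases "i = Suc N") (auto simp: le_Suc_eq)
qed simp

definition letter_count :: "(nat \<Rightarrow> nat) \<Rightarrow> nat \<Rightarrow> nat \<Rightarrow> nat" where
  "letter_count w n c = card {t \<in> {0<..n}. w t = c}"

lemma letter_count_0 [simp]: "letter_count w 0 c = 0"
  by (simp add: letter_count_def)

lemma letter_count_Suc: "letter_count w (Suc n) c = letter_count w n c + (if w (Suc n) = c then 1 else 0)"
proof -
  have "{t \<in> {0<..Suc n}. w t = c} = {t \<in> {0<..n}. w t = c} \<union> (if w (Suc n) = c then {Suc n} else {})"
    by (auto simp: le_Suc_eq)
  then show ?thesis by (simp add: letter_count_def card_Un_disjoint)
qed

lemma letter_count_cong: "(\<And>t. 0 < t \<Longrightarrow> t \<le> n \<Longrightarrow> w t = w' t) \<Longrightarrow> letter_count w n c = letter_count w' n c"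
  unfolding letter_count_def by (rule arg_cong[of _ _ card]) auto

lemma letter_count_le: "letter_count w n c \<le> n"
proof -
  have "card {t \<in> {0<..n}. w t = c} \<le> card {0<..n}" by (intro card_mono) auto
  then show ?thesis by (simp add: letter_count_def)
qed

lemma letter_count_mono:
  assumes "m \<le> n"
  shows "letter_count w m c \<le> letter_count w n c"
    and "c \<in> w ` {m<..n} \<Longrightarrow> letter_count w m c < letter_count w n c"
    and "c \<notin> w ` {m<..n} \<Longrightarrow> letter_count w m c = letter_count w n c"
proof -
  show "letter_count w m c \<le> letter_count w n c"
    unfolding letter_count_def using assms by (intro card_mono) auto
  show "letter_count w m c < letter_count w n c" if "c \<in> w ` {m<..n}"
  proof -
    from that obtain t where "m < t" "t \<le> n" "w t = c" by auto
    then have "t \<in> {t \<in> {0<..n}. w t = c} - {t \<in> {0<..m}. w t = c}" by simp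
    moreover have "{t \<in> {0<..m}. w t = c} \<subseteq> {t \<in> {0<..n}. w t = c}" using assms by auto
    ultimately have "{t \<in> {0<..m}. w t = c} \<subset> {t \<in> {0<..n}. w t = c}" by blast
    then show ?thesis unfolding letter_count_def by (intro psubset_card_mono) simp
  qed
  show "letter_count w m c = letter_count w n c" if "c \<notin> w ` {m<..n}"
  proof -
    have "t \<le> m" if "t \<le> n" "w t = c" for t
    proof (rule ccontr)
      assume "\<not> t \<le> m"
      then have "t \<in> {m<..n}" using that(1) by simp
      then have "w t \<in> w ` {m<..n}" by (rule imageI)
      then show False using \<open>c \<notin> w ` {m<..n}\<close> \<open>w t = c\<close> by simp
    qed
    then have "{t \<in> {0<..m}. w t = c} = {t \<in> {0<..n}. w t = c}" using assms by auto
    then show ?thesis by (simp add: letter_count_def)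
  qed
qed

text \<open>
  A letter \<open>c + 1\<close> is only placed when \<open>c\<close> but not \<open>c + 1\<close> occurs among the neighbours, that is,
  between \<open>r m\<close> and \<open>m\<close>. So the inequality at \<open>r m\<close> has become strict before the letter is added.
\<close>

lemma psi_word_lattice:
  assumes "reach_fun 0 n r" "colour_weight (\<lambda>R c. psi_set R c * h c) r {0<..n} w \<noteq> 0"
    and "m \<le> n" "0 < c"
  shows "letter_count w m (Suc c) \<le> letter_count w m c"
  using assms(3)
proof (induction m rule: less_induct)
  case (less m)
  show ?case
  proof (cases m)
    case (Suc k)
    have "m \<in> {0<..n}" using less Suc by simp
    then have nz: "psi_set (w ` {r m<..<m}) (w m) \<noteq> 0"
      using assms(2) unfolding colour_weight_def by (auto simp: prod_zero_iff)
    have IH: "letter_count w j (Suc c) \<le> letter_count w j c" if "j < m" for j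
      using less that by auto
    show ?thesis
    proof (cases "w m = Suc c")
      case True
      then have mem: "Suc c \<notin> w ` {r m<..<m}" "c \<in> w ` {r m<..<m}"
        using nz \<open>0 < c\<close> by (auto simp: psi_set_def split: if_splits)
      have int: "{r m<..<m} = {r m<..k}" using Suc by auto
      have rm: "r m \<le> k" "r m < m" using reach_funD(2)[OF assms(1), of m] less Suc by auto
      have "letter_count w k (Suc c) = letter_count w (r m) (Suc c)"
        using letter_count_mono(3)[of "r m" k "Suc c" w] mem rm int by simp
      also have "\<dots> \<le> letter_count w (r m) c" using rm by (intro IH)
      also have "\<dots> < letter_count w k c"
        using letter_count_mono(2)[of "r m" k c w] mem rm int by simp
      finally show ?thesis using True Suc by (simp add: letter_count_Suc)
    next
      case False
      then show ?thesis using IH[of k] Suc by (simp add: letter_count_Suc)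
    qed
  qed simp
qed

section \<open>Words of given content\<close>

lemma of_nat_ratfun: "(of_nat m :: ratfun) = to_fract (of_nat m)"
  by (induction m) simp_all

lemma of_nat_ratfun_eq_iff: "(of_nat m :: ratfun) = of_nat k \<longleftrightarrow> m = k"
  by (simp add: of_nat_ratfun)

text \<open>
  Positive integers are good evaluation points because elementary symmetric functions do not vanish
  at them.
\<close>

lemma poly_eq_if_eq_at_nats:
  fixes p p' :: "ratfun poly"
  assumes "\<And>j. poly p (of_nat (Suc j)) = poly p' (of_nat (Suc j))"
  shows "p = p'"
proof (rule ccontr)
  assume "p \<noteq> p'"
  then have "finite {z. poly (p - p') z = 0}" by (intro poly_roots_finite) simp
  moreover have "range (\<lambda>j. of_nat (Suc j)) \<subseteq> {z. poly (p - p') z = 0}" using assms by auto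
  ultimately have "finite (range (\<lambda>j. of_nat (Suc j) :: ratfun))" by (rule finite_subset[rotated])
  moreover have "inj (\<lambda>j. of_nat (Suc j) :: ratfun)" by (intro injI) (simp only: of_nat_ratfun_eq_iff)
  ultimately show False using finite_imageD by blast
qed

definition psi_weight :: "(nat \<Rightarrow> nat) \<Rightarrow> nat \<Rightarrow> (nat \<Rightarrow> nat) \<Rightarrow> ratfun" where
  "psi_weight r n w = colour_weight (\<lambda>R c. psi_set R c * qint c) r {0<..n} w"

text \<open>
  Letter counts smaller than \<open>B\<close> are the digits of this number to the base \<open>B\<close>, so it determines
  them.
\<close>

definition content_exponent :: "nat \<Rightarrow> nat \<Rightarrow> (nat \<Rightarrow> nat) \<Rightarrow> nat" where
  "content_exponent B N h = (\<Sum>c=1..N. h c * B ^ c)"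

definition elem_poly :: "nat \<Rightarrow> nat \<Rightarrow> nat \<Rightarrow> ratfun poly" where
  "elem_poly B N c = elem_sym (\<lambda>i. monom 1 (B ^ i)) {1..N} c"

text \<open>
  If \<open>h\<close> lists the column lengths of a partition, then \<open>h c - h (c + 1)\<close> is the number of its rows
  of length \<open>c\<close>; the product is the elementary symmetric function of that partition at
  \<open>x\<^sub>i = z^(B^i)\<close>.
\<close>

definition content_poly :: "nat \<Rightarrow> nat \<Rightarrow> (nat \<Rightarrow> nat) \<Rightarrow> ratfun poly" where
  "content_poly B N h = (\<Prod>c=1..N. elem_poly B N c ^ (h c - h (Suc c)))"

lemma prod_monom_one: "(\<Prod>s\<in>S. monom (1::'a::comm_ring_1) (f s)) = monom 1 (\<Sum>s\<in>S. f s)"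
  by (induction S rule: infinite_finite_induct) (simp_all add: mult_monom)

lemma elem_poly_eq: "elem_poly B N c = (\<Sum>S | S \<subseteq> {1..N} \<and> card S = c. monom 1 (\<Sum>i\<in>S. B ^ i))"
  by (simp add: elem_poly_def elem_sym_def prod_monom_one)

lemma elem_poly_coeffs: "elem_poly B N c \<in> poly_coeffs"
  unfolding elem_poly_eq by (intro poly_coeffs_sum poly_coeffs_monom) simp

lemma content_poly_coeffs: "content_poly B N h \<in> poly_coeffs"
  unfolding content_poly_def by (intro poly_coeffs_prod poly_coeffs_power elem_poly_coeffs)

text \<open>
  The lowest term comes from the variables \<open>x\<^sub>1, \<dots>, x\<^sub>c\<close>.
\<close>

lemma elem_poly_lowest:
  assumes "2 \<le> B" "c \<le> N"
  shows "lowest_monic (elem_poly B N c) (\<Sum>i=1..c. B ^ i)"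
proof -
  let ?T = "{S. S \<subseteq> {1..N} \<and> card S = c}"
  have least: "(\<Sum>i=1..c. B ^ i) \<le> (\<Sum>i\<in>S. B ^ i) \<and> (S \<noteq> {1..c} \<longrightarrow> (\<Sum>i=1..c. B ^ i) < (\<Sum>i\<in>S. B ^ i))"
    if "S \<in> ?T" for S
    using that assms by (intro sum_initial_least) (auto simp: strict_mono_def intro: finite_subset)
  have fin: "finite ?T" by simp
  have coeff: "coeff (elem_poly B N c) j = (\<Sum>S\<in>?T. if (\<Sum>i\<in>S. B ^ i) = j then 1 else 0)" for j
    by (simp add: elem_poly_eq coeff_sum)
  have mem: "{1..c} \<in> ?T" using assms by auto
  have "coeff (elem_poly B N c) (\<Sum>i=1..c. B ^ i) = (\<Sum>S\<in>?T. if S = {1..c} then 1 else 0)"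
    unfolding coeff
  proof (rule sum.cong)
    fix S assume "S \<in> ?T"
    then show "(if (\<Sum>i\<in>S. B ^ i) = (\<Sum>i=1..c. B ^ i) then 1 else 0) = (if S = {1..c} then 1 else (0::ratfun))"
      using least[of S] by auto
  qed simp
  also have "\<dots> = 1" using fin mem by (subst sum.delta) auto
  finally have "coeff (elem_poly B N c) (\<Sum>i=1..c. B ^ i) = 1" .
  moreover have "coeff (elem_poly B N c) j = 0" if j: "j < (\<Sum>i=1..c. B ^ i)" for j
    unfolding coeff
  proof (rule sum.neutral, rule ballI)
    fix S assume "S \<in> ?T"
    then show "(if (\<Sum>i\<in>S. B ^ i) = j then 1 else 0) = (0::ratfun)" using least[of S] j by auto
  qed
  ultimately show ?thesis by (simp add: lowest_monic_def)
qed

text \<open>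
  Counting the cells of a partition by rows or by columns, a cell in column \<open>i\<close> having weight
  \<open>B\<^sup>i\<close>. The extra term makes the induction on the number of columns work.
\<close>

lemma content_exponent_rows:
  assumes "\<And>c. 0 < c \<Longrightarrow> h (Suc c) \<le> h c"
  shows "(\<Sum>c=1..N. (h c - h (Suc c)) * (\<Sum>i=1..c. B ^ i)) + h (Suc N) * (\<Sum>i=1..N. B ^ i) = content_exponent B N h"
  unfolding content_exponent_def
proof (induction N)
  case (Suc N)
  have "(h (Suc N) - h (Suc (Suc N))) * (\<Sum>i=1..Suc N. B ^ i) + h (Suc (Suc N)) * (\<Sum>i=1..Suc N. B ^ i)
      = h (Suc N) * (\<Sum>i=1..Suc N. B ^ i)"
    using assms[of "Suc N"] by (simp flip: add_mult_distrib)
  also have "\<dots> = h (Suc N) * (\<Sum>i=1..N. B ^ i) + h (Suc N) * B ^ Suc N" by (simp add: add_mult_distrib2)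
  finally show ?case using Suc by simp
qed simp

lemma content_poly_lowest:
  assumes "2 \<le> B" "\<And>c. 0 < c \<Longrightarrow> h (Suc c) \<le> h c" "h (Suc N) = 0"
  shows "lowest_monic (content_poly B N h) (content_exponent B N h)"
proof -
  have "lowest_monic (content_poly B N h) (\<Sum>c=1..N. (h c - h (Suc c)) * (\<Sum>i=1..c. B ^ i))"
    unfolding content_poly_def
    using assms by (intro lowest_monic_prod lowest_monic_power elem_poly_lowest) auto
  then show ?thesis using content_exponent_rows[of h B N] assms by simp
qed

text \<open>
  A row of length \<open>c\<close> collects \<open>e\<^sub>1 / e\<^sub>0, \<dots>, e\<^sub>c / e\<^sub>c\<^sub>-\<^sub>1\<close>, hence \<open>e\<^sub>c\<close>. The last factor accounts
  for columns beyond \<open>N\<close>.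
\<close>

lemma prod_ratio_powers:
  fixes e :: "nat \<Rightarrow> 'a::field"
  assumes "\<And>c. c \<le> N \<Longrightarrow> e c \<noteq> 0" "e 0 = 1" "\<And>c. 0 < c \<Longrightarrow> h (Suc c) \<le> h c"
  shows "(\<Prod>c=1..N. (e c / e (c - 1)) ^ h c) = (\<Prod>c=1..N. e c ^ (h c - h (Suc c))) * e N ^ h (Suc N)"
  using assms(1)
proof (induction N)
  case 0
  then show ?case using assms(2) by simp
next
  case (Suc N)
  have "e (Suc N) ^ h (Suc N) = e (Suc N) ^ (h (Suc N) - h (Suc (Suc N))) * e (Suc N) ^ h (Suc (Suc N))"
    using assms(3)[of "Suc N"] by (simp flip: power_add)
  moreover have "e N \<noteq> 0" using Suc.prems by simp
  ultimately show ?case using Suc by (simp add: power_divide)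
qed

lemma PiE_not_in_image: "w \<in> P \<rightarrow>\<^sub>E E \<Longrightarrow> c \<notin> E \<Longrightarrow> c \<notin> w ` P"
  by (auto dest: PiE_mem)

lemma psi_weight_decompose:
  assumes "w \<in> {0<..n} \<rightarrow>\<^sub>E {1..N}"
  shows "colour_weight (\<lambda>R c. psi_set R c * (qint c * g c)) r {0<..n} w =
    psi_weight r n w * (\<Prod>c=1..N. g c ^ letter_count w n c)"
proof -
  have "(\<Prod>t\<in>{0<..n}. g (w t)) = (\<Prod>c\<in>{1..N}. \<Prod>t\<in>{t \<in> {0<..n}. w t = c}. g (w t))"
    using assms by (intro prod.group[symmetric]) auto
  also have "\<dots> = (\<Prod>c=1..N. g c ^ letter_count w n c)"
    by (intro prod.cong) (simp_all add: letter_count_def)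
  finally show ?thesis
    by (simp add: psi_weight_def colour_weight_def mult.assoc[symmetric] prod.distrib)
qed

text \<open>
  The chromatic function at \<open>x\<^sub>i = z^(B^i)\<close>, as a polynomial in \<open>z\<close>.
\<close>

definition chrom_poly :: "nat \<Rightarrow> nat \<Rightarrow> nat \<Rightarrow> (nat \<Rightarrow> nat) \<Rightarrow> ratfun poly" where
  "chrom_poly B N n r =
     colour_sum (\<lambda>R c. if c \<in> R then 0 else monom (qvar ^ card {s \<in> R. s < c}) (B ^ c)) {1..N} 0 n r"

lemma chrom_poly_coeffs: "chrom_poly B N n r \<in> poly_coeffs"
proof -
  have "0 \<in> poly_coeffs" by (simp add: poly_coeffs_def)
  then show ?thesis
    unfolding chrom_poly_def colour_sum_def colour_weight_def
    by (intro poly_coeffs_sum poly_coeffs_prod) (auto intro: poly_coeffs_monom polynomials_qvar_power)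
qed

lemma poly_chrom_poly: "poly (chrom_poly B N n r) z = colour_sum (chrom_step qvar (\<lambda>c. z ^ (B ^ c))) {1..N} 0 n r"
  unfolding chrom_poly_def colour_sum_def colour_weight_def poly_sum poly_prod
  by (intro sum.cong prod.cong) (auto simp: chrom_step_def poly_monom)

lemma poly_elem_poly: "poly (elem_poly B N c) z = elem_sym (\<lambda>i. z ^ (B ^ i)) {1..N} c"
  by (simp add: elem_poly_def elem_sym_def poly_sum poly_prod poly_monom)

lemma elem_sym_of_nat_nonzero:
  assumes "c \<le> N"
  shows "elem_sym (\<lambda>i. (of_nat (Suc j) :: ratfun) ^ (B ^ i)) {1..N} c \<noteq> 0"
proof -
  have "elem_sym (\<lambda>i. (of_nat (Suc j) :: ratfun) ^ (B ^ i)) {1..N} c =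
      of_nat (\<Sum>S | S \<subseteq> {1..N} \<and> card S = c. \<Prod>s\<in>S. Suc j ^ (B ^ s))"
    unfolding elem_sym_def of_nat_sum of_nat_prod of_nat_power ..
  moreover have "(\<Sum>S | S \<subseteq> {1..N} \<and> card S = c. \<Prod>s\<in>S. Suc j ^ (B ^ s)) \<noteq> 0"
  proof -
    have "{1..c} \<in> {S. S \<subseteq> {1..N} \<and> card S = c}" using assms by auto
    then show ?thesis by (subst sum_eq_0_iff) (auto intro!: exI[of _ "{1..c}"])
  qed
  ultimately show ?thesis by (metis of_nat_0 of_nat_ratfun_eq_iff)
qed

lemma psi_expansion:
  assumes "reach_fun 0 n r" "n \<le> N"
  shows "(\<Sum>w\<in>{0<..n} \<rightarrow>\<^sub>E {1..N}. smult (psi_weight r n w) (content_poly B N (letter_count w n))) = chrom_poly B N n r"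
proof (rule poly_eq_if_eq_at_nats)
  fix j
  let ?z = "of_nat (Suc j) :: ratfun"
  let ?x = "\<lambda>i. ?z ^ (B ^ i)"
  let ?e = "elem_sym ?x {1..N}"
  have e: "?e c \<noteq> 0" if "c \<le> N" for c using that by (rule elem_sym_of_nat_nonzero)
  have "poly (chrom_poly B N n r) ?z = colour_sum (\<lambda>R c. psi_set R c * (qint c * (?e c / ?e (c - 1)))) {1..N} 0 n r"
    unfolding poly_chrom_poly using assms e by (intro psi_sum_eq_chrom_sum[symmetric]) auto
  also have "\<dots> = (\<Sum>w\<in>{0<..n} \<rightarrow>\<^sub>E {1..N}. psi_weight r n w * poly (content_poly B N (letter_count w n)) ?z)"
    unfolding colour_sum_def
  proof (rule sum.cong)
    fix w assume w: "w \<in> {0<..n} \<rightarrow>\<^sub>E {1..N}"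
    show "colour_weight (\<lambda>R c. psi_set R c * (qint c * (?e c / ?e (c - 1)))) r {0<..n} w =
        psi_weight r n w * poly (content_poly B N (letter_count w n)) ?z"
    proof (cases "psi_weight r n w = 0")
      case False
      then have dec: "letter_count w n (Suc c) \<le> letter_count w n c" if "0 < c" for c
        unfolding psi_weight_def using psi_word_lattice[OF assms(1) _ le_refl that] by blast
      have "Suc N \<notin> w ` {0<..n}" using w by (rule PiE_not_in_image) simp
      then have "letter_count w n (Suc N) = 0" using letter_count_mono(3)[of 0 n "Suc N" w] by simp
      moreover have "(\<Prod>c=1..N. (?e c / ?e (c - 1)) ^ letter_count w n c) =
          (\<Prod>c=1..N. ?e c ^ (letter_count w n c - letter_count w n (Suc c))) * ?e N ^ letter_count w n (Suc N)"
        using e elem_sym_0[of "{1..N}" ?x] dec by (intro prod_ratio_powers) auto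
      ultimately show ?thesis
        unfolding psi_weight_decompose[OF w] content_poly_def poly_prod poly_power poly_elem_poly by simp
    next
      case True
      then show ?thesis unfolding psi_weight_decompose[OF w] by (simp only: mult_zero_left)
    qed
  qed simp
  finally show "poly (\<Sum>w\<in>{0<..n} \<rightarrow>\<^sub>E {1..N}. smult (psi_weight r n w) (content_poly B N (letter_count w n))) ?z =
      poly (chrom_poly B N n r) ?z"
    by (simp add: poly_sum)
qed

text \<open>
  The coefficients are extracted from \<open>psi_expansion\<close> in the order of the exponents of the lowest
  terms: at exponent \<open>d\<close> the words with that exponent contribute the sum of their weights, and those
  with smaller exponents a combination of sums already known to be polynomials.
\<close>

theorem content_sum_polynomial:
  assumes "reach_fun 0 n r" "n \<le> N"
  shows "(\<Sum>w | w \<in> {0<..n} \<rightarrow>\<^sub>E {1..N} \<and> (\<forall>c. letter_count w n c = h c). psi_weight r n w) \<in> polynomials"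
proof -
  \<comment> \<open>Larger than every letter count, and at least 2 even if there are no letters.\<close>
  define B where "B = Suc (Suc n)"
  let ?W = "{w \<in> {0<..n} \<rightarrow>\<^sub>E {1..N}. psi_weight r n w \<noteq> 0}"
  let ?D = "\<lambda>w. content_exponent B N (letter_count w n)"
  let ?Q = "\<lambda>w. content_poly B N (letter_count w n)"
  have fin: "finite ({0<..n} \<rightarrow>\<^sub>E {1..N})" by (intro finite_PiE) auto
  have missing: "letter_count w n c = 0" if "w \<in> {0<..n} \<rightarrow>\<^sub>E {1..N}" "c \<notin> {1..N}" for w c
  proof -
    have "c \<notin> w ` {0<..n}" using that by (rule PiE_not_in_image)
    then show ?thesis using letter_count_mono(3)[of 0 n c w] by simp
  qed
  have same: "letter_count w n = letter_count w' n"
    if "w \<in> {0<..n} \<rightarrow>\<^sub>E {1..N}" "w' \<in> {0<..n} \<rightarrow>\<^sub>E {1..N}" "?D w = ?D w'" for w w'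
  proof
    fix c
    show "letter_count w n c = letter_count w' n c"
    proof (cases "c \<in> {1..N}")
      case True
      have "letter_count v n i < B" for v i
        using letter_count_le[of v n i] by (simp add: B_def)
      then show ?thesis
        using that(3) True unfolding content_exponent_def
        by (intro digits_unique[of N "letter_count w n" B "letter_count w' n"])
    qed (use missing that in simp)
  qed
  have lowest: "lowest_monic (?Q w) (?D w)" if "w \<in> ?W" for w
  proof (rule content_poly_lowest)
    show "letter_count w n (Suc c) \<le> letter_count w n c" if "0 < c" for c
      using psi_word_lattice[OF assms(1) _ le_refl that, of qint w] \<open>w \<in> ?W\<close> by (simp add: psi_weight_def)
  qed (use that missing in \<open>auto simp: B_def\<close>)
  have C: "(\<Sum>w | w \<in> ?W \<and> ?D w = d. psi_weight r n w) \<in> polynomials" for d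
  proof (induction d rule: less_induct)
    case (less d)
    let ?S = "\<lambda>w. psi_weight r n w * coeff (?Q w) d"
    have "coeff (chrom_poly B N n r) d = (\<Sum>w\<in>{0<..n} \<rightarrow>\<^sub>E {1..N}. ?S w)"
      unfolding psi_expansion[OF assms, symmetric] by (simp add: coeff_sum)
    also have "\<dots> = (\<Sum>w\<in>?W. ?S w)"
      using fin by (intro sum.mono_neutral_right) auto
    also have "\<dots> = (\<Sum>w | w \<in> ?W \<and> ?D w \<le> d. ?S w)"
    proof (rule sum.mono_neutral_right)
      show "finite ?W" using fin by simp
      show "\<forall>w\<in>?W - {w. w \<in> ?W \<and> ?D w \<le> d}. ?S w = 0"
      proof
        fix w assume w: "w \<in> ?W - {w. w \<in> ?W \<and> ?D w \<le> d}"
        then have "w \<in> ?W" and d: "d < ?D w" by auto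
        have "lowest_monic (?Q w) (?D w)" using \<open>w \<in> ?W\<close> by (rule lowest)
        then show "?S w = 0" using d by (simp add: lowest_monic_def)
      qed
    qed auto
    also have "{w. w \<in> ?W \<and> ?D w \<le> d} = {w. w \<in> ?W \<and> ?D w = d} \<union> {w. w \<in> ?W \<and> ?D w < d}" by auto
    also have "(\<Sum>w\<in>\<dots>. ?S w) = (\<Sum>w | w \<in> ?W \<and> ?D w = d. ?S w) + (\<Sum>w | w \<in> ?W \<and> ?D w < d. ?S w)"
      using fin by (intro sum.union_disjoint) auto
    also have "(\<Sum>w | w \<in> ?W \<and> ?D w = d. ?S w) = (\<Sum>w | w \<in> ?W \<and> ?D w = d. psi_weight r n w)"
    proof (rule sum.cong)
      fix w assume w: "w \<in> {w. w \<in> ?W \<and> ?D w = d}"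
      then have "lowest_monic (?Q w) d" using lowest[of w] by simp
      then show "?S w = psi_weight r n w" by (simp add: lowest_monic_def)
    qed simp
    also have "(\<Sum>w | w \<in> ?W \<and> ?D w < d. ?S w) = (\<Sum>d'<d. \<Sum>w\<in>{w \<in> {w. w \<in> ?W \<and> ?D w < d}. ?D w = d'}. ?S w)"
      using fin by (intro sum.group[symmetric]) auto
    finally have eq: "(\<Sum>w | w \<in> ?W \<and> ?D w = d. psi_weight r n w) = coeff (chrom_poly B N n r) d -
        (\<Sum>d'<d. \<Sum>w\<in>{w \<in> {w. w \<in> ?W \<and> ?D w < d}. ?D w = d'}. ?S w)" by simp
    have lower: "(\<Sum>w\<in>{w \<in> {w. w \<in> ?W \<and> ?D w < d}. ?D w = d'}. ?S w) \<in> polynomials" if "d' < d" for d'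
    proof (cases "\<exists>w. w \<in> ?W \<and> ?D w = d'")
      case True
      then obtain v where v: "v \<in> ?W" "?D v = d'" by blast
      have "(\<Sum>w\<in>{w \<in> {w. w \<in> ?W \<and> ?D w < d}. ?D w = d'}. ?S w) =
          (\<Sum>w | w \<in> ?W \<and> ?D w = d'. psi_weight r n w * coeff (?Q v) d)"
      proof (rule sum.cong)
        show "{w \<in> {w. w \<in> ?W \<and> ?D w < d}. ?D w = d'} = {w. w \<in> ?W \<and> ?D w = d'}" using that by auto
        fix w assume "w \<in> {w. w \<in> ?W \<and> ?D w = d'}"
        then have "letter_count w n = letter_count v n" using v by (intro same) auto
        then show "?S w = psi_weight r n w * coeff (?Q v) d" by simp
      qed
      also have "\<dots> = (\<Sum>w | w \<in> ?W \<and> ?D w = d'. psi_weight r n w) * coeff (?Q v) d"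
        by (rule sum_distrib_right[symmetric])
      also have "\<dots> \<in> polynomials"
        using less[OF that] content_poly_coeffs by (intro polynomials_mult) (auto simp: poly_coeffs_def)
      finally show ?thesis .
    next
      case False
      then have "{w \<in> {w. w \<in> ?W \<and> ?D w < d}. ?D w = d'} = {}" by blast
      then show ?thesis by (simp only: sum.empty polynomials_0)
    qed
    have "coeff (chrom_poly B N n r) d \<in> polynomials" using chrom_poly_coeffs by (auto simp: poly_coeffs_def)
    moreover have "(\<Sum>d'<d. \<Sum>w\<in>{w \<in> {w. w \<in> ?W \<and> ?D w < d}. ?D w = d'}. ?S w) \<in> polynomials"
    proof (rule polynomials_sum)
      fix d' assume "d' \<in> {..<d}"
      then have "d' < d" by simp
      then show "(\<Sum>w\<in>{w \<in> {w. w \<in> ?W \<and> ?D w < d}. ?D w = d'}. ?S w) \<in> polynomials" by (rule lower)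
    qed
    ultimately show ?case unfolding eq by (rule polynomials_diff)
  qed
  let ?H = "{w. w \<in> {0<..n} \<rightarrow>\<^sub>E {1..N} \<and> (\<forall>c. letter_count w n c = h c)}"
  show ?thesis
  proof (cases "?H = {}")
    case True
    then show ?thesis by (simp only: sum.empty polynomials_0)
  next
    case False
    then obtain v where v: "v \<in> ?H" by blast
    have "w \<in> ?H \<longleftrightarrow> ?D w = ?D v" if "w \<in> {0<..n} \<rightarrow>\<^sub>E {1..N}" for w
      using same[of w v] v that by (auto simp: fun_eq_iff content_exponent_def)
    then have "{w. w \<in> ?W \<and> ?D w = ?D v} = {w \<in> ?H. psi_weight r n w \<noteq> 0}" by auto
    moreover have "sum (psi_weight r n) ?H = sum (psi_weight r n) {w \<in> ?H. psi_weight r n w \<noteq> 0}"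
      using fin by (intro sum.mono_neutral_right) auto
    ultimately show ?thesis using C[of "?D v"] by simp
  qed
qed

section \<open>Words with given last letter\<close>

definition remove_letter :: "(nat \<Rightarrow> nat) \<Rightarrow> nat \<Rightarrow> nat \<Rightarrow> nat" where
  "remove_letter h c = h(c := h c - 1)"

lemma remove_letter_other: "d \<noteq> c \<Longrightarrow> remove_letter h c d = h d"
  by (simp add: remove_letter_def)

text \<open>
  Here \<open>N\<close> only bounds the alphabet; the bound leaves room for the path that is attached below.
\<close>

definition last_letter_sum :: "(nat \<Rightarrow> nat) \<Rightarrow> nat \<Rightarrow> nat \<Rightarrow> (nat \<Rightarrow> nat) \<Rightarrow> nat \<Rightarrow> ratfun" where
  "last_letter_sum r N n h p =
     (\<Sum>w | w \<in> {0<..n} \<rightarrow>\<^sub>E {1..N} \<and> (\<forall>c. letter_count w n c = h c) \<and> w n = p. psi_weight r n w)"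

lemma psi_word_bound:
  assumes "psi_weight r n w \<noteq> 0" "0 < t" "t \<le> n"
  shows "w t \<le> t"
  using assms(2,3)
proof (induction t rule: less_induct)
  case (less t)
  then have "t \<in> {0<..n}" by simp
  then have "psi_set (w ` {r t<..<t}) (w t) \<noteq> 0"
    using assms(1) unfolding psi_weight_def colour_weight_def by (auto simp: prod_zero_iff)
  then consider "w t = 1" | "w t - 1 \<in> w ` {r t<..<t}" by (auto simp: psi_set_def split: if_splits)
  then show ?case
  proof cases
    case 2
    then obtain s where "s < t" "r t < s" "w t - 1 = w s" by auto
    then show ?thesis using less.IH[of s] less.prems by auto
  qed (use less in auto)
qed

lemma last_letter_sum_eq_0:
  assumes "n < K" "0 < h K \<or> p = K" "0 < n"
  shows "last_letter_sum r N n h p = 0"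
  unfolding last_letter_sum_def
proof (rule sum.neutral, rule ballI, rule ccontr)
  fix w assume w: "w \<in> {w. w \<in> {0<..n} \<rightarrow>\<^sub>E {1..N} \<and> (\<forall>c. letter_count w n c = h c) \<and> w n = p}"
    and nz: "psi_weight r n w \<noteq> 0"
  have bound: "w t \<le> n" if "t \<in> {0<..n}" for t using psi_word_bound[OF nz, of t] that by auto
  have "K \<notin> w ` {0<..n}" using bound assms(1) by (metis imageE linorder_not_le)
  then have "letter_count w n K = 0" using letter_count_mono(3)[of 0 n K w] by simp
  then show False using w assms bound[of n] by auto
qed

text \<open>
  The new vertex \<open>n + 1\<close> is adjacent only to \<open>n\<close>. Its letter is therefore either one more than the
  last letter or, with weight \<open>q [p - 1] / [p]\<close>, equal to 1.
\<close>

lemma last_letter_sum_Suc: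
  assumes "0 < n" "r (Suc n) = n - 1" "c \<in> {1..N}"
  shows "last_letter_sum r N (Suc n) h c = (if h c = 0 then 0 else
    (\<Sum>p=1..N. psi_set {p} c * qint c * last_letter_sum r N n (remove_letter h c) p))"
proof -
  let ?P = "{0<..n} \<rightarrow>\<^sub>E {1..N}"
  let ?h = "remove_letter h c"
  let ?c = "\<lambda>w. \<forall>d. letter_count w n d = ?h d"
  have indicator_form: "last_letter_sum r N m g p = (\<Sum>w\<in>{0<..m} \<rightarrow>\<^sub>E {1..N}.
      if (\<forall>d. letter_count w m d = g d) \<and> w m = p then psi_weight r m w else 0)" for m g p
  proof -
    have "finite ({0<..m} \<rightarrow>\<^sub>E {1..N})" by (intro finite_PiE) auto
    then show ?thesis unfolding last_letter_sum_def by (simp only: sum.inter_filter[symmetric])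
  qed
  have step: "psi_weight r (Suc n) (w(Suc n := d)) = psi_weight r n w * (psi_set {w n} d * qint d)" for w d
  proof -
    have "{n - 1<..n} = {n}" using assms(1) by auto
    then show ?thesis unfolding psi_weight_def by (subst colour_weight_Suc) (simp_all add: assms)
  qed
  have cond: "(\<forall>d. letter_count (w(Suc n := c)) (Suc n) d = h d) \<longleftrightarrow> h c \<noteq> 0 \<and> ?c w" for w
  proof -
    have count: "letter_count (w(Suc n := c)) (Suc n) d = letter_count w n d + (if c = d then 1 else 0)" for d
      using letter_count_cong[of n "w(Suc n := c)" w d] by (simp add: letter_count_Suc)
    show ?thesis
    proof (intro iffI conjI allI)
      assume L: "\<forall>d. letter_count (w(Suc n := c)) (Suc n) d = h d"
      show "h c \<noteq> 0" using L[rule_format, of c] unfolding count by simp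
      show "letter_count w n d = ?h d" for d
        using L[rule_format, of d] unfolding count by (cases "c = d") (simp_all add: remove_letter_def)
    next
      fix d assume R: "h c \<noteq> 0 \<and> ?c w"
      then have "letter_count w n d = ?h d" "h c \<noteq> 0" by blast+
      then show "letter_count (w(Suc n := c)) (Suc n) d = h d"
        unfolding count by (cases "c = d") (simp_all add: remove_letter_def)
    qed
  qed
  have "last_letter_sum r N (Suc n) h c = (\<Sum>w\<in>{0<..Suc n} \<rightarrow>\<^sub>E {1..N}.
      if (\<forall>d. letter_count w (Suc n) d = h d) \<and> w (Suc n) = c then psi_weight r (Suc n) w else 0)"
    by (rule indicator_form)
  also have "\<dots> = (\<Sum>w\<in>?P. \<Sum>d=1..N. if d = c then
      (if h c \<noteq> 0 \<and> ?c w then psi_weight r n w * (psi_set {w n} c * qint c) else 0) else 0)"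
    unfolding sum_PiE_Suc[OF le0 finite_atLeastAtMost]
  proof (rule sum.cong[OF refl], rule sum.cong[OF refl])
    fix w d
    show "(if (\<forall>e. letter_count (w(Suc n := d)) (Suc n) e = h e) \<and> (w(Suc n := d)) (Suc n) = c
        then psi_weight r (Suc n) (w(Suc n := d)) else 0) =
      (if d = c then (if h c \<noteq> 0 \<and> ?c w then psi_weight r n w * (psi_set {w n} c * qint c) else 0) else 0)"
      by (cases "d = c") (simp_all only: fun_upd_same cond step simp_thms if_False if_True)
  qed
  also have "\<dots> = (\<Sum>w\<in>?P. if h c \<noteq> 0 \<and> ?c w then psi_weight r n w * (psi_set {w n} c * qint c) else 0)"
    using assms(3) by simp
  finally have *: "last_letter_sum r N (Suc n) h c =
    (\<Sum>w\<in>?P. if h c \<noteq> 0 \<and> ?c w then psi_weight r n w * (psi_set {w n} c * qint c) else 0)" .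
  show ?thesis
  proof (cases "h c = 0")
    case True
    then show ?thesis using * by simp
  next
    case False
    have "(\<Sum>p=1..N. psi_set {p} c * qint c * last_letter_sum r N n ?h p) =
        (\<Sum>p=1..N. \<Sum>w\<in>?P. if w n = p then (if ?c w then psi_weight r n w * (psi_set {w n} c * qint c) else 0) else 0)"
    proof (rule sum.cong)
      fix p
      have "last_letter_sum r N n ?h p = (\<Sum>w\<in>?P. if ?c w \<and> w n = p then psi_weight r n w else 0)"
        by (rule indicator_form)
      then have "psi_set {p} c * qint c * last_letter_sum r N n ?h p =
          (\<Sum>w\<in>?P. psi_set {p} c * qint c * (if ?c w \<and> w n = p then psi_weight r n w else 0))"
        by (simp only: sum_distrib_left)
      also have "\<dots> = (\<Sum>w\<in>?P. if w n = p then (if ?c w then psi_weight r n w * (psi_set {w n} c * qint c) else 0) else 0)"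
      proof (rule sum.cong[OF refl])
        fix w
        show "psi_set {p} c * qint c * (if ?c w \<and> w n = p then psi_weight r n w else 0) =
          (if w n = p then (if ?c w then psi_weight r n w * (psi_set {w n} c * qint c) else 0) else 0)"
          by (cases "w n = p"; cases "?c w")
            (simp_all only: simp_thms if_True if_False mult_zero_right mult_zero_left mult_ac)
      qed
      finally show "psi_set {p} c * qint c * last_letter_sum r N n ?h p =
          (\<Sum>w\<in>?P. if w n = p then (if ?c w then psi_weight r n w * (psi_set {w n} c * qint c) else 0) else 0)"
        .
    qed simp
    also have "\<dots> = (\<Sum>w\<in>?P. \<Sum>p=1..N. if w n = p then (if ?c w then psi_weight r n w * (psi_set {w n} c * qint c) else 0) else 0)"
      by (rule sum.swap)
    also have "\<dots> = (\<Sum>w\<in>?P. if ?c w then psi_weight r n w * (psi_set {w n} c * qint c) else 0)"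
    proof (rule sum.cong)
      fix w assume "w \<in> ?P"
      from PiE_mem[OF this, of n] have "w n \<in> {1..N}" using assms(1) by simp
      then show "(\<Sum>p=1..N. if w n = p then (if ?c w then psi_weight r n w * (psi_set {w n} c * qint c) else 0) else 0)
        = (if ?c w then psi_weight r n w * (psi_set {w n} c * qint c) else 0)"
        by (subst sum.delta') (simp_all only: finite_atLeastAtMost if_True)
    qed simp
    finally show ?thesis using * False by simp
  qed
qed

lemma psi_set_singleton_1: "0 < p \<Longrightarrow> psi_set {p} 1 = qvar * qint (p - 1) / qint p"
proof -
  assume "0 < p"
  then have "{s \<in> {p}. 1 < s} = (if p = 1 then {} else {p})" "{s \<in> {p}. s < 1} = {}" by auto
  then show ?thesis using \<open>0 < p\<close> by (auto simp: psi_set_def qint_pos_def)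
qed

lemma psi_set_singleton_Suc: "0 < k \<Longrightarrow> psi_set {p} (Suc k) = (if p = k then 1 / qint k else 0)"
proof (cases "p = k")
  case True
  then have sets: "{s \<in> {p}. s < Suc k} = {k}" "{s \<in> {p}. Suc k < s} = {}" by auto
  assume "0 < k"
  then show ?thesis unfolding psi_set_def sets using True by (simp add: qint_pos_def)
qed (simp add: psi_set_def)

text \<open>
  After division by \<open>[p]\<close> a step from \<open>p\<close> to \<open>p + 1\<close> along a path has weight 1.
\<close>

definition last_letter_quotient :: "(nat \<Rightarrow> nat) \<Rightarrow> nat \<Rightarrow> nat \<Rightarrow> (nat \<Rightarrow> nat) \<Rightarrow> nat \<Rightarrow> ratfun" where
  "last_letter_quotient r N n h p = last_letter_sum r N n h p / qint p"

lemma last_letter_quotient_grow: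
  assumes "0 < n" "r (Suc n) = n - 1" "0 < p" "Suc p \<le> N"
  shows "last_letter_quotient r N (Suc n) h (Suc p) =
    (if h (Suc p) = 0 then 0 else last_letter_quotient r N n (remove_letter h (Suc p)) p)"
proof -
  let ?h = "remove_letter h (Suc p)"
  have "(\<Sum>p'=1..N. psi_set {p'} (Suc p) * qint (Suc p) * last_letter_sum r N n ?h p') =
      (\<Sum>p'=1..N. if p' = p then 1 / qint p * qint (Suc p) * last_letter_sum r N n ?h p else 0)"
    using assms by (intro sum.cong) (auto simp: psi_set_singleton_Suc)
  also have "\<dots> = 1 / qint p * qint (Suc p) * last_letter_sum r N n ?h p"
    using assms by (subst sum.delta) auto
  finally show ?thesis
    using last_letter_sum_Suc[of n r "Suc p" N h] assms
    by (simp add: last_letter_quotient_def)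
qed

lemma last_letter_quotient_restart:
  assumes "0 < n" "r (Suc n) = n - 1" "0 < N"
  shows "last_letter_quotient r N (Suc n) h 1 = (if h 1 = 0 then 0 else
    (\<Sum>p=1..N. qvar * qint (p - 1) * last_letter_quotient r N n (remove_letter h 1) p))"
proof -
  let ?h = "remove_letter h 1"
  have "(\<Sum>p=1..N. psi_set {p} 1 * qint 1 * last_letter_sum r N n ?h p) =
      (\<Sum>p=1..N. qvar * qint (p - 1) * last_letter_quotient r N n ?h p)"
    by (intro sum.cong) (auto simp: psi_set_singleton_1[unfolded One_nat_def] last_letter_quotient_def)
  then show ?thesis
    using last_letter_sum_Suc[of n r 1 N h] assms unfolding last_letter_quotient_def[of r N "Suc n"] by simp
qed

lemma last_letter_quotient_total:
  assumes "reach_fun 0 n r" "0 < n" "n \<le> N"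
  shows "(\<Sum>p=1..N. qint p * last_letter_quotient r N n h p) \<in> polynomials"
proof -
  let ?H = "{w. w \<in> {0<..n} \<rightarrow>\<^sub>E {1..N} \<and> (\<forall>c. letter_count w n c = h c)}"
  have "finite ({0<..n} \<rightarrow>\<^sub>E {1..N})" by (intro finite_PiE) auto
  then have fin: "finite ?H" by (rule finite_subset[rotated]) auto
  have last: "w n \<in> {1..N}" if "w \<in> ?H" for w
    using that assms(2) by (auto dest!: PiE_mem[of w _ _ n])
  have "(\<Sum>p=1..N. qint p * last_letter_quotient r N n h p) = (\<Sum>p=1..N. sum (psi_weight r n) {w \<in> ?H. w n = p})"
    by (intro sum.cong) (auto simp: last_letter_quotient_def last_letter_sum_def conj_assoc)
  also have "\<dots> = sum (psi_weight r n) ?H"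
    using fin last by (intro sum.group) auto
  finally show ?thesis using content_sum_polynomial[OF assms(1,3)] by simp
qed

text \<open>
  The graph is extended by a path with \<open>s \<ge> n\<close> vertices and the content by the letters
  \<open>k + 1, \<dots>, K\<close> where \<open>K = k + s\<close>. The sum over all words of this content is a polynomial. Sorted
  by the last letter \<open>p\<close> it consists of: the case \<open>p = K\<close>, which is \<open>[K]\<close> times the quotient in
  question; the cases \<open>p > K\<close>, which come from a last letter larger than \<open>k\<close> at the start of the
  path; and the cases \<open>p < K\<close>. In the latter the run at the end of the word does not reach from the
  old part to \<open>K\<close>, and since \<open>K > n\<close> does not fit in the old part, it was produced by an earlier run,
  again starting from a letter larger than \<open>k\<close>.
\<close>

theorem last_letter_quotient_polynomial:
  assumes "reach_fun 0 n r" "0 < n" "0 < k"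
  shows "last_letter_quotient r (2 * n + 2) n h k \<in> polynomials"
  using assms(3)
proof (induction "Suc n - k" arbitrary: k h rule: less_induct)
  case less
  show ?case
  proof (cases "k \<le> n")
    case False
    then show ?thesis using last_letter_sum_eq_0[of n k h k] assms(2) by (simp add: last_letter_quotient_def)
  next
    case True
    \<comment> \<open>The path has at most \<open>n + 1\<close> vertices, so all words stay inside this alphabet; a path vertex is
        adjacent only to its predecessor.\<close>
    define N where "N = 2 * n + 2"
    define r' where "r' t = (if t \<le> n then r t else t - 2)" for t
    let ?G = "\<lambda>j. last_letter_quotient r' N (n + j)"
    have reach: "reach_fun 0 (n + j) r'" for j
    proof -
      have "r' s \<le> r' t" if "0 < s" "s \<le> t" "t \<le> n + j" for s t
      proof -
        consider "t \<le> n" | "s \<le> n" "n < t" | "n < s" using that by linarith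
        then show ?thesis
        proof cases
          case 2
          have "r s \<le> r n" "r n < n" using reach_funD(2,3)[OF assms(1)] that 2 by auto
          then show ?thesis using 2 by (auto simp: r'_def)
        qed (use that reach_funD(3)[OF assms(1), of s t] in \<open>auto simp: r'_def\<close>)
      qed
      then show ?thesis using reach_funD(2)[OF assms(1)] by (auto simp: reach_fun_def mono_on_def r'_def)
    qed
    have r'_Suc: "r' (Suc (n + j)) = n + j - 1" for j by (simp add: r'_def)
    have grow: "?G (Suc j) h (Suc p) = (if h (Suc p) = 0 then 0 else ?G j (remove_letter h (Suc p)) p)"
      if "0 < p" "Suc p \<le> N" for j p h
      using last_letter_quotient_grow[of "n + j" r' p N h] that r'_Suc assms(2) by simp
    have weight: "psi_weight r' n w = psi_weight r n w" for w
      unfolding psi_weight_def colour_weight_def by (intro prod.cong) (auto simp: r'_def)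
    have start: "?G 0 h p = last_letter_quotient r N n h p" for h p
      by (simp add: last_letter_quotient_def last_letter_sum_def weight)
    \<comment> \<open>A letter that exceeds \<open>k\<close> by more than the number of path vertices comes from an uninterrupted
        run that started above \<open>k\<close>.\<close>
    have above: "?G j h p \<in> polynomials" if "k + j < p" "p \<le> N" for j h p
      using that
    proof (induction j arbitrary: h p)
      case 0
      have "last_letter_quotient r N n h p \<in> polynomials"
        unfolding N_def using 0 less.prems \<open>k \<le> n\<close> by (intro less.hyps) auto
      then show ?case by (simp only: start)
    next
      case (Suc j)
      then obtain p' where "p = Suc p'" by (cases p) auto
      moreover have "?G j (remove_letter h p) p' \<in> polynomials"
        using Suc.prems \<open>p = Suc p'\<close> by (intro Suc.IH) auto
      ultimately show ?case using grow[of p' j h] Suc.prems by simp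
    qed
    have scaled: "qint (k + s) * last_letter_quotient r N n h k \<in> polynomials" if s: "n \<le> s" "n + s < N" for s
    proof -
      let ?K = "k + s"
      have K: "n < ?K" "?K \<le> N" using s less.prems \<open>k \<le> n\<close> by (auto simp: N_def)
      have zero: "?G 0 h p = 0" if "0 < h ?K" for h p
        using last_letter_sum_eq_0[of n ?K h p r' N] that K assms(2) by (simp add: last_letter_quotient_def)
      \<comment> \<open>An uninterrupted run from \<open>k\<close> has not yet used the letter \<open>K\<close>, which the old part cannot
          contain.\<close>
      have run: "?G j h (k + j) = 0" if "j < s" "0 < h ?K" for j h
        using that
      proof (induction j arbitrary: h)
        case (Suc j)
        have "?G j (remove_letter h (Suc (k + j))) (k + j) = 0"
          using Suc.prems by (intro Suc.IH) (simp_all add: remove_letter_other)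
        then show ?case using grow[of "k + j" j h] Suc.prems K less.prems by simp
      qed (use zero in simp)
      have below: "?G j h p \<in> polynomials" if "j \<le> s" "0 < p" "p < k + j" "0 < h ?K" for j h p
        using that
      proof (induction j arbitrary: h p)
        case 0
        then show ?case using zero[of h p] by simp
      next
        case (Suc j)
        show ?case
        proof (cases "p = 1")
          case True
          have hK: "0 < remove_letter h 1 ?K"
            using Suc.prems K assms(2) by (subst remove_letter_other) auto
          have G: "?G j (remove_letter h 1) p' \<in> polynomials" if "p' \<in> {1..N}" for p'
          proof (cases p' "k + j" rule: linorder_cases)
            case less
            then show ?thesis using Suc.prems that hK by (intro Suc.IH) auto
          next
            case equal
            then show ?thesis using run[of j "remove_letter h 1"] hK Suc.prems by simp
          next
            case greater
            then show ?thesis using that by (intro above) auto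
          qed
          have "?G (Suc j) h 1 = (if h 1 = 0 then 0 else
              (\<Sum>p=1..N. qvar * qint (p - 1) * ?G j (remove_letter h 1) p))"
            using last_letter_quotient_restart[of "n + j" r' N h] r'_Suc[of j] assms(2) by (simp add: N_def)
          moreover have "(\<Sum>p=1..N. qvar * qint (p - 1) * ?G j (remove_letter h 1) p) \<in> polynomials"
            using polynomials_qvar_power[of 1] G
            by (intro polynomials_sum polynomials_mult polynomials_qint) simp_all
          ultimately show ?thesis unfolding True by (cases "h 1 = 0") simp_all
        next
          case False
          define p' where "p' = p - 1"
          have p': "p = Suc p'" "0 < p'" using False \<open>0 < p\<close> by (simp_all add: p'_def)
          have "?G j (remove_letter h (Suc p')) p' \<in> polynomials"
            using Suc.prems p' by (intro Suc.IH) (simp_all add: remove_letter_other)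
          then show ?thesis
            using grow[of p' j h] Suc.prems p' K by simp
        qed
      qed
      define H where "H j c = h c + (if k < c \<and> c \<le> k + j then 1 else 0)" for j c
      \<comment> \<open>Following the run back to its start removes exactly the letters that were added to the
          content.\<close>
      have chain: "?G j (H j) (k + j) = ?G 0 h k" if "j \<le> s" for j
        using that
      proof (induction j)
        case 0
        have "H 0 = h" by (auto simp: H_def)
        then show ?case by simp
      next
        case (Suc j)
        have "remove_letter (H (Suc j)) (Suc (k + j)) = H j" by (auto simp: H_def remove_letter_def fun_eq_iff)
        moreover have "H (Suc j) (Suc (k + j)) \<noteq> 0" by (simp add: H_def)
        moreover have "?G j (H j) (k + j) = ?G 0 h k" using Suc by simp
        moreover have "0 < k + j" "Suc (k + j) \<le> N" using Suc.prems K less.prems by simp_all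
        ultimately show ?case using grow[of "k + j" j "H (Suc j)"] by simp
      qed
      have "0 < s" using s assms(2) by simp
      then have HK: "0 < H s ?K" using K by (simp add: H_def)
      have "(\<Sum>p=1..N. qint p * ?G s (H s) p) \<in> polynomials"
        using s reach[of s] assms(2) by (intro last_letter_quotient_total) auto
      also have "(\<Sum>p=1..N. qint p * ?G s (H s) p) =
          qint ?K * ?G s (H s) ?K + (\<Sum>p\<in>{1..N} - {?K}. qint p * ?G s (H s) p)"
        using K less.prems by (intro sum.remove) auto
      finally have total: "qint ?K * ?G s (H s) ?K + (\<Sum>p\<in>{1..N} - {?K}. qint p * ?G s (H s) p) \<in> polynomials" .
      have "(\<Sum>p\<in>{1..N} - {?K}. qint p * ?G s (H s) p) \<in> polynomials"
      proof (intro polynomials_sum polynomials_mult polynomials_qint)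
        fix p assume p: "p \<in> {1..N} - {?K}"
        show "?G s (H s) p \<in> polynomials"
        proof (cases p ?K rule: linorder_cases)
          case less
          then show ?thesis using p HK by (intro below) auto
        next
          case greater
          then show ?thesis using p by (intro above) auto
        qed (use p in simp)
      qed
      from polynomials_diff[OF total this] have "qint ?K * ?G s (H s) ?K \<in> polynomials" by simp
      then show ?thesis using chain[of s] by (simp only: start le_refl simp_thms)
    qed
    \<comment> \<open>The two consecutive values \<open>s = n\<close> and \<open>s = n + 1\<close> suffice.\<close>
    have "qint (Suc (k + n)) - qvar * qint (k + n) = 1"
      unfolding qint_def by (subst sum.lessThan_Suc_shift) (simp add: sum_distrib_left)
    then have "last_letter_quotient r N n h k =
        (qint (Suc (k + n)) - qvar * qint (k + n)) * last_letter_quotient r N n h k" by simp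
    also have "\<dots> = qint (Suc (k + n)) * last_letter_quotient r N n h k
        - qvar * (qint (k + n) * last_letter_quotient r N n h k)" by (simp only: left_diff_distrib mult.assoc)
    also have "\<dots> \<in> polynomials"
    proof (rule polynomials_diff[OF _ polynomials_mult])
      show "qvar \<in> polynomials" using polynomials_qvar_power[of 1] by simp
      show "qint (k + n) * last_letter_quotient r N n h k \<in> polynomials"
        by (rule scaled) (simp_all add: N_def)
      show "qint (Suc (k + n)) * last_letter_quotient r N n h k \<in> polynomials"
        using scaled[of "Suc n"] by (simp add: N_def)
    qed
    finally show ?thesis by (simp add: N_def)
  qed
qed

section \<open>Run lengths and transition weights\<close>

lemma sum_split_nat:
  fixes f :: "nat \<Rightarrow> nat"
  assumes "m \<le> Suc i" "i \<le> k"
  shows "sum f {m..k} = sum f {m..i} + sum f {Suc i..k}"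
proof -
  have "{m..k} = {m..i} \<union> {Suc i..k}" "{m..i} \<inter> {Suc i..k} = {}" using assms by auto
  then show ?thesis by (simp add: sum.union_disjoint)
qed

text \<open>
  The 1-runs of \<open>\<delta>\<close> occupy the columns \<open>1, \<dots>, C 0 - 1\<close> (possibly none) and
  \<open>D i, \<dots>, C i - 1\<close>; so \<open>C i\<close> is the first column after a 1-run, where a cell may be added.
\<close>

locale run_ends =
  fixes l :: nat and C D :: "nat \<Rightarrow> nat"
  assumes C_pos: "0 < C 0"
    and zeros: "\<And>i. 0 < i \<Longrightarrow> i \<le> l \<Longrightarrow> C (i - 1) < D i"
    and ones: "\<And>i. 0 < i \<Longrightarrow> i \<le> l \<Longrightarrow> D i < C i"
begin

definition one_set :: "nat set" where
  "one_set = {1..<C 0} \<union> (\<Union>i\<in>{1..l}. {D i..<C i})"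

lemma C_mono: "i < j \<Longrightarrow> j \<le> l \<Longrightarrow> C i < D j"
proof (induction j)
  case (Suc j)
  have "C j < D (Suc j)" using zeros[of "Suc j"] Suc by simp
  moreover have "C i \<le> C j"
    using Suc ones[of j] by (cases "i = j") auto
  ultimately show ?case by simp
qed simp

lemma C_le: "i \<le> j \<Longrightarrow> j \<le> l \<Longrightarrow> C i \<le> C j"
  using C_mono[of i j] ones[of j] by (cases "i = j") auto

lemma one_setE:
  assumes "s \<in> one_set"
  obtains "1 \<le> s" "s < C 0" | i where "0 < i" "i \<le> l" "D i \<le> s" "s < C i"
  using assms unfolding one_set_def by (auto simp: Suc_le_eq)

lemma one_setI: "0 < i \<Longrightarrow> i \<le> l \<Longrightarrow> D i \<le> s \<Longrightarrow> s < C i \<Longrightarrow> s \<in> one_set"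
  and one_setI_0: "1 \<le> s \<Longrightarrow> s < C 0 \<Longrightarrow> s \<in> one_set"
  unfolding one_set_def by auto

lemma below_C:
  assumes k: "k \<le> l"
  shows "{s \<in> one_set. s < C k} = {1..<C 0} \<union> (\<Union>i\<in>{1..k}. {D i..<C i})"
proof (intro set_eqI iffI)
  fix s assume s: "s \<in> {s \<in> one_set. s < C k}"
  then have "s \<in> one_set" by simp
  then show "s \<in> {1..<C 0} \<union> (\<Union>i\<in>{1..k}. {D i..<C i})"
  proof (cases rule: one_setE)
    case (2 i)
    have "i \<le> k" using C_mono[of k i] 2 s by (cases "k < i") auto
    then have "i \<in> {1..k}" "s \<in> {D i..<C i}" using 2 by auto
    then show ?thesis by blast
  qed simp
next
  fix s assume "s \<in> {1..<C 0} \<union> (\<Union>i\<in>{1..k}. {D i..<C i})"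
  then consider "1 \<le> s" "s < C 0" | i where "i \<in> {1..k}" "D i \<le> s" "s < C i" by auto
  then show "s \<in> {s \<in> one_set. s < C k}"
  proof cases
    case 1
    then show ?thesis using C_le[of 0 k] k one_setI_0[of s] by simp
  next
    case 2
    then show ?thesis using C_le[of i k] k one_setI[of i s] by simp
  qed
qed

lemma above_C:
  assumes k: "k \<le> l"
  shows "{s \<in> one_set. C k < s} = (\<Union>i\<in>{Suc k..l}. {D i..<C i})"
proof (intro set_eqI iffI)
  fix s assume s: "s \<in> {s \<in> one_set. C k < s}"
  then have "s \<in> one_set" by simp
  then show "s \<in> (\<Union>i\<in>{Suc k..l}. {D i..<C i})"
  proof (cases rule: one_setE)
    case 1
    then show ?thesis using C_le[of 0 k] k s by simp
  next
    case (2 i)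
    have "k < i" using C_le[of i k] k 2 s by (cases "i \<le> k") auto
    then have "i \<in> {Suc k..l}" "s \<in> {D i..<C i}" using 2 by auto
    then show ?thesis by blast
  qed
next
  fix s assume "s \<in> (\<Union>i\<in>{Suc k..l}. {D i..<C i})"
  then obtain i where "i \<in> {Suc k..l}" "D i \<le> s" "s < C i" by auto
  then show "s \<in> {s \<in> one_set. C k < s}"
    using C_mono[of k i] one_setI[of i s] by simp
qed

lemma C_notin:
  assumes k: "k \<le> l"
  shows "C k \<notin> one_set"
proof
  assume "C k \<in> one_set"
  then show False
  proof (cases rule: one_setE)
    case 1
    then show False using C_le[of 0 k] k by auto
  next
    case (2 i)
    then show False using C_mono[of k i] C_le[of i k] k by (cases "k < i") auto
  qed
qed

lemma pred_C:
  assumes "k \<le> l"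
  shows "C k = 1 \<or> C k - 1 \<in> one_set"
proof (cases "k = 0")
  case True
  then show ?thesis using C_pos by (cases "C 0 = 1") (auto intro!: one_setI_0)
next
  case False
  then have "D k < C k" using ones[of k] assms by simp
  then have "C k - 1 \<in> one_set" using False assms by (intro one_setI[of k]) auto
  then show ?thesis ..
qed

lemma eq_C:
  assumes "0 < c" "c \<notin> one_set" "c = 1 \<or> c - 1 \<in> one_set"
  shows "\<exists>k\<le>l. c = C k"
proof (cases "c - 1 \<in> one_set")
  case True
  then show ?thesis
  proof (cases rule: one_setE)
    case 1
    then have "c = C 0" using assms(2) one_setI_0[of c] by fastforce
    then show ?thesis by auto
  next
    case (2 i)
    then have "c = C i" using assms(2) one_setI[of i c] by fastforce
    then show ?thesis using 2 by auto
  qed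
next
  case False
  then have "c = 1" using assms by simp
  then have "c = C 0" using assms(2) C_pos one_setI_0[of c] by fastforce
  then show ?thesis by auto
qed

text \<open>
  Over each 1-run the factors of \<open>psi_set\<close> telescope to the ratio at its two ends.
\<close>

lemma psi_set_one_set:
  assumes k: "k \<le> l"
  shows "psi_set one_set (C k) =
    qvar ^ (\<Sum>i=k+1..l. C i - D i)
    * (\<Prod>i=1..k. qint (C k - D i) / qint (C k - C (i - 1)))
    * (\<Prod>i=k+1..l. qint (D i - C k) / qint (C i - C k))"
proof -
  let ?z = "C k"
  let ?f = "\<lambda>s. qint_pos (?z - s) / qint_pos (?z - s - 1)" and ?g = "\<lambda>s. qvar * qint (s - ?z) / qint (s + 1 - ?z)"
  have disj: "{D i..<C i} \<inter> {D j..<C j} = {}" if "i \<in> {1..l}" "j \<in> {1..l}" "i \<noteq> j" for i j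
    using C_mono[of i j] C_mono[of j i] that by (cases "i < j") auto
  have "(\<Prod>s\<in>{s \<in> one_set. s < ?z}. ?f s) = (\<Prod>s\<in>{1..<C 0}. ?f s) * (\<Prod>s\<in>(\<Union>i\<in>{1..k}. {D i..<C i}). ?f s)"
    unfolding below_C[OF k]
  proof (rule prod.union_disjoint)
    have "C 0 < D i" if "i \<in> {1..k}" for i using C_mono[of 0 i] that k by auto
    then show "{1..<C 0} \<inter> (\<Union>i\<in>{1..k}. {D i..<C i}) = {}" by force
  qed auto
  also have "(\<Prod>s\<in>(\<Union>i\<in>{1..k}. {D i..<C i}). ?f s) = (\<Prod>i\<in>{1..k}. \<Prod>s\<in>{D i..<C i}. ?f s)"
    using k by (intro prod.UNION_disjoint ballI impI disj) auto
  also have "\<dots> = (\<Prod>i\<in>{1..k}. qint_pos (?z - D i) / qint_pos (?z - C i))"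
  proof (rule prod.cong[OF refl])
    fix i assume "i \<in> {1..k}"
    then show "(\<Prod>s\<in>{D i..<C i}. ?f s) = qint_pos (?z - D i) / qint_pos (?z - C i)"
      using ones[of i] C_le[of i k] k by (intro prod_qint_pos_telescope) auto
  qed
  also have "(\<Prod>s\<in>{1..<C 0}. ?f s) = qint_pos (?z - 1) / qint_pos (?z - C 0)"
    using C_pos C_le[of 0 k] k by (intro prod_qint_pos_telescope) auto
  finally have lower: "(\<Prod>s\<in>{s \<in> one_set. s < ?z}. ?f s) / qint_pos (?z - 1) =
      (\<Prod>i\<in>{1..k}. qint_pos (?z - D i) / qint_pos (?z - C i)) / qint_pos (?z - C 0)" by simp
  \<comment> \<open>Shifts the denominators by one run, from the end of run \<open>i\<close> to the end of run \<open>i - 1\<close>.\<close>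
  have shift: "(\<Prod>i\<in>{1..j}. G i / F i) / F 0 = (\<Prod>i\<in>{1..j}. G i / F (i - 1)) / F j"
    if "\<And>i. F i \<noteq> (0::ratfun)" for F G and j :: nat
    by (induction j) (use that in \<open>simp_all add: field_simps\<close>)
  have "(\<Prod>i\<in>{1..k}. qint_pos (?z - D i) / qint_pos (?z - C i)) / qint_pos (?z - C 0) =
      (\<Prod>i\<in>{1..k}. qint_pos (?z - D i) / qint_pos (?z - C (i - 1))) / qint_pos (?z - C k)"
    by (rule shift[of "\<lambda>i. qint_pos (?z - C i)"]) simp
  also have "\<dots> = (\<Prod>i=1..k. qint (?z - D i) / qint (?z - C (i - 1)))"
  proof -
    have "(\<Prod>i\<in>{1..k}. qint_pos (?z - D i) / qint_pos (?z - C (i - 1))) = (\<Prod>i=1..k. qint (?z - D i) / qint (?z - C (i - 1)))"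
    proof (rule prod.cong[OF refl])
      fix i assume i: "i \<in> {1..k}"
      then have "D i < ?z" "C (i - 1) < ?z"
        using ones[of i] zeros[of i] C_le[of i k] k by auto
      then show "qint_pos (?z - D i) / qint_pos (?z - C (i - 1)) = qint (?z - D i) / qint (?z - C (i - 1))"
        by (simp add: qint_pos_def)
    qed
    then show ?thesis by (simp add: qint_pos_def)
  qed
  finally have lower': "(\<Prod>s\<in>{s \<in> one_set. s < ?z}. ?f s) / qint_pos (?z - 1) =
      (\<Prod>i=1..k. qint (?z - D i) / qint (?z - C (i - 1)))" using lower by simp
  have run: "(\<Prod>s\<in>{x..<y}. ?g s) = qvar ^ (y - x) * (qint (x - ?z) / qint (y - ?z))" if "x \<le> y" "?z < x" for x y
    using that(1)
  proof (induction y rule: dec_induct)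
    case (step y)
    then show ?case using that(2) by (simp add: Suc_diff_le)
  qed (use that(2) in simp)
  have "(\<Prod>s\<in>{s \<in> one_set. ?z < s}. ?g s) = (\<Prod>i\<in>{Suc k..l}. \<Prod>s\<in>{D i..<C i}. ?g s)"
    unfolding above_C[OF k] by (intro prod.UNION_disjoint ballI impI disj) auto
  also have "\<dots> = (\<Prod>i\<in>{Suc k..l}. qvar ^ (C i - D i) * (qint (D i - ?z) / qint (C i - ?z)))"
  proof (rule prod.cong[OF refl])
    fix i assume "i \<in> {Suc k..l}"
    then show "(\<Prod>s\<in>{D i..<C i}. ?g s) = qvar ^ (C i - D i) * (qint (D i - ?z) / qint (C i - ?z))"
      using ones[of i] C_mono[of k i] by (intro run) auto
  qed
  also have "\<dots> = qvar ^ (\<Sum>i=k+1..l. C i - D i) * (\<Prod>i=k+1..l. qint (D i - ?z) / qint (C i - ?z))"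
    by (simp only: prod.distrib power_sum Suc_eq_plus1)
  finally have upper: "(\<Prod>s\<in>{s \<in> one_set. ?z < s}. ?g s) =
      qvar ^ (\<Sum>i=k+1..l. C i - D i) * (\<Prod>i=k+1..l. qint (D i - ?z) / qint (C i - ?z))" .
  have "psi_set one_set ?z = (\<Prod>s\<in>{s \<in> one_set. s < ?z}. ?f s) / qint_pos (?z - 1) * (\<Prod>s\<in>{s \<in> one_set. ?z < s}. ?g s)"
  proof -
    have "\<not> (?z \<in> one_set \<or> ?z \<noteq> 1 \<and> ?z - 1 \<notin> one_set)" using C_notin[OF k] pred_C[OF k] by blast
    then show ?thesis unfolding psi_set_def by (rule if_not_P)
  qed
  then show ?thesis unfolding lower' upper by (simp only: mult_ac)
qed

end

definition one_positions :: "nat list \<Rightarrow> nat set" where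
  "one_positions d = {j. 1 \<le> j \<and> j \<le> length d \<and> d ! (j - 1) = 1}"

lemma one_positions_append:
  "one_positions (d @ e) = one_positions d \<union> (\<lambda>j. length d + j) ` one_positions e"
proof (intro set_eqI iffI)
  fix j assume "j \<in> one_positions (d @ e)"
  then have j: "1 \<le> j" "j \<le> length d + length e" "(d @ e) ! (j - 1) = 1" by (auto simp: one_positions_def)
  show "j \<in> one_positions d \<union> (\<lambda>j. length d + j) ` one_positions e"
  proof (cases "j \<le> length d")
    case True
    then have "j - 1 < length d" using j by simp
    then show ?thesis using j True by (simp add: one_positions_def nth_append)
  next
    case False
    then have "\<not> j - 1 < length d" "j - 1 - length d = j - length d - 1" by auto
    then have "e ! (j - length d - 1) = 1" using j(3) by (simp only: nth_append if_False)
    moreover have "1 \<le> j - length d" "j - length d \<le> length e" using j False by linarith+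
    ultimately have "j - length d \<in> one_positions e" by (simp add: one_positions_def)
    then show ?thesis using False by (intro UnI2 image_eqI[of _ _ "j - length d"]) auto
  qed
qed (auto simp: one_positions_def nth_append diff_right_commute)

lemma one_positions_replicate:
  "one_positions (replicate k 0) = {}" "one_positions (replicate k 1) = {1..<Suc k}"
  by (auto simp: one_positions_def)

definition run_end :: "(nat \<Rightarrow> nat) \<Rightarrow> (nat \<Rightarrow> nat) \<Rightarrow> nat \<Rightarrow> nat" where
  "run_end a b k = (\<Sum>i=1..k. a i) + (\<Sum>i=0..k. b i) + 1"

definition run_start :: "(nat \<Rightarrow> nat) \<Rightarrow> (nat \<Rightarrow> nat) \<Rightarrow> nat \<Rightarrow> nat" where
  "run_start a b k = (\<Sum>i=1..k. a i) + (\<Sum>i<k. b i) + 1"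

lemma run_end_start: "run_end a b k = run_start a b k + b k"
proof -
  have "{0..k} = insert k {..<k}" by auto
  then show ?thesis by (simp add: run_end_def run_start_def)
qed

lemma run_start_Suc: "run_start a b (Suc k) = run_end a b k + a (Suc k)"
  by (simp add: run_end_def run_start_def lessThan_Suc_atMost atLeast0AtMost)

lemma one_positions_runs:
  assumes "is_runs d (l, a, b)"
  shows "one_positions d = {1..<run_end a b 0} \<union> (\<Union>i\<in>{1..l}. {run_start a b i..<run_end a b i})"
proof -
  let ?p = "\<lambda>l. replicate (b 0) (1::nat) @ concat (map (\<lambda>i. replicate (a i) 0 @ replicate (b i) 1) [1..<Suc l])"
  have "length (?p l) + 1 = run_end a b l \<and>
      one_positions (?p l) = {1..<run_end a b 0} \<union> (\<Union>i\<in>{1..l}. {run_start a b i..<run_end a b i})" for l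
  proof (induction l)
    case 0
    then show ?case using one_positions_replicate(2)[of "b 0"] by (simp add: run_end_def)
  next
    case (Suc l)
    have p: "?p (Suc l) = ?p l @ replicate (a (Suc l)) 0 @ replicate (b (Suc l)) 1" by simp
    have len: "length (?p l) + 1 = run_end a b l" using Suc by blast
    have "length (?p (Suc l)) = length (?p l) + a (Suc l) + b (Suc l)" unfolding p by (simp only: length_append length_replicate)
    then have "length (?p (Suc l)) + 1 = run_end a b (Suc l)"
      using len run_end_start[of a b "Suc l"] run_start_Suc[of a b l] by linarith
    moreover have "one_positions (?p (Suc l)) = one_positions (?p l) \<union>
        {run_start a b (Suc l)..<run_end a b (Suc l)}"
    proof -
      have "(\<lambda>j. length (?p l) + j) ` (\<lambda>j. a (Suc l) + j) ` {1..<Suc (b (Suc l))} =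
        {run_start a b (Suc l)..<run_end a b (Suc l)}"
      proof -
        have "(\<lambda>j. L + j) ` (\<lambda>j. x + j) ` {1..<Suc y} = {L + 1 + x..<L + 1 + x + y}" for L x y :: nat
          by (simp add: image_add_atLeastLessThan add_ac)
        then show ?thesis
          by (simp only: len run_end_start[of a b "Suc l"] run_start_Suc[of a b l])
      qed
      then show ?thesis
        unfolding p by (simp only: one_positions_append one_positions_replicate length_replicate image_empty Un_empty_left)
    qed
    moreover have "{1..Suc l} = insert (Suc l) {1..l}" by auto
    ultimately show ?case using Suc by auto
  qed
  moreover have "d = ?p l @ replicate (a (Suc l)) 0" using assms by simp
  ultimately show ?thesis
    by (simp only: one_positions_append one_positions_replicate image_empty Un_empty_right)
qed

text \<open>
  The first part identifies the weight of a column with \<open>psi_set\<close>. The second shows that columns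
  that are not of the form \<open>add_col n r k T\<close> are those in which \<open>psi_set\<close> vanishes, in agreement with
  the zero weight of the corresponding tableaux.
\<close>

lemma runs_psi:
  assumes "is_runs (delta n r T) (l, a, b)" "runs (delta n r T) = (l, a, b)"
    and S: "S = {c. \<exists>i. r < T (i, c)}" "S \<subseteq> {1..n}"
  shows "k \<le> l \<Longrightarrow> psi n r k T = psi_set S (add_col n r k T)"
    and "0 < c \<Longrightarrow> c \<notin> S \<Longrightarrow> c = 1 \<or> c - 1 \<in> S \<Longrightarrow> \<exists>k\<le>l. c = add_col n r k T"
proof -
  have add_col: "add_col n r k T = run_end a b k" for k
    using assms(2) by (simp add: add_col_def run_end_def)
  interpret run_ends l "run_end a b" "run_start a b"
  proof
    show "0 < run_end a b 0" by (simp add: run_end_def)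
    fix i assume i: "0 < i" "i \<le> l"
    have "\<forall>i\<in>{1..l}. a i > 0 \<and> b i > 0" using assms(1) unfolding is_runs.simps by blast
    then have ab: "0 < a i" "0 < b i" using i by simp_all
    have "Suc (i - 1) = i" using i by simp
    then have "run_start a b i = run_end a b (i - 1) + a i" using run_start_Suc[of a b "i - 1"] by simp
    then show "run_end a b (i - 1) < run_start a b i" using ab by simp
    show "run_start a b i < run_end a b i" using run_end_start[of a b i] ab by simp
  qed
  have "S = one_positions (delta n r T)"
  proof (intro set_eqI)
    fix c
    have "delta n r T ! (c - 1) = (if c \<in> S then 1 else 0)" if "1 \<le> c" "c \<le> n"
    proof -
      have "c - 1 < length [1..<Suc n]" "[1..<Suc n] ! (c - 1) = c"
        using that by (simp_all add: nth_upt del: upt_Suc)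
      then show ?thesis unfolding delta_def S(1) by (simp only: nth_map mem_Collect_eq)
    qed
    note entry = this
    have len: "length (delta n r T) = n" by (simp add: delta_def)
    show "c \<in> S \<longleftrightarrow> c \<in> one_positions (delta n r T)"
    proof (cases "1 \<le> c \<and> c \<le> n")
      case True
      then show ?thesis using entry by (simp add: one_positions_def len)
    next
      case False
      then have "c \<notin> S" using S(2) by fastforce
      then show ?thesis using False unfolding one_positions_def len by blast
    qed
  qed
  also have "\<dots> = one_set" unfolding one_set_def by (rule one_positions_runs[OF assms(1)])
  finally have S': "S = one_set" .
  show "0 < c \<Longrightarrow> c \<notin> S \<Longrightarrow> c = 1 \<or> c - 1 \<in> S \<Longrightarrow> \<exists>k\<le>l. c = add_col n r k T"
    unfolding S' add_col by (rule eq_C)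
  assume k: "k \<le> l"
  have len: "run_end a b i - run_start a b i = b i" for i using run_end_start[of a b i] by simp
  have left: "run_end a b k - run_start a b i = (\<Sum>j=i+1..k. a j) + (\<Sum>j=i..k. b j)"
    "run_end a b k - run_end a b (i - 1) = (\<Sum>j=i..k. a j) + (\<Sum>j=i..k. b j)" if "i \<in> {1..k}" for i
  proof -
    have i: "Suc (i - 1) = i" "1 \<le> i" "i \<le> k" using that by simp_all
    have "sum a {1..k} = sum a {1..i} + sum a {i+1..k}"
      using sum_split_nat[of 1 i k a] i by simp
    moreover have "sum a {1..k} = sum a {1..i - 1} + sum a {i..k}"
      using sum_split_nat[of 1 "i - 1" k a] i by simp
    moreover have "sum b {0..k} = sum b {0..i - 1} + sum b {i..k}"
      using sum_split_nat[of 0 "i - 1" k b] i by simp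
    moreover have "{..<i} = {0..i - 1}" using i by auto
    then have "sum b {..<i} = sum b {0..i - 1}" by (rule arg_cong)
    ultimately show "run_end a b k - run_start a b i = (\<Sum>j=i+1..k. a j) + (\<Sum>j=i..k. b j)"
      "run_end a b k - run_end a b (i - 1) = (\<Sum>j=i..k. a j) + (\<Sum>j=i..k. b j)"
      unfolding run_end_def run_start_def by linarith+
  qed
  have right: "run_start a b i - run_end a b k = (\<Sum>j=k+1..i. a j) + (\<Sum>j=k+1..i-1. b j)"
    "run_end a b i - run_end a b k = (\<Sum>j=k+1..i. a j) + (\<Sum>j=k+1..i. b j)" if "i \<in> {k+1..l}" for i
  proof -
    have i: "k \<le> i - 1" "k \<le> i" "0 < i" using that by auto
    have "sum a {1..i} = sum a {1..k} + sum a {k+1..i}"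
      using sum_split_nat[of 1 k i a] i by simp
    moreover have "sum b {0..i} = sum b {0..k} + sum b {k+1..i}"
      using sum_split_nat[of 0 k i b] i by simp
    moreover have "sum b {0..i - 1} = sum b {0..k} + sum b {k+1..i - 1}"
      using sum_split_nat[of 0 k "i - 1" b] i by simp
    moreover have "{..<i} = {0..i - 1}" using i by auto
    then have "sum b {..<i} = sum b {0..i - 1}" by (rule arg_cong)
    ultimately show "run_start a b i - run_end a b k = (\<Sum>j=k+1..i. a j) + (\<Sum>j=k+1..i-1. b j)"
      "run_end a b i - run_end a b k = (\<Sum>j=k+1..i. a j) + (\<Sum>j=k+1..i. b j)"
      unfolding run_end_def run_start_def by linarith+
  qed
  have "psi_set S (add_col n r k T) = qvar ^ (\<Sum>i=k+1..l. b i)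
      * (\<Prod>i=1..k. qint ((\<Sum>j=i+1..k. a j) + (\<Sum>j=i..k. b j)) / qint ((\<Sum>j=i..k. a j) + (\<Sum>j=i..k. b j)))
      * (\<Prod>i=k+1..l. qint ((\<Sum>j=k+1..i. a j) + (\<Sum>j=k+1..i-1. b j)) / qint ((\<Sum>j=k+1..i. a j) + (\<Sum>j=k+1..i. b j)))"
    unfolding S' add_col psi_set_one_set[OF k] len
    by (intro arg_cong2[of _ _ _ _ "(*)"] prod.cong refl; simp only: left right)
  then show "psi n r k T = psi_set S (add_col n r k T)"
    unfolding psi_def assms(2) by simp
qed

section \<open>Tableau weights as word weights\<close>

text \<open>
  A standard tableau whose shape is not named, so that the largest entry can be removed without
  computing the new partition.
\<close>

definition standard_filling :: "nat \<Rightarrow> tableau \<Rightarrow> bool" where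
  "standard_filling n T \<longleftrightarrow> bij_betw T {x. T x \<noteq> 0} {1..n} \<and>
     (\<forall>i c. T (i, c) \<noteq> 0 \<longrightarrow> 1 \<le> i \<and> 1 \<le> c \<and>
        (\<forall>i'. 1 \<le> i' \<and> i' < i \<longrightarrow> 0 < T (i', c) \<and> T (i', c) < T (i, c)) \<and>
        (\<forall>c'. 1 \<le> c' \<and> c' < c \<longrightarrow> 0 < T (i, c') \<and> T (i, c') < T (i, c)))"

definition entry_column :: "tableau \<Rightarrow> nat \<Rightarrow> nat" where
  "entry_column T t = (THE c. \<exists>i. T (i, c) = t)"

lemma standard_fillingD:
  assumes "standard_filling n T"
  shows "T (i, c) \<noteq> 0 \<Longrightarrow> 1 \<le> i" "T (i, c) \<noteq> 0 \<Longrightarrow> 1 \<le> c"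
    "T (i, c) \<noteq> 0 \<Longrightarrow> 1 \<le> i' \<Longrightarrow> i' < i \<Longrightarrow> 0 < T (i', c)"
    "T (i, c) \<noteq> 0 \<Longrightarrow> 1 \<le> i' \<Longrightarrow> i' < i \<Longrightarrow> T (i', c) < T (i, c)"
    "T (i, c) \<noteq> 0 \<Longrightarrow> 1 \<le> c' \<Longrightarrow> c' < c \<Longrightarrow> 0 < T (i, c')"
    "T (i, c) \<noteq> 0 \<Longrightarrow> 1 \<le> c' \<Longrightarrow> c' < c \<Longrightarrow> T (i, c') < T (i, c)"
proof -
  assume nz: "T (i, c) \<noteq> 0"
  have "1 \<le> i \<and> 1 \<le> c \<and> (\<forall>i'. 1 \<le> i' \<and> i' < i \<longrightarrow> 0 < T (i', c) \<and> T (i', c) < T (i, c)) \<and>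
        (\<forall>c'. 1 \<le> c' \<and> c' < c \<longrightarrow> 0 < T (i, c') \<and> T (i, c') < T (i, c))"
    using assms nz unfolding standard_filling_def by blast
  then show "1 \<le> i" "1 \<le> c"
    "1 \<le> i' \<Longrightarrow> i' < i \<Longrightarrow> 0 < T (i', c)" "1 \<le> i' \<Longrightarrow> i' < i \<Longrightarrow> T (i', c) < T (i, c)"
    "1 \<le> c' \<Longrightarrow> c' < c \<Longrightarrow> 0 < T (i, c')" "1 \<le> c' \<Longrightarrow> c' < c \<Longrightarrow> T (i, c') < T (i, c)"
    by blast+
qed

lemma standard_filling_bij: "standard_filling n T \<Longrightarrow> bij_betw T {x. T x \<noteq> 0} {1..n}"
  unfolding standard_filling_def by (rule conjunct1)

lemma standard_filling_le: "standard_filling n T \<Longrightarrow> T x \<le> n"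
proof (cases "T x = 0")
  case False
  assume "standard_filling n T"
  then have "T x \<in> {1..n}" using False by (intro bij_betw_apply[OF standard_filling_bij]) auto
  then show ?thesis by simp
qed simp

lemma standard_filling_cell:
  assumes "standard_filling n T" "1 \<le> t" "t \<le> n"
  obtains i c where "T (i, c) = t"
proof -
  have "t \<in> T ` {x. T x \<noteq> 0}" using bij_betw_imp_surj_on[OF standard_filling_bij[OF assms(1)]] assms by simp
  then obtain x where "T x = t" by blast
  then show ?thesis using that[of "fst x" "snd x"] by simp
qed

lemma entry_column_eq:
  assumes "standard_filling n T" "T (i, c) = t" "t \<noteq> 0"
  shows "entry_column T t = c"
  unfolding entry_column_def
proof (rule the_equality)
  show "\<exists>i. T (i, c) = t" using assms(2) by blast
  fix c' assume "\<exists>i. T (i, c') = t"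
  then obtain i' where "T (i', c') = t" by blast
  then have "(i', c') = (i, c)"
    using assms(2,3) by (rule_tac inj_onD[OF bij_betw_imp_inj_on[OF standard_filling_bij[OF assms(1)]]]) auto
  then show "c' = c" by simp
qed

lemma standard_filling_column_le:
  assumes "standard_filling n T" "T (i, c) \<noteq> 0"
  shows "c \<le> T (i, c)"
  using assms(2)
proof (induction c)
  case (Suc c)
  show ?case
  proof (cases "c = 0")
    case False
    then have "0 < T (i, c)" "T (i, c) < T (i, Suc c)"
      using standard_fillingD(5,6)[OF assms(1) Suc.prems, of c] by auto
    then show ?thesis using Suc.IH by simp
  qed (use Suc in simp)
qed simp

lemma standard_filling_remove:
  assumes "standard_filling (Suc n) T"
  shows "standard_filling n (remove_entry (Suc n) T)"
proof -
  let ?T = "remove_entry (Suc n) T"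
  note D = standard_fillingD[OF assms]
  have T: "?T x = T x" if "T x < Suc n" for x using that by (simp add: remove_entry_def)
  have nz: "?T x \<noteq> 0 \<longleftrightarrow> T x \<noteq> 0 \<and> T x < Suc n" for x
    using standard_filling_le[OF assms, of x] by (auto simp: remove_entry_def)
  have bij: "bij_betw ?T {x. ?T x \<noteq> 0} {1..n}"
  proof -
    have sub: "{x. ?T x \<noteq> 0} \<subseteq> {x. T x \<noteq> 0}" using nz by blast
    have "bij_betw T {x. ?T x \<noteq> 0} {1..n}"
    proof (rule bij_betw_subset[OF standard_filling_bij[OF assms] sub])
      show "T ` {x. ?T x \<noteq> 0} = {1..n}"
      proof (intro set_eqI iffI)
        fix t assume "t \<in> {1..n}"
        then obtain i c where "T (i, c) = t" using standard_filling_cell[OF assms, of t] by auto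
        then have "?T (i, c) \<noteq> 0" using \<open>t \<in> {1..n}\<close> nz[of "(i, c)"] by simp
        then show "t \<in> T ` {x. ?T x \<noteq> 0}" using \<open>T (i, c) = t\<close> by blast
      next
        fix t assume "t \<in> T ` {x. ?T x \<noteq> 0}"
        then obtain x where "t = T x" "?T x \<noteq> 0" by blast
        then show "t \<in> {1..n}" using nz[of x] by simp
      qed
    qed
    moreover have "bij_betw T {x. ?T x \<noteq> 0} {1..n} = bij_betw ?T {x. ?T x \<noteq> 0} {1..n}"
    proof (rule bij_betw_cong)
      fix x assume "x \<in> {x. ?T x \<noteq> 0}"
      then have "T x < Suc n" using nz[of x] by blast
      then show "T x = ?T x" using T[of x] by simp
    qed
    ultimately show ?thesis by simp
  qed
  moreover have "1 \<le> i \<and> 1 \<le> c \<and>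
        (\<forall>i'. 1 \<le> i' \<and> i' < i \<longrightarrow> 0 < ?T (i', c) \<and> ?T (i', c) < ?T (i, c)) \<and>
        (\<forall>c'. 1 \<le> c' \<and> c' < c \<longrightarrow> 0 < ?T (i, c') \<and> ?T (i, c') < ?T (i, c))" if "?T (i, c) \<noteq> 0" for i c
  proof -
    have x: "T (i, c) \<noteq> 0" "T (i, c) < Suc n" using that nz by auto
    have "0 < ?T (i', c) \<and> ?T (i', c) < ?T (i, c)" if "1 \<le> i'" "i' < i" for i'
      using D(3,4)[OF x(1) that] x(2) by (simp add: T)
    moreover have "0 < ?T (i, c') \<and> ?T (i, c') < ?T (i, c)" if "1 \<le> c'" "c' < c" for c'
      using D(5,6)[OF x(1) that] x(2) by (simp add: T)
    ultimately show ?thesis using D(1,2)[OF x(1)] by blast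
  qed
  ultimately show ?thesis unfolding standard_filling_def by blast
qed

lemma entry_column_remove:
  assumes "standard_filling (Suc n) T" "1 \<le> t" "t \<le> n"
  shows "entry_column (remove_entry (Suc n) T) t = entry_column T t"
proof -
  obtain i c where c: "T (i, c) = t" using standard_filling_cell[OF assms(1), of t] assms by auto
  then have "remove_entry (Suc n) T (i, c) = t" using assms by (simp add: remove_entry_def)
  then show ?thesis
    using entry_column_eq[OF assms(1) c] entry_column_eq[OF standard_filling_remove[OF assms(1)], of i c t] assms(2)
    by simp
qed

text \<open>
  Entry \<open>n + 1\<close> lies at the bottom of its column, so the tableau arises from \<open>add_cell\<close> iff the
  column is one of the admissible ones.
\<close>

lemma hess_p_Suc:
  assumes T: "standard_filling (Suc n) T" and m: "1 \<le> m 1"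
  shows "hess_p (Suc n) m T =
    psi_set (entry_column T ` {Suc n - m 1<..<Suc n}) (entry_column T (Suc n))
    * hess_p n (\<lambda>i. m (i + 1) - 1) (remove_entry (Suc n) T)"
proof -
  let ?T = "remove_entry (Suc n) T" and ?r = "Suc n - m 1" and ?c = "entry_column T (Suc n)"
  let ?S = "entry_column T ` {?r<..<Suc n}"
  note T' = standard_filling_remove[OF T]
  obtain i0 c0 where cell: "T (i0, c0) = Suc n" using standard_filling_cell[OF T, of "Suc n"] by auto
  have c: "?c = c0" using entry_column_eq[OF T cell] by simp
  have c0: "0 < c0" and i0: "1 \<le> i0" using standard_fillingD(1,2)[OF T, of i0 c0] cell by auto
  have ne: "?T x \<noteq> Suc n" for x by (simp add: remove_entry_def)
  have S: "?S = {c. \<exists>i. ?r < ?T (i, c)}"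
  proof (intro set_eqI iffI)
    fix c assume "c \<in> ?S"
    then obtain t where t: "?r < t" "t < Suc n" "c = entry_column T t" by auto
    obtain i c' where c': "T (i, c') = t" using standard_filling_cell[OF T, of t] t by auto
    then have "?T (i, c') = t" using t by (simp add: remove_entry_def)
    moreover have "c' = c" using entry_column_eq[OF T c'] t by simp
    ultimately have "?r < ?T (i, c)" using t by simp
    then show "c \<in> {c. \<exists>i. ?r < ?T (i, c)}" by blast
  next
    fix c assume "c \<in> {c. \<exists>i. ?r < ?T (i, c)}"
    then obtain i where i: "?r < ?T (i, c)" by auto
    then have "?T (i, c) = T (i, c)" by (auto simp: remove_entry_def split: if_splits)
    moreover have "?T (i, c) \<le> n" by (rule standard_filling_le[OF T'])
    moreover have "entry_column T (T (i, c)) = c" using i calculation by (intro entry_column_eq[OF T refl]) auto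
    ultimately show "c \<in> ?S" using i by (intro image_eqI[of _ _ "T (i, c)"]) auto
  qed
  have S_sub: "?S \<subseteq> {1..n}"
  proof
    fix c assume "c \<in> ?S"
    then obtain i where "?r < ?T (i, c)" unfolding S by auto
    then have nz: "?T (i, c) \<noteq> 0" by simp
    then show "c \<in> {1..n}"
      using standard_fillingD(2)[OF T' nz] standard_filling_column_le[OF T' nz] standard_filling_le[OF T', of "(i, c)"] by simp
  qed
  obtain l a b where runs: "runs (delta n ?r ?T) = (l, a, b)" by (metis prod_cases3)
  then have is_runs: "is_runs (delta n ?r ?T) (l, a, b)" using is_runs_runs[of n ?r ?T] by simp
  note R = runs_psi[OF is_runs runs S S_sub]
  have l: "num_runs n ?r ?T = l" unfolding num_runs_def runs by simp
  have height: "col_height ?T c0 = i0 - 1"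
  proof -
    have "?T (i, c0) \<noteq> 0 \<longleftrightarrow> i \<in> {1..<i0}" for i
    proof
      assume nz: "?T (i, c0) \<noteq> 0"
      then have "T (i, c0) \<noteq> 0" "T (i, c0) \<noteq> Suc n" by (auto simp: remove_entry_def split: if_splits)
      moreover from this have "i \<noteq> i0" using cell by auto
      moreover have "\<not> i0 < i"
        using standard_fillingD(4)[OF T, of i c0 i0] standard_filling_le[OF T, of "(i, c0)"] cell i0 calculation by auto
      ultimately show "i \<in> {1..<i0}" using standard_fillingD(1)[OF T, of i c0] by auto
    next
      assume "i \<in> {1..<i0}"
      then show "?T (i, c0) \<noteq> 0"
        using standard_fillingD(3,4)[OF T, of i0 c0 i] cell by (auto simp: remove_entry_def)
    qed
    then have "{i. ?T (i, c0) \<noteq> 0} = {1..<i0}" by blast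
    then show ?thesis by (simp add: col_height_def)
  qed
  have restore: "?T((i0, c0) := Suc n) = T"
  proof
    fix x
    show "(?T((i0, c0) := Suc n)) x = T x"
    proof (cases "x = (i0, c0)")
      case False
      have "T x \<noteq> Suc n"
      proof
        assume "T x = Suc n"
        then have "x = (i0, c0)"
          using cell by (rule_tac inj_onD[OF bij_betw_imp_inj_on[OF standard_filling_bij[OF T]]]) auto
        then show False using False by simp
      qed
      then show ?thesis using False by (simp add: remove_entry_def)
    qed (use cell in simp)
  qed
  have add: "T = add_cell n ?r k ?T \<longleftrightarrow> add_col n ?r k ?T = c0" for k
  proof
    assume "add_col n ?r k ?T = c0"
    then show "T = add_cell n ?r k ?T" using height i0 restore by (simp add: add_cell_def Let_def)
  next
    assume eq: "T = add_cell n ?r k ?T"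
    let ?d = "add_col n ?r k ?T"
    have "T (col_height ?T ?d + 1, ?d) = Suc n" by (subst eq) (simp add: add_cell_def Let_def)
    then have "entry_column T (Suc n) = ?d" by (intro entry_column_eq[OF T]) auto
    then show "?d = c0" using c by simp
  qed
  show ?thesis
  proof (cases "\<exists>k\<le>l. T = add_cell n ?r k ?T")
    case True
    then obtain k where k: "k \<le> l" "T = add_cell n ?r k ?T" by blast
    have "(THE k. k \<le> l \<and> T = add_cell n ?r k ?T) = k"
    proof (rule the_equality)
      fix k' assume "k' \<le> l \<and> T = add_cell n ?r k' ?T"
      then show "k' = k" using k l by (intro add_cell_inj[of ?T n k' ?r k] ne) auto
    qed (use k in simp)
    moreover have "psi n ?r k ?T = psi_set ?S ?c" using R(1)[OF k(1)] add[of k] k(2) c by simp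
    ultimately show ?thesis unfolding hess_p.simps(2) Let_def l if_P[OF True] by (simp only:)
  next
    case False
    have "psi_set ?S ?c = 0"
    proof (rule ccontr)
      assume nz: "psi_set ?S ?c \<noteq> 0"
      then have "c0 \<notin> ?S" "c0 = 1 \<or> c0 - 1 \<in> ?S" unfolding c by (auto simp: psi_set_def split: if_splits)
      then obtain k where "k \<le> l" "c0 = add_col n ?r k ?T" using R(2)[OF c0] by blast
      then show False using False add[of k] by auto
    qed
    then show ?thesis unfolding hess_p.simps(2) Let_def l if_not_P[OF False] by (simp only: mult_zero_left)
  qed
qed

lemma hess_p_eq_weight:
  assumes "standard_filling n T" "\<And>i. 1 \<le> i \<Longrightarrow> i \<le> n \<Longrightarrow> i \<le> m i"
  shows "hess_p n m T = colour_weight psi_set (\<lambda>t. n - m (n + 1 - t)) {0<..n} (entry_column T)"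
  using assms
proof (induction n arbitrary: m T)
  case 0
  then show ?case by (simp add: colour_weight_def)
next
  case (Suc n)
  let ?T = "remove_entry (Suc n) T" and ?m = "\<lambda>i. m (i + 1) - 1"
  have "hess_p n ?m ?T = colour_weight psi_set (\<lambda>t. n - ?m (n + 1 - t)) {0<..n} (entry_column ?T)"
  proof (rule Suc.IH)
    show "standard_filling n ?T" by (rule standard_filling_remove[OF Suc.prems(1)])
    show "i \<le> ?m i" if "1 \<le> i" "i \<le> n" for i using Suc.prems(2)[of "i + 1"] that by simp
  qed
  also have "\<dots> = colour_weight psi_set (\<lambda>t. Suc n - m (Suc n + 1 - t)) {0<..n} (entry_column T)"
    unfolding colour_weight_def
  proof (rule prod.cong[OF refl])
    fix t assume t: "t \<in> {0<..n}"
    have "n - ?m (n + 1 - t) = Suc n - m (Suc n + 1 - t)"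
    proof -
      have "n + 1 - t + 1 = Suc n + 1 - t" "Suc n + 1 - t \<le> m (Suc n + 1 - t)" using Suc.prems(2)[of "Suc n + 1 - t"] t by auto
      then show ?thesis using t by simp
    qed
    moreover have "entry_column ?T ` {x<..<t} = entry_column T ` {x<..<t}" for x
      using t by (intro image_cong entry_column_remove[OF Suc.prems(1)]) auto
    moreover have "entry_column ?T t = entry_column T t"
      using t by (intro entry_column_remove[OF Suc.prems(1)]) auto
    ultimately show "psi_set (entry_column ?T ` {n - ?m (n + 1 - t)<..<t}) (entry_column ?T t) =
        psi_set (entry_column T ` {Suc n - m (Suc n + 1 - t)<..<t}) (entry_column T t)" by simp
  qed
  finally have IH: "hess_p n ?m ?T = colour_weight psi_set (\<lambda>t. Suc n - m (Suc n + 1 - t)) {0<..n} (entry_column T)" .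
  have "{0<..Suc n} = insert (Suc n) {0<..n}" by auto
  then have "colour_weight psi_set (\<lambda>t. Suc n - m (Suc n + 1 - t)) {0<..Suc n} (entry_column T) =
    psi_set (entry_column T ` {Suc n - m 1<..<Suc n}) (entry_column T (Suc n)) *
    colour_weight psi_set (\<lambda>t. Suc n - m (Suc n + 1 - t)) {0<..n} (entry_column T)"
    by (simp add: colour_weight_def)
  then show ?case using hess_p_Suc[of n T m] Suc.prems(1) Suc.prems(2)[of 1] by (simp only: IH)
qed

section \<open>Standard tableaux and words\<close>

definition column_height :: "nat list \<Rightarrow> nat \<Rightarrow> nat" where
  "column_height lam c = card {i. (i, c) \<in> diagram lam}"

definition column_word :: "nat \<Rightarrow> tableau \<Rightarrow> nat \<Rightarrow> nat" where
  "column_word n T = restrict (entry_column T) {0<..n}"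

lemma diagram_up:
  assumes "lam \<turnstile>p n" "(i, c) \<in> diagram lam" "1 \<le> i'" "i' \<le> i"
  shows "(i', c) \<in> diagram lam"
proof (cases "i' = i")
  case False
  have "sorted_wrt (\<ge>) lam" using assms(1) by (simp add: partition_of_def)
  then have "lam ! (i - 1) \<le> lam ! (i' - 1)"
    using False assms(2-4) by (intro sorted_wrt_nth_less[of "(\<ge>)" lam "i' - 1" "i - 1"]) (auto simp: diagram_def)
  then show ?thesis using assms(2-4) by (auto simp: diagram_def)
qed (use assms in simp)

lemma diagram_left: "(i, c) \<in> diagram lam \<Longrightarrow> 1 \<le> c' \<Longrightarrow> c' \<le> c \<Longrightarrow> (i, c') \<in> diagram lam"
  by (auto simp: diagram_def)

lemma diagram_pos: "(i, c) \<in> diagram lam \<Longrightarrow> 1 \<le> i \<and> 1 \<le> c"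
  by (simp add: diagram_def)

lemma diagram_column:
  assumes "lam \<turnstile>p n"
  shows "{i. (i, c) \<in> diagram lam} = {1..column_height lam c}"
proof -
  let ?D = "{i. (i, c) \<in> diagram lam}"
  have fin: "finite ?D" by (rule finite_subset[of _ "{..length lam}"]) (auto simp: diagram_def)
  show ?thesis
  proof (cases "?D = {}")
    case False
    have D: "?D = {1..Max ?D}"
    proof (intro set_eqI iffI)
      fix i assume "i \<in> ?D"
      then show "i \<in> {1..Max ?D}" using fin diagram_pos[of i c lam] by simp
    next
      fix i assume i: "i \<in> {1..Max ?D}"
      have "Max ?D \<in> ?D" using fin False by (rule Max_in)
      then show "i \<in> ?D" using i diagram_up[OF assms, of "Max ?D" c i] by simp
    qed
    have "card ?D = card {1..Max ?D}" using D by (rule arg_cong)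
    then have "column_height lam c = Max ?D" by (simp add: column_height_def)
    then show ?thesis using D by (simp only:)
  qed (simp add: column_height_def)
qed

lemma mem_diagram:
  assumes "lam \<turnstile>p n"
  shows "(i, c) \<in> diagram lam \<longleftrightarrow> 1 \<le> i \<and> i \<le> column_height lam c"
  using diagram_column[OF assms, of c] by auto

lemma SYT_standard_filling:
  assumes lam: "lam \<turnstile>p n" and T: "T \<in> SYT lam"
  shows "standard_filling n T" and "{x. T x \<noteq> 0} = diagram lam"
proof -
  have n: "sum_list lam = n" using lam by (simp add: partition_of_def)
  note S = T[unfolded SYT_def mem_Collect_eq n]
  have bij: "bij_betw T (diagram lam) {1..n}" by (rule S[THEN conjunct2, THEN conjunct1])
  have out: "T x = 0" if "x \<notin> diagram lam" for x
    by (rule S[THEN conjunct1, rule_format, OF that])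
  have nz: "0 < T x" if "x \<in> diagram lam" for x using bij_betw_apply[OF bij that] by simp
  show supp: "{x. T x \<noteq> 0} = diagram lam"
  proof (intro set_eqI iffI)
    fix x assume "x \<in> {x. T x \<noteq> 0}"
    then show "x \<in> diagram lam" using out[of x] by (cases "x \<in> diagram lam") simp_all
  next
    fix x assume "x \<in> diagram lam"
    then show "x \<in> {x. T x \<noteq> 0}" using nz[of x] by simp
  qed
  have row: "T (i, c) < T (i, c')" if "(i, c) \<in> diagram lam" "(i, c') \<in> diagram lam" "c < c'" for i c c'
    by (rule S[THEN conjunct2, THEN conjunct2, THEN conjunct1, rule_format, OF that])
  have col: "T (i, c) < T (i', c)" if "(i, c) \<in> diagram lam" "(i', c) \<in> diagram lam" "i < i'" for i i' c
    by (rule S[THEN conjunct2, THEN conjunct2, THEN conjunct2, rule_format, OF that])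
  have "1 \<le> i \<and> 1 \<le> c \<and> (\<forall>i'. 1 \<le> i' \<and> i' < i \<longrightarrow> 0 < T (i', c) \<and> T (i', c) < T (i, c)) \<and>
        (\<forall>c'. 1 \<le> c' \<and> c' < c \<longrightarrow> 0 < T (i, c') \<and> T (i, c') < T (i, c))" if "T (i, c) \<noteq> 0" for i c
  proof -
    have x: "(i, c) \<in> diagram lam" using that supp by blast
    have "0 < T (i', c) \<and> T (i', c) < T (i, c)" if "1 \<le> i'" "i' < i" for i'
    proof -
      have "(i', c) \<in> diagram lam" using diagram_up[OF lam x that(1)] that(2) by simp
      then show ?thesis using nz col[OF _ x that(2)] by blast
    qed
    moreover have "0 < T (i, c') \<and> T (i, c') < T (i, c)" if "1 \<le> c'" "c' < c" for c'
    proof -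
      have "(i, c') \<in> diagram lam" using diagram_left[OF x that(1)] that(2) by simp
      then show ?thesis using nz row[OF _ x that(2)] by blast
    qed
    ultimately show ?thesis using diagram_pos[OF x] by blast
  qed
  moreover have "bij_betw T {x. T x \<noteq> 0} {1..n}" unfolding supp by (rule bij)
  ultimately show "standard_filling n T" unfolding standard_filling_def by blast
qed

text \<open>
  The entries of column \<open>c\<close> up to \<open>T (i, c)\<close> are those in rows \<open>1, \<dots>, i\<close>. Hence the word of a
  tableau determines the row of every entry.
\<close>

lemma letter_count_entry_column:
  assumes "standard_filling n T" "T (i, c) = t" "t \<noteq> 0"
  shows "letter_count (entry_column T) t c = i"
proof -
  note D = standard_fillingD[OF assms(1)]
  have i: "1 \<le> i" using D(1)[of i c] assms by simp
  have tn: "t \<le> n" using standard_filling_le[OF assms(1), of "(i, c)"] assms by simp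
  have nz: "0 < T (j, c) \<and> T (j, c) \<le> t" if "1 \<le> j" "j \<le> i" for j
    using D(3,4)[of i c j] that assms(2,3) by (cases "j = i") auto
  have "bij_betw (\<lambda>j. T (j, c)) {1..i} {s \<in> {0<..t}. entry_column T s = c}"
  proof (rule bij_betw_imageI)
    show "inj_on (\<lambda>j. T (j, c)) {1..i}"
    proof (rule linorder_inj_onI)
      fix j j' assume "j < j'" "j \<in> {1..i}" "j' \<in> {1..i}"
      then show "T (j, c) \<noteq> T (j', c)" using D(4)[of j' c j] nz[of j'] by auto
    qed auto
    show "(\<lambda>j. T (j, c)) ` {1..i} = {s \<in> {0<..t}. entry_column T s = c}"
    proof (intro set_eqI iffI)
      fix s assume "s \<in> (\<lambda>j. T (j, c)) ` {1..i}"
      then obtain j where j: "s = T (j, c)" "1 \<le> j" "j \<le> i" by auto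
      then show "s \<in> {s \<in> {0<..t}. entry_column T s = c}"
        using nz[of j] entry_column_eq[OF assms(1), of j c s] by simp
    next
      fix s assume "s \<in> {s \<in> {0<..t}. entry_column T s = c}"
      then have s: "0 < s" "s \<le> t" "entry_column T s = c" by auto
      obtain j c' where j: "T (j, c') = s" using standard_filling_cell[OF assms(1), of s] s tn by auto
      have "c' = c" using entry_column_eq[OF assms(1) j] s by simp
      moreover have "1 \<le> j" using D(1)[of j c'] j s by simp
      moreover have "\<not> i < j" using D(4)[of j c i] j i s assms(2) \<open>c' = c\<close> by auto
      ultimately show "s \<in> (\<lambda>j. T (j, c)) ` {1..i}" using j by (intro image_eqI[of _ _ j]) auto
    qed
  qed
  then have "card {1..i} = card {s \<in> {0<..t}. entry_column T s = c}" by (rule bij_betw_same_card)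
  then show ?thesis by (simp add: letter_count_def)
qed

lemma column_word_inj:
  assumes "standard_filling n T" "standard_filling n T'" "column_word n T = column_word n T'"
  shows "T = T'"
proof -
  have eq: "entry_column T s = entry_column T' s" if "0 < s" "s \<le> n" for s
    using fun_cong[OF assms(3), of s] that by (simp add: column_word_def)
  have one: "U' x = U x"
    if U: "standard_filling n U" "standard_filling n U'" "U x \<noteq> 0"
      and eq: "\<And>s. 0 < s \<Longrightarrow> s \<le> n \<Longrightarrow> entry_column U s = entry_column U' s" for U U' x
  proof -
    obtain i c where x: "x = (i, c)" by (cases x)
    let ?t = "U x"
    have t: "0 < ?t" "?t \<le> n" using U standard_filling_le by auto
    obtain i' c' where c': "U' (i', c') = ?t" using standard_filling_cell[OF U(2), of ?t] t by auto
    have "c' = c" using entry_column_eq[OF U(1), of i c ?t] entry_column_eq[OF U(2) c'] eq[of ?t] t x by simp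
    moreover have "i' = i"
    proof -
      have "letter_count (entry_column U') ?t c = letter_count (entry_column U) ?t c"
        using t eq by (intro letter_count_cong) auto
      then show ?thesis
        using letter_count_entry_column[OF U(1), of i c ?t] letter_count_entry_column[OF U(2), of i' c ?t] c' \<open>c' = c\<close> t x
        by simp
    qed
    ultimately show ?thesis using c' x by simp
  qed
  show ?thesis
  proof
    fix x
    show "T x = T' x"
    proof (cases "T x = 0 \<and> T' x = 0")
      case False
      then show ?thesis using one[OF assms(1,2), of x] one[OF assms(2,1), of x] eq by fastforce
    qed simp
  qed
qed

lemma letter_count_attained:
  assumes "1 \<le> i" "i \<le> letter_count w n c"
  obtains t where "0 < t" "t \<le> n" "w t = c" "letter_count w t c = i"
  using assms(2)
proof (induction n arbitrary: thesis)
  case (Suc n)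
  show ?case
  proof (cases "i \<le> letter_count w n c")
    case True
    then show ?thesis using Suc.IH[OF _ True] Suc.prems(1) by (metis le_SucI)
  next
    case False
    then have "w (Suc n) = c" "letter_count w (Suc n) c = i" using Suc.prems(2) by (auto simp: letter_count_Suc split: if_splits)
    then show ?thesis using Suc.prems(1)[of "Suc n"] by simp
  qed
qed (use assms(1) in simp)

lemma letter_count_less:
  assumes "t < t'" "w t' = c"
  shows "letter_count w t c < letter_count w t' c"
  using letter_count_mono(2)[of t t' c w] assms by force

text \<open>
  Entry \<open>t\<close> is placed in column \<open>w t\<close>, in the row given by the number of occurrences of this letter so
  far. The lattice condition makes the rows increase.
\<close>

lemma lattice_word_SYT:
  assumes lam: "lam \<turnstile>p n"
    and w: "w \<in> {0<..n} \<rightarrow>\<^sub>E {1..N}" "\<And>c. letter_count w n c = column_height lam c"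
    and lattice: "\<And>m c. m \<le> n \<Longrightarrow> 0 < c \<Longrightarrow> letter_count w m (Suc c) \<le> letter_count w m c"
  obtains T where "T \<in> SYT lam" "column_word n T = w"
proof -
  have n: "sum_list lam = n" using lam by (simp add: partition_of_def)
  let ?cell = "\<lambda>t. (letter_count w t (w t), w t)"
  have inj: "inj_on ?cell {0<..n}"
  proof (rule linorder_inj_onI)
    fix s t :: nat assume "s < t" "s \<in> {0<..n}" "t \<in> {0<..n}"
    then show "?cell s \<noteq> ?cell t" using letter_count_less[of s t w "w t"] by auto
  qed auto
  have image: "?cell ` {0<..n} = diagram lam"
  proof (intro set_eqI iffI)
    fix x assume "x \<in> ?cell ` {0<..n}"
    then obtain t where t: "0 < t" "t \<le> n" "x = ?cell t" by auto
    have "1 \<le> letter_count w t (w t)" using letter_count_less[of 0 t w "w t"] t by simp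
    moreover have "letter_count w t (w t) \<le> column_height lam (w t)"
      using letter_count_mono(1)[OF t(2), of w "w t"] w(2) by simp
    ultimately show "x \<in> diagram lam" unfolding t(3) mem_diagram[OF lam] by blast
  next
    fix x assume "x \<in> diagram lam"
    then obtain i c where x: "x = (i, c)" "1 \<le> i" "i \<le> letter_count w n c"
      using mem_diagram[OF lam] w(2) by (cases x) auto
    then obtain t where "0 < t" "t \<le> n" "w t = c" "letter_count w t c = i" using letter_count_attained by metis
    then show "x \<in> ?cell ` {0<..n}" using x by (intro image_eqI[of _ _ t]) auto
  qed
  define T where "T x = (if x \<in> diagram lam then the_inv_into {0<..n} ?cell x else 0)" for x
  have Tcell: "T (?cell t) = t" if "t \<in> {0<..n}" for t
  proof -
    have "?cell t \<in> diagram lam" using image that by blast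
    then show ?thesis using the_inv_into_f_f[OF inj that] by (simp add: T_def)
  qed
  have cellT: "?cell (T x) = x" "T x \<in> {0<..n}" if x: "x \<in> diagram lam" for x
  proof -
    obtain t where t: "t \<in> {0<..n}" "x = ?cell t" using x image by blast
    then have "T x = t" using Tcell by simp
    then show "?cell (T x) = x" "T x \<in> {0<..n}" using t by simp_all
  qed
  have coords: "w (T (i, c)) = c" "letter_count w (T (i, c)) c = i" if "(i, c) \<in> diagram lam" for i c
    using cellT(1)[OF that] by auto
  have chain: "letter_count w m (c + d) \<le> letter_count w m c" if "m \<le> n" "0 < c" for m c d
  proof (induction d)
    case (Suc d)
    then show ?case using lattice[of m "c + d"] that by simp
  qed simp
  have "T \<in> SYT lam" unfolding SYT_def n
  proof (intro CollectI conjI allI impI)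
    show "T x = 0" if "x \<notin> diagram lam" for x using that by (simp add: T_def)
    show "bij_betw T (diagram lam) {1..n}"
    proof (rule bij_betw_byWitness[where f' = ?cell])
      show "\<forall>x\<in>diagram lam. ?cell (T x) = x" using cellT(1) by blast
      show "\<forall>t\<in>{1..n}. T (?cell t) = t" using Tcell by simp
      show "T ` diagram lam \<subseteq> {1..n}"
      proof
        fix t assume "t \<in> T ` diagram lam"
        then have "t \<in> {0<..n}" using cellT(2) by blast
        then show "t \<in> {1..n}" by simp
      qed
      show "?cell ` {1..n} \<subseteq> diagram lam"
      proof -
        have "{1..n} = {0<..n}" by auto
        then show ?thesis using image by simp
      qed
    qed
    show "T (i, c) < T (i', c)" if "(i, c) \<in> diagram lam" "(i', c) \<in> diagram lam" "i < i'" for i i' c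
    proof (rule ccontr)
      assume "\<not> T (i, c) < T (i', c)"
      then have "letter_count w (T (i', c)) c \<le> letter_count w (T (i, c)) c" by (intro letter_count_mono) simp
      then show False using coords that by simp
    qed
    show "T (i, c) < T (i, c')" if "(i, c) \<in> diagram lam" "(i, c') \<in> diagram lam" "c < c'" for i c c'
    proof (rule ccontr)
      assume "\<not> T (i, c) < T (i, c')"
      moreover have "T (i, c) \<noteq> T (i, c')" using coords(1)[OF that(1)] coords(1)[OF that(2)] that(3) by auto
      ultimately have less: "T (i, c') < T (i, c)" by simp
      have "i = letter_count w (T (i, c')) c'" using coords(2)[OF that(2)] by simp
      also have "\<dots> \<le> letter_count w (T (i, c')) c"
        using chain[of "T (i, c')" c "c' - c"] cellT(2)[OF that(2)] diagram_pos[OF that(1)] that(3) by simp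
      also have "\<dots> < letter_count w (T (i, c)) c"
        using less coords(1)[OF that(1)] by (rule letter_count_less)
      also have "\<dots> = i" using coords(2)[OF that(1)] .
      finally show False by simp
    qed
  qed
  moreover have "column_word n T = w"
  proof
    fix t
    show "column_word n T t = w t"
    proof (cases "t \<in> {0<..n}")
      case True
      have "entry_column T t = w t"
        using entry_column_eq[OF SYT_standard_filling(1)[OF lam \<open>T \<in> SYT lam\<close>] Tcell[OF True]] True by simp
      then show ?thesis using True by (simp add: column_word_def)
    next
      case False
      have "w t = undefined" using PiE_arb[OF w(1) False] .
      then show ?thesis unfolding column_word_def restrict_apply using False by (simp only: if_False)
    qed
  qed
  ultimately show thesis by (rule that)
qed

lemma prod_qint_entry_column:
  assumes lam: "lam \<turnstile>p n" and T: "T \<in> SYT lam"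
  shows "(\<Prod>t\<in>{0<..n}. qint (entry_column T t)) = prod_list (map qfact lam)"
proof -
  note F = SYT_standard_filling[OF lam T]
  have bij: "bij_betw T (diagram lam) {0<..n}"
  proof -
    have "{0<..n} = {1..n}" by auto
    then show ?thesis using standard_filling_bij[OF F(1)] F(2) by simp
  qed
  have "(\<Prod>t\<in>{0<..n}. qint (entry_column T t)) = (\<Prod>x\<in>diagram lam. qint (entry_column T (T x)))"
    using bij by (rule prod.reindex_bij_betw[symmetric])
  also have "\<dots> = (\<Prod>x\<in>diagram lam. qint (snd x))"
  proof (rule prod.cong[OF refl])
    fix x assume x: "x \<in> diagram lam"
    obtain i c where ic: "x = (i, c)" by (cases x)
    have "T (i, c) \<noteq> 0" using x F(2) ic by blast
    then show "qint (entry_column T (T x)) = qint (snd x)" using entry_column_eq[OF F(1) refl] ic by simp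
  qed
  also have "diagram lam = Sigma {1..length lam} (\<lambda>i. {1..lam ! (i - 1)})"
    by (auto simp: diagram_def)
  also have "(\<Prod>x\<in>Sigma {1..length lam} (\<lambda>i. {1..lam ! (i - 1)}). qint (snd x)) =
      (\<Prod>i=1..length lam. \<Prod>c=1..lam ! (i - 1). qint c)"
    by (subst prod.Sigma) (simp_all add: case_prod_beta)
  also have "\<dots> = (\<Prod>i<length lam. qfact (lam ! i))"
    unfolding qfact_def by (simp add: prod.atLeast1_atMost_eq)
  also have "\<dots> = prod_list (map qfact lam)"
    by (simp add: prod.list_conv_set_nth atLeast0LessThan)
  finally show ?thesis .
qed

text \<open>
  Words of nonzero weight satisfy the lattice condition, so they are exactly the words of tableaux of
  nonzero weight. The factor \<open>\<Prod>\<^sub>i [\<lambda>\<^sub>i]!\<close> is the product of \<open>[c]\<close> over all cells, \<open>c\<close> being the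
  column of the cell, and is thus spread over the letters of the word.
\<close>

lemma coeff_c_eq_last_letter_sum:
  assumes n: "0 < n" "n \<le> N" and lam: "lam \<turnstile>p n" and m: "hessenberg n m"
  defines "r \<equiv> \<lambda>t. n - m (n + 1 - t)"
  shows "coeff_c lam k m = last_letter_sum r N n (column_height lam) k" and "reach_fun 0 n r"
proof -
  have sum: "sum_list lam = n" using lam by (simp add: partition_of_def)
  have mi: "i \<le> m i" "m i \<le> n" if "1 \<le> i" "i \<le> n" for i using m that by (auto simp: hessenberg_def)
  show reach: "reach_fun 0 n r"
  proof -
    have "r s \<le> r t" if "0 < s" "s \<le> t" "t \<le> n" for s t
    proof -
      have "m (n + 1 - t) \<le> m (n + 1 - s)"
        using m that unfolding hessenberg_def by (auto intro!: mono_onD[of "{1..n}" m])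
      then show ?thesis unfolding r_def by simp
    qed
    moreover have "r t < t" if "0 < t" "t \<le> n" for t
    proof -
      have "n + 1 - t \<le> m (n + 1 - t)" using that by (intro mi) simp_all
      then show ?thesis unfolding r_def using that by linarith
    qed
    ultimately show ?thesis by (auto simp: reach_fun_def mono_on_def)
  qed
  let ?S = "SYT_col k lam"
  let ?H = "{w. w \<in> {0<..n} \<rightarrow>\<^sub>E {1..N} \<and> (\<forall>c. letter_count w n c = column_height lam c) \<and> w n = k}"
  have filling: "standard_filling n T" if "T \<in> ?S" for T
    using SYT_standard_filling(1)[OF lam, of T] that by (simp add: SYT_col_def)
  have weight: "psi_weight r n (column_word n T) = prod_list (map qfact lam) * hess_p n m T" if T: "T \<in> ?S" for T
  proof -
    have "psi_weight r n (column_word n T) = psi_weight r n (entry_column T)"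
      unfolding psi_weight_def by (rule colour_weight_cong) (auto simp: column_word_def)
    also have "\<dots> = (\<Prod>t\<in>{0<..n}. qint (entry_column T t)) * colour_weight psi_set r {0<..n} (entry_column T)"
      unfolding psi_weight_def colour_weight_def by (simp only: prod.distrib mult.commute)
    also have "(\<Prod>t\<in>{0<..n}. qint (entry_column T t)) = prod_list (map qfact lam)"
      using T by (intro prod_qint_entry_column[OF lam]) (simp add: SYT_col_def)
    also have "colour_weight psi_set r {0<..n} (entry_column T) = hess_p n m T"
      unfolding r_def using hess_p_eq_weight[OF filling[OF T], of m] mi by simp
    finally show ?thesis .
  qed
  have sub: "column_word n ` ?S \<subseteq> ?H"
  proof (rule image_subsetI)
    fix T assume T: "T \<in> ?S"
    note F = filling[OF T]
    have TS: "T \<in> SYT lam" using T by (simp add: SYT_col_def)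
    obtain i where i: "T (i, k) = n" using T sum by (auto simp: SYT_col_def)
    have "entry_column T t \<in> {1..N}" if t: "t \<in> {0<..n}" for t
    proof -
      obtain i c where c: "T (i, c) = t" using standard_filling_cell[OF F, of t] t by auto
      then have "entry_column T t = c" using entry_column_eq[OF F c] that by simp
      moreover have "T (i, c) \<noteq> 0" using c that by simp
      ultimately show ?thesis
        using standard_fillingD(2)[OF F, of i c] standard_filling_column_le[OF F, of i c] c that n by simp
    qed
    then have "column_word n T \<in> {0<..n} \<rightarrow>\<^sub>E {1..N}" unfolding column_word_def by (rule restrict_PiE_iff[THEN iffD2, OF ballI])
    moreover have "letter_count (column_word n T) n c = column_height lam c" for c
    proof -
      have "letter_count (column_word n T) n c = letter_count (entry_column T) n c"
        by (rule letter_count_cong) (simp add: column_word_def)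
      also have "\<dots> = card {t \<in> {0<..n}. entry_column T t = c}" by (simp add: letter_count_def)
      also have "\<dots> = card ((\<lambda>i. T (i, c)) ` {i. (i, c) \<in> diagram lam})"
      proof (rule arg_cong[of _ _ card], intro set_eqI iffI)
        fix t assume "t \<in> {t \<in> {0<..n}. entry_column T t = c}"
        then have t: "0 < t" "t \<le> n" "entry_column T t = c" by auto
        obtain i c' where c': "T (i, c') = t" using standard_filling_cell[OF F, of t] t by auto
        then have "c' = c" using entry_column_eq[OF F c'] t by simp
        moreover have "(i, c') \<in> diagram lam" using SYT_standard_filling(2)[OF lam TS] c' t by auto
        ultimately show "t \<in> (\<lambda>i. T (i, c)) ` {i. (i, c) \<in> diagram lam}" using c' by blast
      next
        fix t assume "t \<in> (\<lambda>i. T (i, c)) ` {i. (i, c) \<in> diagram lam}"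
        then obtain i where i: "t = T (i, c)" "(i, c) \<in> diagram lam" by blast
        have "t \<noteq> 0" using i SYT_standard_filling(2)[OF lam TS] by blast
        then show "t \<in> {t \<in> {0<..n}. entry_column T t = c}"
          using i entry_column_eq[OF F, of i c t] standard_filling_le[OF F, of "(i, c)"] by simp
      qed
      also have "\<dots> = column_height lam c"
        unfolding column_height_def
      proof (rule card_image, rule inj_onI)
        fix i j assume ij: "i \<in> {i. (i, c) \<in> diagram lam}" "j \<in> {i. (i, c) \<in> diagram lam}" "T (i, c) = T (j, c)"
        have "inj_on T (diagram lam)"
          using bij_betw_imp_inj_on[OF standard_filling_bij[OF F]] SYT_standard_filling(2)[OF lam TS] by simp
        from inj_onD[OF this ij(3)] ij show "i = j" by simp
      qed
      finally show ?thesis .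
    qed
    moreover have "column_word n T n = k"
      using entry_column_eq[OF F i] n by (simp add: column_word_def)
    ultimately show "column_word n T \<in> ?H" by blast
  qed
  have zero: "psi_weight r n w = 0" if w: "w \<in> ?H - column_word n ` ?S" for w
  proof (rule ccontr)
    assume nz: "psi_weight r n w \<noteq> 0"
    have H: "w \<in> {0<..n} \<rightarrow>\<^sub>E {1..N}" "\<And>c. letter_count w n c = column_height lam c" "w n = k" using w by auto
    have "letter_count w m' (Suc c) \<le> letter_count w m' c" if "m' \<le> n" "0 < c" for m' c
      using psi_word_lattice[OF reach _ that, of qint w] nz by (simp add: psi_weight_def)
    then obtain T where T: "T \<in> SYT lam" "column_word n T = w"
      using lattice_word_SYT[OF lam H(1,2)] by blast
    note F = SYT_standard_filling[OF lam T(1)]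
    obtain i c where c: "T (i, c) = n" using standard_filling_cell[OF F(1), of n] n by auto
    have "c = k" using entry_column_eq[OF F(1) c] fun_cong[OF T(2), of n] H(3) n by (simp add: column_word_def)
    moreover have "(i, c) \<in> diagram lam" using c n F(2) by auto
    ultimately have "T \<in> ?S" using T(1) c sum by (auto simp: SYT_col_def)
    then show False using w T(2) by blast
  qed
  have "finite ({0<..n} \<rightarrow>\<^sub>E {1..N})" by (intro finite_PiE) auto
  then have fin: "finite ?H" by (rule finite_subset[rotated]) auto
  have inj: "inj_on (column_word n) ?S"
    using filling by (intro inj_onI column_word_inj) auto
  have "coeff_c lam k m = (\<Sum>T\<in>?S. prod_list (map qfact lam) * hess_p n m T)"
    unfolding coeff_c_def sum by (rule sum_distrib_left)
  also have "\<dots> = (\<Sum>T\<in>?S. psi_weight r n (column_word n T))" using weight by simp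
  also have "\<dots> = sum (psi_weight r n) (column_word n ` ?S)" using inj by (simp add: sum.reindex)
  also have "\<dots> = sum (psi_weight r n) ?H" using fin sub zero by (intro sum.mono_neutral_left) auto
  finally show "coeff_c lam k m = last_letter_sum r N n (column_height lam) k"
    by (simp only: last_letter_sum_def)
qed

theorem corollary1p10:
  fixes n k :: nat and m :: "nat \<Rightarrow> nat" and lam :: "nat list"
  assumes "n \<ge> 1" and "hessenberg n m" and "lam \<turnstile>p n" and "1 \<le> k" and "k \<le> n"
  shows "\<exists>P :: rat poly. coeff_c lam k m / qint k = to_fract P"
proof -
  have n: "0 < n" "n \<le> 2 * n + 2" using assms(1) by simp_all
  note C = coeff_c_eq_last_letter_sum[OF n assms(3,2)]
  have "coeff_c lam k m / qint k \<in> polynomials"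
    unfolding C(1) using last_letter_quotient_polynomial[OF C(2) n(1), of k] assms(4)
    by (simp add: last_letter_quotient_def)
  then show ?thesis by (auto simp: polynomials_def)
qed

end
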